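(* Let $s,M,p$ be positive integers and let $a_{ij},b_i$ ($1\le i,j\le s$) be real numbers with $c_i=\sum_{j=1}^sa_{ij}$, such that the underlying (classical) Runge–Kutta method with coefficients $(a_{ij},b_i,c_i)$ is of order $p$. Let $\psi(\cdot,t)$ be a solution on $[t_n,t_n+T_0]$, $T_0>0$, of the periodic derivative nonlinear Schrödinger equation $\mathrm i\partial_t\psi=-\partial_{xx}\psi-\mathrm i\,\partial_x(|\psi|^2\psi)$ that is smooth enough, i.e. $\psi\in C([t_n,t_n+T_0];H^r_{\rm per}(\Omega))$ with $r$ sufficiently large depending only on $M$ and $p$. Put $\psi^n=\psi(\cdot,t_n)$ and assume $\det (J_{\boldsymbol\alpha}{\bf G})(0,{\bf 0})\neq0$. Then the semi-discrete multi-structures-preserving (mSP) method described in the context has order $\hat p=\min\{p,M+1\}$ in time, in the sense of local truncation error: the numerical solution $\psi^{n+1}$ produced from $\psi^n$ with step $\tau$ satisfies $$\|\psi^{n+1}-\psi(\cdot,t_n+\tau)\|_{L^2(\Omega)}=\mathcal O(\tau^{\hat p+1})\qquad\text{as }\tau\to0^+ .$$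
   Context: $\Omega=[a,b]\subset\mathbb R$ is a bounded interval with periodic boundary conditions; $H^r_{\rm per}(\Omega)$ is the Sobolev space of $(b-a)$-periodic complex-valued functions; $(f,g)=\int_a^b f g^*dx$; $^*$ is complex conjugation, $\Re,\Im$ real and imaginary parts. Write $\mathcal L=\mathrm i\,\partial_{xx}$, $\mathcal N[\psi]=-\partial_x(|\psi|^2\psi)$, so the equation is $\partial_t\psi=\mathcal L\psi+\mathcal N[\psi]$; $\exp(t\mathcal L)$ is the unitary group generated by $\mathcal L$. Functionals: $\mathcal M[\psi]=\int_a^b|\psi|^2dx$; $\mathcal E[\psi]=\int_a^b\big(|\partial_x\psi|^2-\tfrac32\Im(|\psi|^2\psi\,\partial_x\psi^* )+\tfrac12|\psi|^6\big)dx$; $\mathcal P[\psi]=\int_a^b\big(\Im(\psi^*\psi_x)+\tfrac12|\psi|^4\big)dx$. Their variational derivatives: $g_1[\psi]=\frac{\delta\mathcal E}{\delta\psi^*}=-\partial_{xx}\psi-3\mathrm i|\psi|^2\partial_x\psi+\tfrac32|\psi|^4\psi$, $g_2[\psi]=\frac{\delta\mathcal M}{\delta\psi^*}=\psi$, $g_3[\psi]=\frac{\delta\mathcal P}{\delta\psi^*}=-\mathrm i\psi_x+|\psi|^2\psi$. The mSP method, one step from $\psi^n$ with step size $\tau$: Prediction: $\psi_{ni}^{(0)}=\exp(c_i\tau\mathcal L)\psi^n$ and for $\ell=0,\dots,M-1$, $\psi_{ni}^{(\ell+1)}=\exp(c_i\tau\mathcal L)\psi^n+\tau\sum_{j=1}^s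 a_{ij}\exp((c_i-c_j)\tau\mathcal L)\mathcal N[\psi_{nj}^{(\ell)}]$, $1\le i\le s$. Correction: $k_i=\mathcal N[\psi_{ni}^{(M)}]+\sum_{j=1}^3\beta_j^n g_j[\psi_{ni}^{(M)}]$ and $\psi^{n+1}=\exp(\tau\mathcal L)\psi^n+\tau\sum_{i=1}^s b_i\exp((1-c_i)\tau\mathcal L)k_i$, where the real numbers $\beta_1^n,\beta_2^n,\beta_3^n$ are chosen such that $\mathcal E[\psi^{n+1}]=\mathcal E[\psi^n]$, $\mathcal M[\psi^{n+1}]=\mathcal M[\psi^n]$, $\mathcal P[\psi^{n+1}]=\mathcal P[\psi^n]$. Equivalently, with $\alpha_j=\tau\beta_j^n$, $\psi^{n+1}=\widehat\psi^{n+1}+\sum_{j=1}^3\alpha_j\Gamma_j^n$, where $\widehat\psi^{n+1}=\exp(\tau\mathcal L)\psi^n+\tau\sum_i b_i\exp((1-c_i)\tau\mathcal L)\mathcal N[\psi_{ni}^{(M)}]$ and $\Gamma_j^n=\sum_i b_i\exp((1-c_i)\tau\mathcal L)g_j[\psi_{ni}^{(M)}]$, and $\boldsymbol\alpha=(\alpha_1,\alpha_2,\alpha_3)^\top$ solves ${\bf G}(\tau,\boldsymbol\alpha)={\bf 0}$ with $${\bf G}(\tau,\boldsymbol\alpha)=\Big(\mathcal E[\widehat\psi^{n+1}+\textstyle\sum_j\alpha_j\Gamma_j^n]-\mathcal E[\psi^n],\ \mathcal M[\widehat\psi^{n+1}+\sum_j\alpha_j\Gamma_j^n]-\mathcal M[\psi^n],\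 \mathcal P[\widehat\psi^{n+1}+\sum_j\alpha_j\Gamma_j^n]-\mathcal P[\psi^n]\Big)^\top.$$ For small $\tau$, $\boldsymbol\alpha=\boldsymbol\alpha(\tau)$ denotes the solution that is unique in a fixed neighbourhood of ${\bf 0}\in\mathbb R^3$ (it exists when $(J_{\boldsymbol\alpha}{\bf G})(0,{\bf 0})$ is nonsingular, by the implicit function theorem; $\boldsymbol\alpha(0)={\bf 0}$ and $\boldsymbol\alpha$ is continuous at $0$). $J_{\boldsymbol\alpha}{\bf G}=\partial{\bf G}/\partial\boldsymbol\alpha$; at $(0,{\bf 0})$ it equals $2\big[\Re(g_k[\psi^n],g_j[\psi^n])\big]_{k,j=1}^3$ (since $\sum_ib_i=1$ for a Runge–Kutta method of order $p\ge1$). "Order $p$" of the underlying Runge–Kutta method means the usual order for smooth ordinary differential equations (local error $\mathcal O(\tau^{p+1})$); it is the method obtained by setting $\mathcal L=0$ in the Lawson Runge–Kutta method. *)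

theory Defs
  imports "HOL-Analysis.Analysis" "HOL-Library.Landau_Symbols"
begin

section \<open>Periodic functions and Sobolev spaces\<close>

text \<open>
  A function on the periodic interval \<open>[a,b]\<close> is represented by its \<open>(b-a)\<close>-periodic extension
  to the whole real line.
\<close>

definition periodic_fun :: "real \<Rightarrow> real \<Rightarrow> (real \<Rightarrow> complex) \<Rightarrow> bool" where
  "periodic_fun a b f \<longleftrightarrow> (\<forall>x. f (x + (b - a)) = f x)"

definition L2_norm_on :: "real \<Rightarrow> real \<Rightarrow> (real \<Rightarrow> complex) \<Rightarrow> real" where
  "L2_norm_on a b f = sqrt (integral {a..b} (\<lambda>x. (cmod (f x))\<^sup>2))"

definition wavenumber :: "real \<Rightarrow> real \<Rightarrow> int \<Rightarrow> real" where
  "wavenumber a b k = 2 * pi * of_int k / (b - a)"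

definition fourier_coeff :: "real \<Rightarrow> real \<Rightarrow> (real \<Rightarrow> complex) \<Rightarrow> int \<Rightarrow> complex" where
  "fourier_coeff a b f k =
     complex_of_real (1 / (b - a)) * integral {a..b} (\<lambda>x. f x * cis (- (wavenumber a b k * x)))"

definition H_per :: "real \<Rightarrow> real \<Rightarrow> real \<Rightarrow> (real \<Rightarrow> complex) set" where
  "H_per a b r = {f. periodic_fun a b f \<and>
     f absolutely_integrable_on {a..b} \<and> (\<lambda>x. (cmod (f x))\<^sup>2) integrable_on {a..b} \<and>
     (\<lambda>k. (1 + (wavenumber a b k)\<^sup>2) powr r * (cmod (fourier_coeff a b f k))\<^sup>2) summable_on UNIV}"

definition H_per_norm :: "real \<Rightarrow> real \<Rightarrow> real \<Rightarrow> (real \<Rightarrow> complex) \<Rightarrow> real" where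
  "H_per_norm a b r f = sqrt ((b - a) *
     infsum (\<lambda>k. (1 + (wavenumber a b k)\<^sup>2) powr r * (cmod (fourier_coeff a b f k))\<^sup>2) UNIV)"

definition C_H_per ::
  "real \<Rightarrow> real \<Rightarrow> real \<Rightarrow> real set \<Rightarrow> (real \<Rightarrow> real \<Rightarrow> complex) \<Rightarrow> bool" where
  "C_H_per a b r I \<psi> \<longleftrightarrow> (\<forall>t\<in>I. \<psi> t \<in> H_per a b r) \<and>
     (\<forall>t\<in>I. ((\<lambda>u. H_per_norm a b r (\<lambda>x. \<psi> u x - \<psi> t x)) \<longlongrightarrow> 0) (at t within I))"

section \<open>The derivative nonlinear Schroedinger equation\<close>

definition dx :: "(real \<Rightarrow> complex) \<Rightarrow> real \<Rightarrow> complex" where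
  "dx f x = vector_derivative f (at x)"

text \<open>
  The unitary group generated by \<open>\<L> = \<i> \<partial>\<^sub>x\<^sub>x\<close>, as a Fourier multiplier: \<open>\<L>\<close> acts on the mode
  \<open>exp (\<i> \<mu> x)\<close> as multiplication by \<open>-\<i> \<mu>\<^sup>2\<close>.  The series is summed pointwise, which yields the
  continuous representative whenever the Fourier coefficients are summable
  (in particular on \<open>H_per a b r\<close> for \<open>r > 1/2\<close>).
\<close>

definition expL :: "real \<Rightarrow> real \<Rightarrow> real \<Rightarrow> (real \<Rightarrow> complex) \<Rightarrow> real \<Rightarrow> complex" where
  "expL a b t f x =
     infsum (\<lambda>k. cis (- (t * (wavenumber a b k)\<^sup>2)) * fourier_coeff a b f k *
                 cis (wavenumber a b k * x)) UNIV"

definition nonlin :: "(real \<Rightarrow> complex) \<Rightarrow> real \<Rightarrow> complex" where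
  "nonlin \<psi> x = - dx (\<lambda>y. complex_of_real ((cmod (\<psi> y))\<^sup>2) * \<psi> y) x"

text \<open>
  Elements of Sobolev spaces are functions here, not classes modulo null sets, so the continuous
  representative of each \<open>\<psi> t\<close> is required explicitly.  Applied to \<open>C([t0,t1]; H\<^sup>r)\<close> with \<open>r\<close> large,
  the equation holds classically at every point; the time derivative is one-sided at the end points.
\<close>

definition dnls_solution :: "real set \<Rightarrow> (real \<Rightarrow> real \<Rightarrow> complex) \<Rightarrow> bool" where
  "dnls_solution I \<psi> \<longleftrightarrow> (\<forall>t\<in>I. continuous_on UNIV (\<psi> t)) \<and>
     (\<forall>t\<in>I. \<forall>x. \<exists>D. ((\<lambda>u. \<psi> u x) has_vector_derivative D) (at t within I) \<and>
        \<i> * D = - dx (dx (\<psi> t)) x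
                - \<i> * dx (\<lambda>y. complex_of_real ((cmod (\<psi> t y))\<^sup>2) * \<psi> t y) x)"

definition mass :: "real \<Rightarrow> real \<Rightarrow> (real \<Rightarrow> complex) \<Rightarrow> real" where
  "mass a b \<psi> = integral {a..b} (\<lambda>x. (cmod (\<psi> x))\<^sup>2)"

definition energy :: "real \<Rightarrow> real \<Rightarrow> (real \<Rightarrow> complex) \<Rightarrow> real" where
  "energy a b \<psi> = integral {a..b} (\<lambda>x. (cmod (dx \<psi> x))\<^sup>2
     - 3/2 * Im (complex_of_real ((cmod (\<psi> x))\<^sup>2) * \<psi> x * cnj (dx \<psi> x))
     + 1/2 * (cmod (\<psi> x)) ^ 6)"

definition momentum :: "real \<Rightarrow> real \<Rightarrow> (real \<Rightarrow> complex) \<Rightarrow> real" where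
  "momentum a b \<psi> = integral {a..b} (\<lambda>x. Im (cnj (\<psi> x) * dx \<psi> x) + 1/2 * (cmod (\<psi> x)) ^ 4)"

definition grad_energy :: "(real \<Rightarrow> complex) \<Rightarrow> real \<Rightarrow> complex" where
  "grad_energy \<psi> x = - dx (dx \<psi>) x
     - 3 * \<i> * complex_of_real ((cmod (\<psi> x))\<^sup>2) * dx \<psi> x
     + 3/2 * complex_of_real ((cmod (\<psi> x)) ^ 4) * \<psi> x"

definition grad_mass :: "(real \<Rightarrow> complex) \<Rightarrow> real \<Rightarrow> complex" where
  "grad_mass \<psi> x = \<psi> x"

definition grad_momentum :: "(real \<Rightarrow> complex) \<Rightarrow> real \<Rightarrow> complex" where
  "grad_momentum \<psi> x = - \<i> * dx \<psi> x + complex_of_real ((cmod (\<psi> x))\<^sup>2) * \<psi> x"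

definition grad :: "3 \<Rightarrow> (real \<Rightarrow> complex) \<Rightarrow> real \<Rightarrow> complex" where
  "grad j = (if j = 1 then grad_energy else if j = 2 then grad_mass else grad_momentum)"

definition invariants :: "real \<Rightarrow> real \<Rightarrow> (real \<Rightarrow> complex) \<Rightarrow> real ^ 3" where
  "invariants a b \<psi> = vector [energy a b \<psi>, mass a b \<psi>, momentum a b \<psi>]"

section \<open>Order of the underlying Runge-Kutta method\<close>

text \<open>
  All dimensions \<open>d\<close> have to be covered by one predicate, so \<open>\<real>\<^sup>d\<close> is modelled inside \<open>nat \<Rightarrow> real\<close>
  by the coordinates with index below \<open>d\<close>.  A scalar function on \<open>\<real>\<^sup>d\<close> is a function that depends on
  these coordinates only; its continuity is then the same as continuity for the product topology.
\<close>

definition partial_deriv :: "nat \<Rightarrow> ((nat \<Rightarrow> real) \<Rightarrow> real) \<Rightarrow> (nat \<Rightarrow> real) \<Rightarrow> real" where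
  "partial_deriv i f y = deriv (\<lambda>u. f (y(i := u))) (y i)"

definition iter_partial :: "nat list \<Rightarrow> ((nat \<Rightarrow> real) \<Rightarrow> real) \<Rightarrow> (nat \<Rightarrow> real) \<Rightarrow> real" where
  "iter_partial js f = foldr partial_deriv js f"

definition smooth_on_Rd :: "nat \<Rightarrow> ((nat \<Rightarrow> real) \<Rightarrow> real) \<Rightarrow> bool" where
  "smooth_on_Rd d f \<longleftrightarrow>
     (\<forall>y z. (\<forall>i<d. y i = z i) \<longrightarrow> f y = f z) \<and>
     (\<forall>js. set js \<subseteq> {..<d} \<longrightarrow>
        continuous_on UNIV (iter_partial js f) \<and>
        (\<forall>i<d. \<forall>y. (\<lambda>u. iter_partial js f (y(i := u))) differentiable (at (y i))))"

definition ode_solution ::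
  "nat \<Rightarrow> ((nat \<Rightarrow> real) \<Rightarrow> nat \<Rightarrow> real) \<Rightarrow> real \<Rightarrow> (real \<Rightarrow> nat \<Rightarrow> real) \<Rightarrow> bool" where
  "ode_solution d f T y \<longleftrightarrow>
     (\<forall>t\<in>{0..T}. \<forall>m<d. ((\<lambda>u. y u m) has_real_derivative f (y t) m) (at t within {0..T}))"

definition rk_stages ::
  "nat \<Rightarrow> (nat \<Rightarrow> nat \<Rightarrow> real) \<Rightarrow> nat \<Rightarrow> ((nat \<Rightarrow> real) \<Rightarrow> nat \<Rightarrow> real) \<Rightarrow> (nat \<Rightarrow> real) \<Rightarrow> real \<Rightarrow>
   (nat \<Rightarrow> nat \<Rightarrow> real) \<Rightarrow> bool" where
  "rk_stages s A d f y0 \<tau> Y \<longleftrightarrow>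
     (\<forall>i<s. \<forall>m<d. Y i m = y0 m + \<tau> * (\<Sum>j<s. A i j * f (Y j) m))"

text \<open>
  \<open>A\<close> may be a full matrix (implicit method); the stage vectors are then the solution branch \<open>Y \<tau>\<close>
  of the stage equations that tends to the initial value as \<open>\<tau> \<rightarrow> 0\<close>.  For smooth \<open>f\<close> this branch
  exists and is unique for small \<open>\<tau>\<close>.  Autonomous systems suffice: because the nodes are the row
  sums \<open>c\<^sub>i = \<Sum>\<^sub>j a\<^sub>i\<^sub>j\<close>, a time-dependent right-hand side is covered by adjoining \<open>t' = 1\<close>.
\<close>

definition rk_order :: "nat \<Rightarrow> (nat \<Rightarrow> nat \<Rightarrow> real) \<Rightarrow> (nat \<Rightarrow> real) \<Rightarrow> nat \<Rightarrow> bool" where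
  "rk_order s A w p \<longleftrightarrow>
     (\<forall>d f T y Y.
        (\<forall>m<d. smooth_on_Rd d (\<lambda>z. f z m)) \<and> T > 0 \<and> ode_solution d f T y \<and>
        (\<forall>\<^sub>F \<tau> in at_right 0. rk_stages s A d f (y 0) \<tau> (Y \<tau>)) \<and>
        (\<forall>i<s. \<forall>m<d. ((\<lambda>\<tau>. Y \<tau> i m) \<longlongrightarrow> y 0 m) (at_right 0)) \<longrightarrow>
        (\<forall>m<d. (\<lambda>\<tau>. y 0 m + \<tau> * (\<Sum>i<s. w i * f (Y \<tau> i) m) - y \<tau> m)
                 \<in> O[at_right 0](\<lambda>\<tau>. \<tau> ^ (p + 1))))"

section \<open>The mSP method\<close>

text \<open>
  Stages are numbered \<open>0, \<dots>, s - 1\<close>; \<open>A\<close> and \<open>w\<close> are the coefficients \<open>a\<^sub>i\<^sub>j\<close> and \<open>b\<^sub>i\<close>.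
\<close>

definition rk_node :: "nat \<Rightarrow> (nat \<Rightarrow> nat \<Rightarrow> real) \<Rightarrow> nat \<Rightarrow> real" where
  "rk_node s A i = (\<Sum>j<s. A i j)"

primrec mSP_stage ::
  "real \<Rightarrow> real \<Rightarrow> nat \<Rightarrow> (nat \<Rightarrow> nat \<Rightarrow> real) \<Rightarrow> (real \<Rightarrow> complex) \<Rightarrow> real \<Rightarrow> nat \<Rightarrow> nat \<Rightarrow>
   real \<Rightarrow> complex" where
  "mSP_stage a b s A u \<tau> 0 = (\<lambda>i. expL a b (rk_node s A i * \<tau>) u)"
| "mSP_stage a b s A u \<tau> (Suc l) = (\<lambda>i x. expL a b (rk_node s A i * \<tau>) u x +
     complex_of_real \<tau> * (\<Sum>j<s. complex_of_real (A i j) *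
       expL a b ((rk_node s A i - rk_node s A j) * \<tau>) (nonlin (mSP_stage a b s A u \<tau> l j)) x))"

definition mSP_slope ::
  "real \<Rightarrow> real \<Rightarrow> nat \<Rightarrow> (nat \<Rightarrow> nat \<Rightarrow> real) \<Rightarrow> nat \<Rightarrow> (real \<Rightarrow> complex) \<Rightarrow> real \<Rightarrow> real ^ 3 \<Rightarrow> nat \<Rightarrow>
   real \<Rightarrow> complex" where
  "mSP_slope a b s A M u \<tau> \<beta> i x = nonlin (mSP_stage a b s A u \<tau> M i) x +
     (\<Sum>j\<in>UNIV. complex_of_real (\<beta> $ j) * grad j (mSP_stage a b s A u \<tau> M i) x)"

definition mSP_update ::
  "real \<Rightarrow> real \<Rightarrow> nat \<Rightarrow> (nat \<Rightarrow> nat \<Rightarrow> real) \<Rightarrow> (nat \<Rightarrow> real) \<Rightarrow> nat \<Rightarrow> (real \<Rightarrow> complex) \<Rightarrow> real \<Rightarrow>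
   real ^ 3 \<Rightarrow> real \<Rightarrow> complex" where
  "mSP_update a b s A w M u \<tau> \<beta> x = expL a b \<tau> u x +
     complex_of_real \<tau> * (\<Sum>i<s. complex_of_real (w i) *
       expL a b ((1 - rk_node s A i) * \<tau>) (mSP_slope a b s A M u \<tau> \<beta> i) x)"

definition mSP_psi_hat ::
  "real \<Rightarrow> real \<Rightarrow> nat \<Rightarrow> (nat \<Rightarrow> nat \<Rightarrow> real) \<Rightarrow> (nat \<Rightarrow> real) \<Rightarrow> nat \<Rightarrow> (real \<Rightarrow> complex) \<Rightarrow> real \<Rightarrow>
   real \<Rightarrow> complex" where
  "mSP_psi_hat a b s A w M u \<tau> x = expL a b \<tau> u x +
     complex_of_real \<tau> * (\<Sum>i<s. complex_of_real (w i) *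
       expL a b ((1 - rk_node s A i) * \<tau>) (nonlin (mSP_stage a b s A u \<tau> M i)) x)"

definition mSP_Gamma ::
  "real \<Rightarrow> real \<Rightarrow> nat \<Rightarrow> (nat \<Rightarrow> nat \<Rightarrow> real) \<Rightarrow> (nat \<Rightarrow> real) \<Rightarrow> nat \<Rightarrow> (real \<Rightarrow> complex) \<Rightarrow> real \<Rightarrow>
   3 \<Rightarrow> real \<Rightarrow> complex" where
  "mSP_Gamma a b s A w M u \<tau> j x = (\<Sum>i<s. complex_of_real (w i) *
     expL a b ((1 - rk_node s A i) * \<tau>) (grad j (mSP_stage a b s A u \<tau> M i)) x)"

definition mSP_G ::
  "real \<Rightarrow> real \<Rightarrow> nat \<Rightarrow> (nat \<Rightarrow> nat \<Rightarrow> real) \<Rightarrow> (nat \<Rightarrow> real) \<Rightarrow> nat \<Rightarrow> (real \<Rightarrow> complex) \<Rightarrow> real \<Rightarrow>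
   real ^ 3 \<Rightarrow> real ^ 3" where
  "mSP_G a b s A w M u \<tau> \<alpha> =
     invariants a b (\<lambda>x. mSP_psi_hat a b s A w M u \<tau> x +
       (\<Sum>j\<in>UNIV. complex_of_real (\<alpha> $ j) * mSP_Gamma a b s A w M u \<tau> j x)) -
     invariants a b u"

text \<open>
  The branch of multipliers selected by the method: for all small \<open>\<tau> > 0\<close>, \<open>\<alpha> \<tau>\<close> is the unique
  zero of \<open>G(\<tau>, \<cdot>)\<close> in a neighbourhood of \<open>0\<close> that does not depend on \<open>\<tau>\<close>, and
  \<open>\<alpha> \<tau> \<rightarrow> 0\<close> as \<open>\<tau> \<rightarrow> 0\<close>.
\<close>

definition mSP_multipliers ::
  "real \<Rightarrow> real \<Rightarrow> nat \<Rightarrow> (nat \<Rightarrow> nat \<Rightarrow> real) \<Rightarrow> (nat \<Rightarrow> real) \<Rightarrow> nat \<Rightarrow> (real \<Rightarrow> complex) \<Rightarrow>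
   (real \<Rightarrow> real ^ 3) \<Rightarrow> bool" where
  "mSP_multipliers a b s A w M u \<alpha> \<longleftrightarrow>
     (\<exists>\<rho>>0. \<forall>\<^sub>F \<tau> in at_right 0.
        \<alpha> \<tau> \<in> ball 0 \<rho> \<and> mSP_G a b s A w M u \<tau> (\<alpha> \<tau>) = 0 \<and>
        (\<forall>\<gamma>\<in>ball 0 \<rho>. mSP_G a b s A w M u \<tau> \<gamma> = 0 \<longrightarrow> \<gamma> = \<alpha> \<tau>)) \<and>
     (\<alpha> \<longlongrightarrow> 0) (at_right 0)"

end

(*
  Work in the algebra of absolutely convergent Fourier series, with the weighted norms
  sum_k (1 + |k|)^m |c_k|: each of them is submultiplicative, the unitary group of the linear part
  is isometric, and every derivative costs one weight.  In the interaction picture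
  v(t) = exp(-tL) psi(t_n + t) the equation reads v' = F(t, v) with F cubic in v, and the Lawson
  method becomes the classical Runge-Kutta method for this equation, applied with M Picard sweeps.
  Both v and the numerical solution have expansions in powers of the step size, with remainders
  controlled at the price of finitely many derivatives.  Their coefficients are combinations of the
  same elementary differentials, weighted by 1/gamma(T) and by the elementary weights of the method
  respectively; the order of the method for finite-dimensional systems makes the two weights agree
  for all trees T with at most p nodes, and M sweeps reproduce the stages up to trees of height M.
  Hence the uncorrected solution has local error O(tau^(q+1)), q = min p (M+1).

  The exact flow conserves the three invariants, so G(tau, 0) = O(tau^(q+1)).  The invariants are
  strictly differentiable functions of (psi, psi_x), hence G(tau, .) is a uniformly small
  perturbation of an invertible linear map near 0; this yields the branch of multipliers and the
  bound alpha(tau) = O(tau^(q+1)), and the correction does not spoil the order.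
*)

theory Submission
  imports Defs "HOL-Computational_Algebra.Formal_Power_Series" "HOL-Library.Nat_Bijection"
begin

text \<open>The obstacle is that \<open>rk_order\<close> speaks about smooth systems in finitely
  many variables, while this equation has an unbounded linear part and a nonlinearity that loses a
  derivative. The hypothesis is therefore used only through numbers: applied to one polynomial
  system per tree, it yields identities between real weights, and these are transferred by linearity
  to combinations of arbitrary vectors of the function space. No elementary differential is ever
  computed; only closure of the class of such combinations under the operations of the method is
  proved. The equation in the interaction picture depends on time, yet autonomous trees suffice: a
  factor c_i^k is the stage weight of k single nodes, whose exact weight is 1. Powers of the linear
  operator thus come with extra leaves. Absolutely convergent series also make point evaluation
  continuous, so that the pointwise definitions of the method can be matched with operations on
  coefficients. Sobolev regularity enters once, through an embedding by Cauchy-Schwarz.\<close>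

no_notation Infinite_Set_Sum.abs_summable_on (infix \<open>abs'_summable'_on\<close> 50)

section \<open>Absolutely convergent Fourier series\<close>

lemma abs_summable_on_Times:
  fixes f g :: "'a \<Rightarrow> 'b::{real_normed_algebra,banach}"
  assumes "f abs_summable_on A" "g abs_summable_on B"
  shows "(\<lambda>(x,y). f x * g y) abs_summable_on A \<times> B"
proof -
  have "(\<lambda>(x,y). norm (f x) * norm (g y)) summable_on A \<times> B"
  proof (rule summable_on_SigmaI)
    show "((\<lambda>y. case (x, y) of (x, y) \<Rightarrow> norm (f x) * norm (g y)) has_sum
        norm (f x) * infsum (\<lambda>y. norm (g y)) B) B" if "x \<in> A" for x
      using assms(2) by (auto intro!: has_sum_cmult_right has_sum_infsum)
    show "(\<lambda>x. norm (f x) * infsum (\<lambda>y. norm (g y)) B) summable_on A"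
      using assms(1) by (intro summable_on_cmult_left)
  qed auto
  thus ?thesis
    by (rule Infinite_Sum.abs_summable_on_comparison_test') (auto intro: norm_mult_ineq)
qed

lemma infsum_Times:
  fixes f g :: "'a \<Rightarrow> 'b::{real_normed_algebra,banach}"
  assumes "f abs_summable_on A" "g abs_summable_on B"
  shows "infsum (\<lambda>(x,y). f x * g y) (A \<times> B) = infsum f A * infsum g B"
proof -
  have s: "(\<lambda>(x,y). f x * g y) summable_on A \<times> B"
    using abs_summable_on_Times[OF assms] by (rule abs_summable_summable)
  have "infsum (\<lambda>(x,y). f x * g y) (A \<times> B) = infsum (\<lambda>x. infsum (\<lambda>y. f x * g y) B) A"
    using infsum_Sigma'_banach[OF s] by simp
  also have "\<dots> = infsum (\<lambda>x. f x * infsum g B) A"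
    using abs_summable_summable[OF assms(2)] by (intro infsum_cong infsum_cmult_right) auto
  also have "\<dots> = infsum f A * infsum g B"
    using abs_summable_summable[OF assms(1)] by (intro infsum_cmult_left) auto
  finally show ?thesis .
qed

definition conv :: "(int \<Rightarrow> 'a) \<Rightarrow> (int \<Rightarrow> 'a) \<Rightarrow> int \<Rightarrow> 'a::{real_normed_algebra,banach}" where
  "conv f g k = infsum (\<lambda>j. f j * g (k - j)) UNIV"

text \<open>The shear (k, j) -> (j, k - j) is a bijection of the integer lattice that carries the
  convolution family to the product family; absolute summability and Fubini do the rest.\<close>

lemma conv_props:
  fixes f g :: "int \<Rightarrow> 'a::{real_normed_algebra,banach}"
  assumes "f abs_summable_on UNIV" "g abs_summable_on UNIV"
  shows conv_inner: "(\<lambda>j. f j * g (k - j)) abs_summable_on UNIV"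
    and conv_abs_summable: "conv f g abs_summable_on UNIV"
    and infsum_conv: "infsum (conv f g) UNIV = infsum f UNIV * infsum g UNIV"
proof -
  have bij: "bij_betw (\<lambda>(k,j). (j, k - j)) (UNIV::(int\<times>int) set) (UNIV \<times> UNIV)"
    by (rule bij_betwI[where g="\<lambda>(j,l). (j+l, j)"]) auto
  have "(\<lambda>(x,y). f x * g y) abs_summable_on UNIV \<times> UNIV"
    by (rule abs_summable_on_Times[OF assms])
  hence s0: "(\<lambda>(k,j). f j * g (k - j)) abs_summable_on UNIV \<times> UNIV"
    using summable_on_reindex_bij_betw[OF bij, of "\<lambda>p. norm (case p of (x,y) \<Rightarrow> f x * g y)"]
    by (simp add: case_prod_unfold)
  hence s: "(\<lambda>(k,j). f j * g (k - j)) abs_summable_on Sigma UNIV (\<lambda>_. UNIV)" by simp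
  from s show "(\<lambda>j. f j * g (k - j)) abs_summable_on UNIV"
    unfolding Infinite_Sum.abs_summable_on_Sigma_iff by simp
  have inner: "(\<lambda>j. f j * g (k - j)) abs_summable_on UNIV" for k
    using s unfolding Infinite_Sum.abs_summable_on_Sigma_iff by simp
  have "(\<lambda>k. infsum (\<lambda>j. norm (f j * g (k - j))) UNIV) abs_summable_on UNIV"
    using s unfolding Infinite_Sum.abs_summable_on_Sigma_iff by simp
  hence o: "(\<lambda>k. infsum (\<lambda>j. norm (f j * g (k - j))) UNIV) summable_on UNIV"
    by (simp add: abs_summable_summable)
  show "conv f g abs_summable_on UNIV"
    by (rule Infinite_Sum.abs_summable_on_comparison_test'[OF o]) (auto simp: conv_def intro!: norm_infsum_bound inner)
  have "infsum (conv f g) UNIV = infsum (\<lambda>(k,j). f j * g (k - j)) (UNIV \<times> UNIV)"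
    unfolding conv_def using infsum_Sigma'_banach[OF abs_summable_summable[OF s]] by simp
  also have "\<dots> = infsum (\<lambda>(x,y). f x * g y) (UNIV \<times> UNIV)"
    using infsum_reindex_bij_betw[OF bij, of "\<lambda>(x,y). f x * g y"] by (simp add: case_prod_unfold)
  also have "\<dots> = infsum f UNIV * infsum g UNIV"
    by (rule infsum_Times[OF assms])
  finally show "infsum (conv f g) UNIV = infsum f UNIV * infsum g UNIV" .
qed

definition trig_series :: "real \<Rightarrow> real \<Rightarrow> (int \<Rightarrow> complex) \<Rightarrow> real \<Rightarrow> complex" where
  "trig_series a b c x = infsum (\<lambda>k. c k * cis (wavenumber a b k * x)) UNIV"

lemma trig_series_summable:
  assumes "c abs_summable_on UNIV"
  shows "(\<lambda>k. c k * cis (wavenumber a b k * x)) abs_summable_on UNIV"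
  using assms by (simp add: norm_mult)

text \<open>Multiplying coefficients by the character k -> exp(i w_k x) commutes with convolution,
  because the character is multiplicative in k. At fixed x the claim is then
  \<open>infsum_conv\<close> for the twisted sequences.\<close>

lemma trig_series_conv:
  assumes "c abs_summable_on UNIV" "d abs_summable_on UNIV"
  shows "trig_series a b (conv c d) x = trig_series a b c x * trig_series a b d x"
proof -
  let ?e = "\<lambda>k. cis (wavenumber a b k * x)"
  have e: "?e j * ?e (k - j) = ?e k" for j k
    by (simp add: cis_mult wavenumber_def algebra_simps diff_divide_distrib)
  have "conv (\<lambda>k. c k * ?e k) (\<lambda>k. d k * ?e k) k = conv c d k * ?e k" for k
  proof -
    have "conv (\<lambda>k. c k * ?e k) (\<lambda>k. d k * ?e k) k = infsum (\<lambda>j. (c j * d (k - j)) * ?e k) UNIV"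
      unfolding conv_def by (rule infsum_cong) (metis e mult.assoc mult.left_commute)
    also have "\<dots> = conv c d k * ?e k"
      unfolding conv_def
      by (rule infsum_cmult_left) (use abs_summable_summable[OF conv_inner[OF assms]] in auto)
    finally show ?thesis .
  qed
  hence "trig_series a b (conv c d) x = infsum (conv (\<lambda>k. c k * ?e k) (\<lambda>k. d k * ?e k)) UNIV"
    unfolding trig_series_def by presburger
  also have "\<dots> = trig_series a b c x * trig_series a b d x"
    unfolding trig_series_def
    by (rule infsum_conv) (use assms in \<open>auto intro: trig_series_summable\<close>)
  finally show ?thesis .
qed

lemma norm_trig_series_le:
  assumes "c abs_summable_on UNIV"
  shows "norm (trig_series a b c x) \<le> infsum (\<lambda>k. norm (c k)) UNIV"
  using norm_infsum_bound[OF trig_series_summable[OF assms, of a b x]]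
  unfolding trig_series_def by (simp add: norm_mult)

lemma trig_series_diff:
  assumes "c abs_summable_on UNIV" "d abs_summable_on UNIV"
  shows "trig_series a b (\<lambda>k. c k - d k) x = trig_series a b c x - trig_series a b d x"
proof -
  let ?e = "\<lambda>k. cis (wavenumber a b k * x)"
  have "((\<lambda>k. c k * ?e k + - (d k * ?e k)) has_sum
      (trig_series a b c x + - trig_series a b d x)) UNIV"
    unfolding trig_series_def
    by (intro has_sum_add has_sum_uminus[THEN iffD2] has_sum_infsum)
       (use assms in \<open>auto intro!: has_sum_infsum abs_summable_summable trig_series_summable\<close>)
  thus ?thesis
    by (simp add: trig_series_def algebra_simps infsumI)
qed

text \<open>The tail of the sum of moduli bounds the error uniformly in x. The index
  \<open>k0\<close> lets a caller force a given mode into the partial sum, as the computation of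
  Fourier coefficients requires.\<close>

lemma trig_series_finite_approx:
  assumes c: "c abs_summable_on UNIV" and "e > 0"
  obtains K where "finite K" "k0 \<in> K"
    "\<And>x. norm (trig_series a b c x - (\<Sum>k\<in>K. c k * cis (wavenumber a b k * x))) < e"
proof -
  have "\<forall>\<^sub>F K in finite_subsets_at_top UNIV.
      dist (\<Sum>k\<in>K. norm (c k)) (infsum (\<lambda>k. norm (c k)) UNIV) < e"
    using infsum_tendsto[OF c] \<open>e > 0\<close> by (rule tendstoD)
  then obtain K0 where K0: "finite K0" "\<And>K. finite K \<Longrightarrow> K0 \<subseteq> K \<Longrightarrow>
      dist (\<Sum>k\<in>K. norm (c k)) (infsum (\<lambda>k. norm (c k)) UNIV) < e"
    unfolding eventually_finite_subsets_at_top by auto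
  define K where "K = insert k0 K0"
  have K: "finite K" "dist (\<Sum>k\<in>K. norm (c k)) (infsum (\<lambda>k. norm (c k)) UNIV) < e"
    using K0 by (auto simp: K_def)
  have "norm (trig_series a b c x - (\<Sum>k\<in>K. c k * cis (wavenumber a b k * x))) < e" for x
  proof -
    let ?t = "\<lambda>k. c k * cis (wavenumber a b k * x)"
    have t: "?t abs_summable_on A" for A
      using trig_series_summable[OF c, of a b x] by (rule summable_on_subset_banach) auto
    have cs: "c abs_summable_on A" for A
      using c by (rule summable_on_subset_banach) auto
    have "trig_series a b c x = (\<Sum>k\<in>K. ?t k) + infsum ?t (-K)"
      unfolding trig_series_def using infsum_Un_disjoint[of ?t K "-K"] K(1)
        abs_summable_summable[OF t] by (simp add: Un_commute)
    moreover have "norm (infsum ?t (-K)) \<le> infsum (\<lambda>k. norm (c k)) (-K)"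
      using norm_infsum_bound[OF t, of "-K"] by (simp add: norm_mult)
    moreover have "infsum (\<lambda>k. norm (c k)) UNIV = (\<Sum>k\<in>K. norm (c k)) + infsum (\<lambda>k. norm (c k)) (-K)"
      using infsum_Un_disjoint[of "\<lambda>k. norm (c k)" K "-K"] K(1) cs by (simp add: Un_commute)
    ultimately show ?thesis using K(2) by (simp add: dist_norm)
  qed
  thus ?thesis using that[of K] K(1) by (auto simp: K_def)
qed

lemma trig_series_periodic:
  assumes "a < b"
  shows "trig_series a b c (x + (b - a)) = trig_series a b c x"
proof -
  have "cis (wavenumber a b k * (x + (b - a))) = cis (wavenumber a b k * x)" for k
  proof -
    have "wavenumber a b k * (x + (b - a)) = wavenumber a b k * x + 2 * pi * of_int k"
      using assms by (simp add: wavenumber_def field_simps)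
    thus ?thesis by (metis cis_mult cis_multiple_2pi Ints_of_int mult.right_neutral)
  qed
  thus ?thesis by (simp add: trig_series_def)
qed

lemma continuous_on_trig_series:
  assumes c: "c abs_summable_on UNIV"
  shows "continuous_on S (trig_series a b c)"
proof (rule continuous_on_subset[OF _ subset_UNIV], rule continuous_on_iff[THEN iffD2], safe)
  fix x :: real and e :: real assume e: "e > 0"
  obtain K where K: "finite K"
    "\<And>x. norm (trig_series a b c x - (\<Sum>k\<in>K. c k * cis (wavenumber a b k * x))) < e / 3"
    using trig_series_finite_approx[OF c, of "e/3" 0] e by (metis divide_pos_pos zero_less_numeral)
  define P where "P = (\<lambda>x. \<Sum>k\<in>K. c k * cis (wavenumber a b k * x))"
  have "continuous_on UNIV P" unfolding P_def by (intro continuous_intros)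
  then obtain d where d: "d > 0" "\<And>y. dist y x < d \<Longrightarrow> dist (P y) (P x) < e/3"
    using e unfolding continuous_on_iff by (metis UNIV_I divide_pos_pos zero_less_numeral)
  have "dist (trig_series a b c y) (trig_series a b c x) < e" if "dist y x < d" for y
  proof -
    have "norm (trig_series a b c y - P y) < e/3" "norm (trig_series a b c x - P x) < e/3"
      using K(2) by (auto simp: P_def)
    thus ?thesis using d(2)[OF that] 
      by (smt (verit, del_insts) dist_norm dist_commute dist_triangle field_sum_of_halves dist_triangle_third)
  qed
  thus "\<exists>d>0. \<forall>y\<in>UNIV. dist y x < d \<longrightarrow> dist (trig_series a b c y) (trig_series a b c x) < e"
    using d(1) by auto
qed

section \<open>Orthogonality of the modes and uniqueness of Fourier coefficients\<close>

lemma integral_cis_wavenumber: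
  assumes "a < b"
  shows "((\<lambda>x. cis (wavenumber a b k * x)) has_integral (if k = 0 then of_real (b - a) else 0)) {a..b}"
proof (cases "k = 0")
  case True
  thus ?thesis using has_integral_const_real[of "1::complex" a b] assms
    by (simp add: wavenumber_def scaleR_conv_of_real)
next
  case False
  define w where "w = wavenumber a b k"
  have w: "w \<noteq> 0" using False assms by (simp add: w_def wavenumber_def)
  have d: "((\<lambda>x. cis (w * x) / (\<i> * w)) has_vector_derivative cis (w * x)) (at x within {a..b})" for x
  proof -
    have "((\<lambda>x. cis (w * x)) has_vector_derivative (w *\<^sub>R (\<i> * cis (w * x)))) (at x within {a..b})"
      unfolding cis_conv_exp
      by (rule has_vector_derivative_real_field[THEN has_vector_derivative_eq_rhs] derivative_eq_intros refl 
          | (auto simp: scaleR_conv_of_real intro!: derivative_eq_intros))+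
    from has_vector_derivative_mult_right[OF this, of "1 / (\<i> * w)"] show ?thesis
      using w by (simp add: scaleR_conv_of_real mult.commute field_simps)
  qed
  have "cis (w * b) = cis (w * a)"
  proof -
    have "w * b = w * a + 2 * pi * of_int k"
      using assms by (simp add: w_def wavenumber_def field_simps)
    thus ?thesis by (metis cis_mult cis_multiple_2pi Ints_of_int mult.right_neutral)
  qed
  thus ?thesis
    using fundamental_theorem_of_calculus[of a b "\<lambda>x. cis (w * x) / (\<i> * w)" "\<lambda>x. cis (w * x)"] d assms False
    by (simp add: w_def)
qed

lemma fourier_coeff_finite:
  assumes "a < b" "finite K" "j \<in> K"
  shows "fourier_coeff a b (\<lambda>x. \<Sum>k\<in>K. c k * cis (wavenumber a b k * x)) j = c j"
proof -
  have e: "cis (wavenumber a b k * x) * cis (- (wavenumber a b j * x)) = cis (wavenumber a b (k - j) * x)" for k x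
    by (simp add: cis_mult wavenumber_def algebra_simps diff_divide_distrib)
  have "((\<lambda>x. \<Sum>k\<in>K. c k * cis (wavenumber a b (k - j) * x)) has_integral
      (\<Sum>k\<in>K. c k * (if k - j = 0 then of_real (b - a) else 0))) {a..b}"
    by (intro has_integral_sum has_integral_mult_right integral_cis_wavenumber assms)
  also have "(\<Sum>k\<in>K. c k * (if k - j = 0 then of_real (b - a) else 0)) = c j * of_real (b - a)"
    using assms by (simp add: if_distrib cong: if_cong)
  finally have "integral {a..b} (\<lambda>x. (\<Sum>k\<in>K. c k * cis (wavenumber a b k * x)) * cis (- (wavenumber a b j * x)))
      = c j * of_real (b - a)"
    by (simp add: sum_distrib_right mult.assoc e integral_unique)
  thus ?thesis using assms by (simp add: fourier_coeff_def)
qed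

lemma norm_fourier_coeff_le:
  assumes "a < b" "continuous_on {a..b} f" "\<And>x. norm (f x) \<le> e"
  shows "norm (fourier_coeff a b f j) \<le> e"
proof -
  have "norm (integral {a..b} (\<lambda>x. f x * cis (- (wavenumber a b j * x)))) \<le> e * (b - a)"
    by (rule integral_bound) (use assms in \<open>auto intro!: continuous_intros simp: norm_mult\<close>)
  moreover have "norm (complex_of_real (1 / (b - a))) = 1 / (b - a)"
    using assms(1) by (simp only: norm_of_real) simp
  ultimately show ?thesis using assms(1)
    by (simp only: fourier_coeff_def norm_mult) (simp add: field_simps)
qed

lemma fourier_coeff_diff:
  assumes "continuous_on {a..b} f" "continuous_on {a..b} g"
  shows "fourier_coeff a b (\<lambda>x. f x - g x) j = fourier_coeff a b f j - fourier_coeff a b g j"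
proof -
  have i: "(\<lambda>x. f x * cis (- (wavenumber a b j * x))) integrable_on {a..b}" if "continuous_on {a..b} f" for f
    by (intro integrable_continuous_interval continuous_intros that)
  show ?thesis unfolding fourier_coeff_def ring_distribs
    by (subst integral_diff) (use assms i in \<open>auto simp: ring_distribs\<close>)
qed

text \<open>Uniform approximation by a partial sum containing mode \<open>j\<close> moves the
  coefficient by at most e, and finite sums are settled by orthogonality.\<close>

lemma fourier_coeff_trig_series:
  assumes "a < b" "c abs_summable_on UNIV"
  shows "fourier_coeff a b (trig_series a b c) j = c j"
proof -
  have "norm (fourier_coeff a b (trig_series a b c) j - c j) \<le> e" if "e > 0" for e
  proof -
    obtain K where K: "finite K" "j \<in> K"
      "\<And>x. norm (trig_series a b c x - (\<Sum>k\<in>K. c k * cis (wavenumber a b k * x))) < e"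
      using trig_series_finite_approx[OF assms(2) \<open>e > 0\<close>, of j] by metis
    let ?P = "\<lambda>x. \<Sum>k\<in>K. c k * cis (wavenumber a b k * x)"
    have cP: "continuous_on S ?P" for S by (intro continuous_intros)
    have "norm (fourier_coeff a b (\<lambda>x. trig_series a b c x - ?P x) j) \<le> e"
      using K(3) by (intro norm_fourier_coeff_le assms continuous_intros continuous_on_trig_series cP)
        (simp add: less_imp_le)
    thus ?thesis
      by (simp add: fourier_coeff_diff continuous_on_trig_series assms cP fourier_coeff_finite K)
  qed
  hence "norm (fourier_coeff a b (trig_series a b c) j - c j) \<le> 0" by (rule field_le_epsilon) (simp add: )
  thus ?thesis by simp
qed

lemma trig_series_inj:
  assumes "a < b" "c abs_summable_on UNIV" "d abs_summable_on UNIV"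
    "trig_series a b c = trig_series a b d"
  shows "c = d"
  using assms fourier_coeff_trig_series by (metis ext)

lemma periodic_fun_int:
  assumes "periodic_fun a b f"
  shows "f (x + of_int n * (b - a)) = f x"
proof (induction n arbitrary: x rule: int_induct[where k=0])
  case (step1 i)
  have "f (x + of_int (i + 1) * (b - a)) = f ((x + of_int i * (b - a)) + (b - a))"
    by (simp add: algebra_simps)
  thus ?case using assms step1 by (simp add: periodic_fun_def)
next
  case (step2 i)
  have "f (x + of_int (i - 1) * (b - a)) = f ((x + of_int (i - 1) * (b - a)) + (b - a))"
    using assms unfolding periodic_fun_def by metis
  also have "\<dots> = f (x + of_int i * (b - a))"
    by (simp add: algebra_simps)
  finally show ?case using step2 by simp
qed auto

text \<open>The class is closed under products, so it contains every real polynomial function of the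
  point exp(i w_1 x), which is what the Weierstrass theorem on the circle delivers.\<close>

inductive trig_poly :: "real \<Rightarrow> real \<Rightarrow> (real \<Rightarrow> complex) \<Rightarrow> bool" for a b where
  mode: "trig_poly a b (\<lambda>x. c * cis (wavenumber a b k * x))"
| add: "trig_poly a b f \<Longrightarrow> trig_poly a b g \<Longrightarrow> trig_poly a b (\<lambda>x. f x + g x)"

lemma trig_poly_mult_mode:
  "trig_poly a b g \<Longrightarrow> trig_poly a b (\<lambda>x. c * cis (wavenumber a b k * x) * g x)"
proof (induction rule: trig_poly.induct)
  case (mode d l)
  have "(\<lambda>x. c * cis (wavenumber a b k * x) * (d * cis (wavenumber a b l * x))) =
      (\<lambda>x. (c * d) * cis (wavenumber a b (k + l) * x))"
    by (rule ext) (simp add: wavenumber_def algebra_simps add_divide_distrib flip: cis_mult)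
  thus ?case by (simp only: trig_poly.mode)
next
  case (add f g)
  thus ?case by (simp add: algebra_simps trig_poly.add)
qed

lemma trig_poly_mult: "trig_poly a b f \<Longrightarrow> trig_poly a b g \<Longrightarrow> trig_poly a b (\<lambda>x. f x * g x)"
  by (induction rule: trig_poly.induct) (auto simp: algebra_simps intro: trig_poly_mult_mode[simplified algebra_simps] trig_poly.add)

lemma trig_poly_const: "trig_poly a b (\<lambda>_. c)"
  using trig_poly.mode[of a b c 0] by (simp add: wavenumber_def)

lemma trig_poly_continuous: "trig_poly a b f \<Longrightarrow> continuous_on S f"
  by (induction rule: trig_poly.induct) (auto intro!: continuous_intros)

lemma trig_poly_real_polynomial:
  fixes p :: "complex \<Rightarrow> real"
  assumes "real_polynomial_function p"
  shows "trig_poly a b (\<lambda>x. complex_of_real (p (cis (wavenumber a b 1 * x))))"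
  using assms
proof (induction rule: real_polynomial_function.induct)
  case (linear f)
  interpret bounded_linear f by (rule linear)
  define u v where "u = complex_of_real (f 1)" and "v = complex_of_real (f \<i>)"
  \<comment> \<open>A real-linear functional of exp(i y) is a combination of cos y and sin y, hence
    of the modes 1 and -1.\<close>
  have "complex_of_real (f (cis y)) = (u - \<i> * v) / 2 * cis y + (u + \<i> * v) / 2 * cis (- y)" for y
  proof -
    have "cis y = cos y *\<^sub>R 1 + sin y *\<^sub>R \<i>" by (simp add: complex_eq_iff)
    hence "f (cis y) = cos y * f 1 + sin y * f \<i>" by (simp only: add scaleR) simp
    thus ?thesis by (simp add: u_def v_def complex_eq_iff field_simps)
  qed
  hence "(\<lambda>x. complex_of_real (f (cis (wavenumber a b 1 * x)))) =
    (\<lambda>x. (u - \<i> * v) / 2 * cis (wavenumber a b 1 * x) + (u + \<i> * v) / 2 * cis (wavenumber a b (-1) * x))"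
    by (simp add: wavenumber_def)
  thus ?case by (simp only: trig_poly.intros)
qed (auto intro: trig_poly_const trig_poly.add trig_poly_mult)

lemma integral_trig_poly_eq_0:
  assumes "trig_poly a b f" "a < b" "continuous_on {a..b} h" "\<And>k. fourier_coeff a b h k = 0"
  shows "integral {a..b} (\<lambda>x. h x * f x) = 0"
  using assms(1)
proof (induction rule: trig_poly.induct)
  case (mode c k)
  have "integral {a..b} (\<lambda>x. h x * cis (wavenumber a b k * x)) = 0"
    using assms(4)[of "-k"] assms(2) by (simp add: fourier_coeff_def wavenumber_def)
  hence "integral {a..b} (\<lambda>x. (h x * cis (wavenumber a b k * x)) * c) = 0"
    by simp
  thus ?case by (simp add: mult_ac)
next
  case (add f g)
  have "(\<lambda>x. h x * f x) integrable_on {a..b}" "(\<lambda>x. h x * g x) integrable_on {a..b}"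
    by (intro integrable_continuous_interval continuous_on_mult assms
        trig_poly_continuous[OF add.hyps(1)] trig_poly_continuous[OF add.hyps(2)])+
  thus ?case using add by (simp add: distrib_left integral_add)
qed

text \<open>Moved to the unit circle, the conjugate of \<open>h\<close> is a uniform limit of
  polynomials, that is, of trigonometric polynomials whose product with \<open>h\<close> integrates
  to 0. This makes the integral of |h|^2 arbitrarily small.\<close>

lemma fourier_coeff_eq_0_imp_eq_0:
  assumes ab: "a < b" and per: "periodic_fun a b h" and cont: "continuous_on UNIV h"
    and 0: "\<And>k. fourier_coeff a b h k = 0"
  shows "h x = 0"
proof -
  define w where "w = wavenumber a b 1"
  have w: "w > 0" "w * (b - a) = 2 * pi" using ab by (auto simp: w_def wavenumber_def)
  define H where "H z = h (Arg z / w)" for z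
  have hH: "H (cis y) = h (y / w)" for y
  proof -
    have "cis (Arg (cis y)) = cis y" by (simp add: cis_Arg_unique cis_Arg)
    then obtain n :: int where "Arg (cis y) = y + 2 * pi * n"
      by (metis cis.sel sin_cos_eq_iff)
    hence "Arg (cis y) = y + of_int n * (w * (b - a))"
      by (simp only: w(2)) (simp add: algebra_simps)
    hence "Arg (cis y) / w = y / w + of_int n * (b - a)"
      using w(1) by (simp add: add_divide_distrib)
    thus ?thesis using periodic_fun_int[OF per] by (simp add: H_def)
  qed
  have contH: "continuous_on (sphere 0 1) H"
    unfolding continuous_on_eq_continuous_within
  proof
    fix z0 :: complex assume z0: "z0 \<in> sphere 0 1"
    define y0 where "y0 = Arg z0"
    have "z0 \<noteq> 0" using z0 by auto
    hence z0': "z0 = cis y0" using z0 by (simp add: y0_def cis_Arg sgn_eq)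
    \<comment> \<open>\<open>Arg\<close> jumps on the negative real axis. Dividing by
      \<open>z0\<close> moves the point to 1, off the cut, and on the circle periodicity of
      \<open>h\<close> makes this function equal to \<open>H\<close>.\<close>
    define K where "K z = h ((y0 + Arg (z / z0)) / w)" for z
    have HK: "H z = K z" if "z \<in> sphere 0 1" for z
    proof -
      have "cis (Arg (z / z0)) = z / z0"
        using that z0 by (subst cis_Arg) (auto simp: sgn_eq norm_divide)
      hence "z = cis (y0 + Arg (z / z0))"
        using z0 by (auto simp: z0' simp flip: cis_mult)
      thus ?thesis unfolding K_def using hH by metis
    qed
    have "isCont (\<lambda>z. Arg (z / z0)) z0"
      by (rule isCont_o2[where g=Arg]) (use \<open>z0 \<noteq> 0\<close> in \<open>auto intro!: continuous_at_Arg continuous_intros\<close>)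
    hence i: "isCont (\<lambda>z. (y0 + Arg (z / z0)) / w) z0"
      using w(1) by (intro continuous_intros) auto
    have "isCont h y" for y using cont by (simp add: continuous_on_eq_continuous_at)
    hence "isCont K z0" unfolding K_def by (intro isCont_o2[OF i])
    thus "continuous (at z0 within sphere 0 1) H"
      by (rule continuous_transform_within[OF continuous_at_imp_continuous_within zero_less_one z0])
         (simp add: HK)
  qed
  have conth: "continuous_on S h" for S using cont continuous_on_subset by blast
  define I where "I = integral {a..b} (\<lambda>x. norm (h x))"
  have "I \<ge> 0" unfolding I_def by (intro integral_nonneg integrable_continuous_interval continuous_intros conth) auto
  \<comment> \<open>The factor is \<open>I + 1\<close> so that e can be replaced by e / (I + 1) even
    when \<open>I\<close> is 0.\<close>
  have int_le: "norm (integral {a..b} (\<lambda>x. h x * cnj (h x))) \<le> e * (I + 1)" if e: "e > 0" for e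
  proof -
    obtain g where g: "polynomial_function g" "\<And>z. z \<in> sphere 0 1 \<Longrightarrow> norm (cnj (H z) - g z) < e"
      using Stone_Weierstrass_polynomial_function[of "sphere 0 1" "\<lambda>z. cnj (H z)" e] contH e
      by (metis compact_sphere continuous_on_cnj)
    define G where "G x = g (cis (w * x))" for x
    have rp: "real_polynomial_function (\<lambda>z. Re (g z))" "real_polynomial_function (\<lambda>z. Im (g z))"
      using g(1) bounded_linear_Re bounded_linear_Im unfolding polynomial_function_def o_def by blast+
    have "trig_poly a b (\<lambda>x. complex_of_real (Re (G x)) + \<i> * complex_of_real (Im (G x)))"
      unfolding G_def w_def
      by (intro trig_poly.add trig_poly_mult trig_poly_const
          trig_poly_real_polynomial[OF rp(1)] trig_poly_real_polynomial[OF rp(2)])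
    hence G: "trig_poly a b G" by (simp add: complex_eq[symmetric])
    have Ge: "norm (cnj (h x) - G x) \<le> e" for x
      using g(2)[of "cis (w * x)"] w(1) by (simp add: hH G_def)
    have "integral {a..b} (\<lambda>x. h x * cnj (h x)) = integral {a..b} (\<lambda>x. h x * cnj (h x)) - integral {a..b} (\<lambda>x. h x * G x)"
      using integral_trig_poly_eq_0[OF G ab conth 0] by simp
    also have "\<dots> = integral {a..b} (\<lambda>x. h x * cnj (h x) - h x * G x)"
      by (rule integral_diff[symmetric])
         (intro integrable_continuous_interval continuous_intros conth trig_poly_continuous[OF G])+
    also have "norm \<dots> \<le> integral {a..b} (\<lambda>x. e * norm (h x))"
    proof (rule integral_norm_bound_integral)
      show "norm (h x * cnj (h x) - h x * G x) \<le> e * norm (h x)" for x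
        using mult_left_mono[OF Ge[of x], of "norm (h x)"]
        by (simp add: norm_mult[symmetric] right_diff_distrib mult.commute)
    qed (intro integrable_continuous_interval continuous_intros conth trig_poly_continuous[OF G])+
    also have "\<dots> \<le> e * (I + 1)" using e by (simp add: I_def algebra_simps)
    finally show ?thesis .
  qed
  have "norm (integral {a..b} (\<lambda>x. h x * cnj (h x))) \<le> 0"
  proof (rule field_le_epsilon)
    fix e :: real assume "e > 0"
    thus "norm (integral {a..b} (\<lambda>x. h x * cnj (h x))) \<le> 0 + e"
      using int_le[of "e / (I + 1)"] \<open>I \<ge> 0\<close> by simp
  qed
  moreover have "integral {a..b} (\<lambda>x. h x * cnj (h x)) = of_real (integral {a..b} (\<lambda>x. (norm (h x))\<^sup>2))"
    using integral_linear[OF integrable_continuous_interval bounded_linear_of_real, of a b "\<lambda>x. (norm (h x))\<^sup>2"]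
    by (simp add: complex_norm_square[symmetric] o_def continuous_intros conth flip: of_real_power)
  ultimately have "integral {a..b} (\<lambda>x. (norm (h x))\<^sup>2) = 0" by simp
  moreover have "(\<lambda>x. (norm (h x))\<^sup>2) integrable_on {a..b}"
    by (intro integrable_continuous_interval continuous_intros conth)
  ultimately have hi: "((\<lambda>x. (norm (h x))\<^sup>2) has_integral 0) (cbox a b)"
    using integrable_integral by fastforce
  have h0: "h y = 0" if "y \<in> {a..b}" for y
    using has_integral_0_cbox_imp_0[of a b "\<lambda>x. (norm (h x))\<^sup>2" y, OF _ _ hi] ab that
      continuous_on_power[OF continuous_on_norm[OF conth[of "{a..b}"]], of 2]
    by auto
  define n where "n = \<lfloor>(x - a) / (b - a)\<rfloor>"
  have "of_int n \<le> (x - a) / (b - a)" "(x - a) / (b - a) < of_int n + 1" by (auto simp: n_def)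
  hence "of_int n * (b - a) \<le> x - a" "x - a \<le> (of_int n + 1) * (b - a)"
    using ab by (auto simp: pos_le_divide_eq pos_divide_less_eq)
  hence "x + of_int (- n) * (b - a) \<in> {a..b}" by (auto simp: algebra_simps)
  thus ?thesis using h0 periodic_fun_int[OF per, of x "-n"] by metis
qed

lemma trig_series_fourier_coeff:
  assumes ab: "a < b" and per: "periodic_fun a b f" and cont: "continuous_on UNIV f"
    and s: "fourier_coeff a b f abs_summable_on UNIV"
  shows "f = trig_series a b (fourier_coeff a b f)"
proof
  fix x
  have c: "continuous_on S f" for S using cont continuous_on_subset by blast
  have "f x - trig_series a b (fourier_coeff a b f) x = 0"
  proof (rule fourier_coeff_eq_0_imp_eq_0[OF ab])
    show "periodic_fun a b (\<lambda>x. f x - trig_series a b (fourier_coeff a b f) x)"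
      using per ab by (simp add: periodic_fun_def trig_series_periodic)
    show "continuous_on UNIV (\<lambda>x. f x - trig_series a b (fourier_coeff a b f) x)"
      by (intro continuous_intros cont continuous_on_trig_series s)
    show "fourier_coeff a b (\<lambda>x. f x - trig_series a b (fourier_coeff a b f) x) k = 0" for k
      by (simp add: fourier_coeff_diff c continuous_on_trig_series s fourier_coeff_trig_series[OF ab s])
  qed
  thus "f x = trig_series a b (fourier_coeff a b f) x" by simp
qed

section \<open>Taylor remainders mode by mode\<close>

lemma norm_cis_Taylor:
  "norm (cis y - (\<Sum>q<n. (\<i> * of_real y) ^ q / fact q)) \<le> \<bar>y\<bar> ^ n"
proof (cases n)
  case (Suc m)
  have "norm (exp (\<i> * of_real y) - (\<Sum>k\<le>m. (\<i> * of_real y) ^ k / fact k)) \<le> \<bar>y\<bar> ^ Suc m / fact m"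
    using Taylor_exp[of "\<i> * of_real y" m] by (simp add: norm_mult)
  also have "\<dots> \<le> \<bar>y\<bar> ^ Suc m / 1" by (intro divide_left_mono) (auto simp: fact_ge_1)
  finally show ?thesis by (simp add: Suc cis_conv_exp lessThan_Suc_atMost)
qed auto

lemma has_vector_derivative_quadratic_error:
  fixes f :: "real \<Rightarrow> 'a::real_normed_vector"
  assumes "\<And>h. norm (f (x + h) - f x - h *\<^sub>R D) \<le> C * h\<^sup>2"
  shows "(f has_vector_derivative D) (at x)"
proof -
  have C: "C \<ge> 0" using order_trans[OF norm_ge_zero assms[of 1]] by simp
  have "((\<lambda>h. norm (f (x + h) - f x - h *\<^sub>R D) / norm h) \<longlongrightarrow> 0) (at 0)"
  proof (rule tendsto_sandwich[of "\<lambda>_. 0" _ _ "\<lambda>h. C * \<bar>h\<bar>"])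
    show "\<forall>\<^sub>F h in at 0. norm (f (x + h) - f x - h *\<^sub>R D) / norm h \<le> C * \<bar>h\<bar>"
    proof (rule always_eventually, rule allI)
      fix h
      show "norm (f (x + h) - f x - h *\<^sub>R D) / norm h \<le> C * \<bar>h\<bar>"
        using assms[of h] C by (cases "h = 0") (auto simp: divide_le_eq power2_eq_square mult.assoc abs_mult_self_eq)
    qed
    show "((\<lambda>h. C * \<bar>h\<bar>) \<longlongrightarrow> 0) (at 0)" by (auto intro!: tendsto_eq_intros)
  qed auto
  thus ?thesis
    unfolding has_vector_derivative_def has_derivative_at by (auto intro: bounded_linear_scaleR_left)
qed

lemma has_sum_neg:
  fixes f :: "'a \<Rightarrow> 'b::topological_ab_group_add"
  assumes "(f has_sum S) A"
  shows "((\<lambda>x. - f x) has_sum - S) A"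
  using assms by (simp add: has_sum_uminus)

text \<open>Each mode has a second-order Taylor remainder of size h^2 w_k^2 |c_k|, and these bounds
  are summable by the first assumption, so the whole series has a quadratic error.\<close>

lemma has_vector_derivative_trig_series:
  assumes s: "(\<lambda>k. (wavenumber a b k)\<^sup>2 * norm (c k)) summable_on UNIV"
    and c: "c abs_summable_on UNIV"
    and d: "(\<lambda>k. \<i> * wavenumber a b k * c k) abs_summable_on UNIV"
  shows "(trig_series a b c has_vector_derivative
      trig_series a b (\<lambda>k. \<i> * wavenumber a b k * c k) x) (at x)"
proof (rule has_vector_derivative_quadratic_error)
  fix h
  let ?w = "wavenumber a b"
  let ?t = "\<lambda>k. c k * cis (?w k * (x + h)) + - (c k * cis (?w k * x)) + - (of_real h * (\<i> * ?w k * c k * cis (?w k * x)))"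
  have hs: "((\<lambda>k. e k * cis (?w k * y)) has_sum trig_series a b e y) UNIV"
    if "e abs_summable_on UNIV" for e y
    unfolding trig_series_def
    by (rule has_sum_infsum, rule abs_summable_summable, rule trig_series_summable, rule that)
  have "(?t has_sum (trig_series a b c (x + h) + - trig_series a b c x + 
      - (of_real h * trig_series a b (\<lambda>k. \<i> * ?w k * c k) x))) UNIV"
    by (rule has_sum_add has_sum_neg has_sum_cmult_right hs c d)+
  hence eq: "trig_series a b c (x + h) - trig_series a b c x - h *\<^sub>R trig_series a b (\<lambda>k. \<i> * ?w k * c k) x
      = infsum ?t UNIV"
    by (simp add: infsumI scaleR_conv_of_real)
  have t: "norm (?t k) \<le> h\<^sup>2 * ((?w k)\<^sup>2 * norm (c k))" for k
  proof -
    have "?t k = c k * cis (?w k * x) * (cis (?w k * h) - (\<Sum>q<2. (\<i> * of_real (?w k * h)) ^ q / fact q))"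
      by (simp add: numeral_2_eq_2 algebra_simps flip: cis_mult)
    hence "norm (?t k) = norm (c k) * norm (cis (?w k * h) - (\<Sum>q<2. (\<i> * of_real (?w k * h)) ^ q / fact q))"
      by (simp only: norm_mult norm_cis mult_1_right)
    also have "\<dots> \<le> norm (c k) * \<bar>?w k * h\<bar> ^ 2"
      by (intro mult_left_mono norm_cis_Taylor) auto
    finally show ?thesis by (simp add: power_mult_distrib mult_ac)
  qed
  have "norm (infsum ?t UNIV) \<le> infsum (\<lambda>k. h\<^sup>2 * ((?w k)\<^sup>2 * norm (c k))) UNIV"
  proof (rule norm_infsum_le[OF has_sum_infsum has_sum_infsum])
    show "(\<lambda>k. h\<^sup>2 * ((?w k)\<^sup>2 * norm (c k))) summable_on UNIV"
      using s by (rule summable_on_cmult_right)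
    thus "?t summable_on UNIV"
      by (rule abs_summable_summable[OF Infinite_Sum.abs_summable_on_comparison_test']) (rule t)
    show "norm (?t k) \<le> h\<^sup>2 * ((?w k)\<^sup>2 * norm (c k))" for k by (rule t)
  qed
  also have "\<dots> = infsum (\<lambda>k. (?w k)\<^sup>2 * norm (c k)) UNIV * h\<^sup>2"
    using s by (subst infsum_cmult_right) auto
  finally show "norm (trig_series a b c (x + h) - trig_series a b c x - h *\<^sub>R trig_series a b (\<lambda>k. \<i> * ?w k * c k) x)
      \<le> infsum (\<lambda>k. (?w k)\<^sup>2 * norm (c k)) UNIV * h\<^sup>2"
    by (simp add: eq)
qed

section \<open>The Wiener algebra\<close>

text \<open>Only the coefficient sequence is stored, so the algebra is the same for every interval;
  \<open>a\<close> and \<open>b\<close> enter through the evaluation \<open>ev\<close> and the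
  symbols of the operators. A type, rather than a carrier set, makes formal power series with such
  coefficients and ring normalisation available.\<close>

typedef wiener = "{c :: int \<Rightarrow> complex. (\<lambda>k. cmod (c k)) summable_on UNIV}"
  morphisms fc Abs_wiener
  by (rule exI[of _ "\<lambda>_. 0"]) simp

setup_lifting type_definition_wiener

lemma fc_abs_summable [simp, intro]: "(\<lambda>k. cmod (fc f k)) summable_on UNIV"
  using fc[of f] by simp

lemma wiener_eqI: "(\<And>k. fc f k = fc g k) \<Longrightarrow> f = g"
  by (simp add: fc_inject[symmetric] ext)

instantiation wiener :: real_normed_vector
begin

lift_definition zero_wiener :: wiener is "\<lambda>_. 0" by simp

lift_definition plus_wiener :: "wiener \<Rightarrow> wiener \<Rightarrow> wiener" is "\<lambda>c d k. c k + d k"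
proof -
  fix c d :: "int \<Rightarrow> complex"
  assume "(\<lambda>k. cmod (c k)) summable_on UNIV" "(\<lambda>k. cmod (d k)) summable_on UNIV"
  hence "(\<lambda>k. cmod (c k) + cmod (d k)) summable_on UNIV" by (rule summable_on_add)
  thus "(\<lambda>k. cmod (c k + d k)) summable_on UNIV"
    by (rule Infinite_Sum.abs_summable_on_comparison_test') (rule norm_triangle_ineq)
qed

lift_definition uminus_wiener :: "wiener \<Rightarrow> wiener" is "\<lambda>c k. - c k" by simp

definition minus_wiener :: "wiener \<Rightarrow> wiener \<Rightarrow> wiener" where "minus_wiener f g = f + - g"

lift_definition scaleR_wiener :: "real \<Rightarrow> wiener \<Rightarrow> wiener" is "\<lambda>r c k. r *\<^sub>R c k"
  by (auto intro: summable_on_cmult_right)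

lift_definition norm_wiener :: "wiener \<Rightarrow> real" is "\<lambda>c. infsum (\<lambda>k. cmod (c k)) UNIV" .

definition dist_wiener :: "wiener \<Rightarrow> wiener \<Rightarrow> real" where "dist_wiener f g = norm (f - g)"

definition sgn_wiener :: "wiener \<Rightarrow> wiener" where "sgn_wiener f = inverse (norm f) *\<^sub>R f"

definition uniformity_wiener :: "(wiener \<times> wiener) filter" where
  "uniformity_wiener = (INF e\<in>{0 <..}. principal {(x, y). dist x y < e})"

definition open_wiener :: "wiener set \<Rightarrow> bool" where
  "open_wiener U \<longleftrightarrow> (\<forall>x\<in>U. \<forall>\<^sub>F (x', y) in uniformity. x' = x \<longrightarrow> y \<in> U)"

lemma fc_add' [simp]: "fc (f + g) k = fc f k + fc g k"
  and fc_uminus [simp]: "fc (- f) k = - fc f k"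
  and fc_zero [simp]: "fc 0 k = 0"
  and fc_scaleR [simp]: "fc (r *\<^sub>R f) k = r *\<^sub>R fc f k"
  by (transfer; simp)+

lemma fc_minus [simp]: "fc (f - g) k = fc f k - fc g k"
  by (simp add: minus_wiener_def)

lemma norm_wiener_eq: "norm f = infsum (\<lambda>k. cmod (fc f k)) UNIV"
  by transfer simp

instance
proof
  fix f g h :: wiener and r s :: real
  show "f + g + h = f + (g + h)" "f + g = g + f" "0 + f = f" "- f + f = 0" "f - g = f + - g"
    "r *\<^sub>R (f + g) = r *\<^sub>R f + r *\<^sub>R g" "(r + s) *\<^sub>R f = r *\<^sub>R f + s *\<^sub>R f"
    "r *\<^sub>R s *\<^sub>R f = (r * s) *\<^sub>R f" "1 *\<^sub>R f = f"
    by (auto intro!: wiener_eqI simp: algebra_simps)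
  show "dist f g = norm (f - g)" by (rule dist_wiener_def)
  show "sgn f = inverse (norm f) *\<^sub>R f" by (rule sgn_wiener_def)
  show "uniformity = (INF e\<in>{0 <..}. principal {(x, y). dist x (y::wiener) < e})"
    by (rule uniformity_wiener_def)
  show "open U \<longleftrightarrow> (\<forall>x\<in>U. \<forall>\<^sub>F (x', y) in uniformity. x' = x \<longrightarrow> y \<in> U)" for U :: "wiener set"
    by (rule open_wiener_def)
  show "norm f = 0 \<longleftrightarrow> f = 0"
  proof
    assume "norm f = 0"
    hence "cmod (fc f k) = 0" for k
      by (intro nonneg_infsum_le_0D[of "\<lambda>k. cmod (fc f k)" UNIV]) (auto simp: norm_wiener_eq)
    thus "f = 0" by (auto intro!: wiener_eqI)
  qed (simp add: norm_wiener_eq)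
  show "norm (f + g) \<le> norm f + norm g"
    using infsum_mono[of "\<lambda>k. cmod (fc (f + g) k)" UNIV "\<lambda>k. cmod (fc f k) + cmod (fc g k)"]
    by (simp add: norm_wiener_eq infsum_add[symmetric] summable_on_add norm_triangle_ineq del: fc_add')
       (simp add: norm_triangle_ineq)
  show "norm (r *\<^sub>R f) = \<bar>r\<bar> * norm f"
    by (simp add: norm_wiener_eq infsum_cmult_right')
qed

end

definition ev :: "real \<Rightarrow> real \<Rightarrow> wiener \<Rightarrow> real \<Rightarrow> complex" where
  "ev a b f = trig_series a b (fc f)"

lemma ev_add: "ev a b (f + g) x = ev a b f x + ev a b g x"
proof -
  have "((\<lambda>k. fc f k * cis (wavenumber a b k * x) + fc g k * cis (wavenumber a b k * x)) has_sum
      (ev a b f x + ev a b g x)) UNIV"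
    unfolding ev_def trig_series_def
    by (intro has_sum_add has_sum_infsum abs_summable_summable[OF trig_series_summable[OF fc_abs_summable]])
  thus ?thesis by (simp add: ev_def trig_series_def algebra_simps infsumI)
qed

lemma ev_minus: "ev a b (f - g) x = ev a b f x - ev a b g x"
proof -
  have "fc (f - g) = (\<lambda>k. fc f k - fc g k)" by auto
  thus ?thesis by (simp add: ev_def trig_series_diff)
qed

lemma ev_inj: "a < b \<Longrightarrow> (\<And>x. ev a b f x = ev a b g x) \<Longrightarrow> f = g"
  unfolding ev_def by (metis ext fc_abs_summable fc_inject trig_series_inj)

instantiation wiener :: "{comm_ring_1, real_normed_algebra_1}"
begin

lift_definition one_wiener :: wiener is "\<lambda>k. if k = 0 then 1 else 0"
  by (rule finite_nonzero_values_imp_summable_on) (auto intro: finite_subset[of _ "{0}"])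

lift_definition times_wiener :: "wiener \<Rightarrow> wiener \<Rightarrow> wiener" is conv
  by (rule conv_abs_summable)

lemma fc_times: "fc (f * g) = conv (fc f) (fc g)"
  by (rule times_wiener.rep_eq)

lemma fc_one: "fc 1 k = (if k = 0 then 1 else 0)"
  by (simp add: one_wiener.rep_eq)

lemma ev_mult: "ev a b (f * g) x = ev a b f x * ev a b g x"
  by (simp add: ev_def fc_times trig_series_conv)

lemma infsum_at_0:
  fixes g :: "int \<Rightarrow> 'a::{comm_monoid_add,t2_space}"
  assumes "\<And>k. k \<noteq> 0 \<Longrightarrow> g k = 0"
  shows "infsum g UNIV = g 0"
  using infsum_cong_neutral[of UNIV "{0}" g g] assms by auto

lemma ev_one: "ev a b 1 x = 1"
  unfolding ev_def trig_series_def by (subst infsum_at_0) (auto simp: fc_one wavenumber_def)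

instance
proof
  fix f g h :: wiener and r :: real
  \<comment> \<open>On the interval [0, 1] evaluation is injective and turns convolution into
    pointwise multiplication, so the ring laws are inherited from complex-valued functions.\<close>
  show "f * g * h = f * (g * h)" "f * g = g * f" "1 * f = f" "(f + g) * h = f * h + g * h"
      "f * (g + h) = f * g + f * h" "f * 1 = f"
    by (rule ev_inj[of 0 1]; simp add: ev_mult ev_one ev_add algebra_simps)+
  show "(0::wiener) \<noteq> 1"
    using fc_one[of 0] by (metis fc_zero zero_neq_one)
  show sc: "r *\<^sub>R f * g = r *\<^sub>R (f * g)" for f g :: wiener
  proof (rule wiener_eqI)
    fix k
    have "fc (r *\<^sub>R f * g) k = infsum (\<lambda>j. r *\<^sub>R (fc f j * fc g (k - j))) UNIV"
      by (simp add: fc_times conv_def)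
    also have "\<dots> = r *\<^sub>R infsum (\<lambda>j. fc f j * fc g (k - j)) UNIV"
      by (rule infsum_scaleR_right)
    finally show "fc (r *\<^sub>R f * g) k = fc (r *\<^sub>R (f * g)) k" by (simp add: fc_times conv_def)
  qed
  show "f * r *\<^sub>R g = r *\<^sub>R (f * g)"
  proof (rule wiener_eqI)
    fix k
    have "fc (f * r *\<^sub>R g) k = infsum (\<lambda>j. r *\<^sub>R (fc f j * fc g (k - j))) UNIV"
      by (simp add: fc_times conv_def)
    also have "\<dots> = r *\<^sub>R infsum (\<lambda>j. fc f j * fc g (k - j)) UNIV"
      by (rule infsum_scaleR_right)
    finally show "fc (f * r *\<^sub>R g) k = fc (r *\<^sub>R (f * g)) k" by (simp add: fc_times conv_def)
  qed
  show "norm (f * g) \<le> norm f * norm g"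
  proof -
    let ?F = "\<lambda>k. cmod (fc f k)" and ?G = "\<lambda>k. cmod (fc g k)"
    have FG: "?F abs_summable_on UNIV" "?G abs_summable_on UNIV" by simp_all
    have "cmod (conv (fc f) (fc g) k) \<le> conv ?F ?G k" for k
      using norm_infsum_bound[OF conv_inner[OF fc_abs_summable fc_abs_summable], of f g k]
      by (simp add: conv_def norm_mult)
    hence "cmod (fc (f * g) k) \<le> conv ?F ?G k" for k by (simp add: fc_times)
    from infsum_mono[OF fc_abs_summable abs_summable_summable[OF conv_abs_summable[OF FG]] this]
    have "norm (f * g) \<le> infsum (conv ?F ?G) UNIV" by (simp add: norm_wiener_eq)
    also have "\<dots> = norm f * norm g" by (simp add: infsum_conv[OF FG] norm_wiener_eq)
    finally show ?thesis .
  qed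
  show "norm (1::wiener) = 1"
    unfolding norm_wiener_eq by (subst infsum_at_0) (auto simp: fc_one)
qed

end

lemma norm_ev_le: "norm (ev a b f x) \<le> norm f"
  unfolding ev_def norm_wiener_eq by (rule norm_trig_series_le) simp

lemma ev_scaleR: "ev a b (r *\<^sub>R f) x = r *\<^sub>R ev a b f x"
  unfolding ev_def trig_series_def by (simp add: infsum_scaleR_right)

lemma ev_zero: "ev a b 0 x = 0"
  by (simp add: ev_def trig_series_def)

lemma ev_uminus: "ev a b (- f) x = - ev a b f x"
  using ev_minus[of a b 0 f x] by (simp add: ev_zero)

lemma ev_sum: "ev a b (\<Sum>i\<in>I. f i) x = (\<Sum>i\<in>I. ev a b (f i) x)"
  by (induction I rule: infinite_finite_induct) (auto simp: ev_add ev_zero)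

lemma continuous_on_ev: "continuous_on S (ev a b f)"
  unfolding ev_def by (rule continuous_on_trig_series) simp

lemma fourier_coeff_ev: "a < b \<Longrightarrow> fourier_coeff a b (ev a b f) k = fc f k"
  unfolding ev_def by (rule fourier_coeff_trig_series) auto

lemma bounded_linear_fc: "bounded_linear (\<lambda>f. fc f k)"
proof (rule bounded_linear_intro)
  show "norm (fc f k) \<le> norm f * 1" for f
    using finite_sum_le_infsum[OF fc_abs_summable, of "{k}" f] by (simp add: norm_wiener_eq)
qed auto

lemma integral_ev:
  assumes "a < b"
  shows "integral {a..b} (ev a b f) = of_real (b - a) * fc f 0"
  using fourier_coeff_ev[OF assms, of f 0] assms
  by (simp add: fourier_coeff_def wavenumber_def field_simps)

text \<open>The type class offers real scalars only; complex scalars act by multiplication with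
  constant functions.\<close>

lift_definition cst :: "complex \<Rightarrow> wiener" is "\<lambda>z k. if k = 0 then z else 0"
  by (rule finite_nonzero_values_imp_summable_on) (auto intro: finite_subset[of _ "{0}"])

lemma ev_cst: "ev a b (cst z) x = z"
  unfolding ev_def trig_series_def by (subst infsum_at_0) (auto simp: cst.rep_eq wavenumber_def)

lemma fc_cst_mult [simp]: "fc (cst z * f) k = z * fc f k"
  unfolding fc_times conv_def by (subst infsum_at_0) (auto simp: cst.rep_eq)

lemma fc_cst: "fc (cst z) k = (if k = 0 then z else 0)"
  by (simp add: cst.rep_eq)

lemma cst_mult: "cst (z * w) = cst z * cst w"
  and cst_neg: "cst (- z) = - cst z"
  and cst_1: "cst 1 = 1"
  by (rule wiener_eqI; simp add: fc_cst fc_one)+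

lemma cst_of_real: "cst (of_real r) = of_real r"
  unfolding of_real_def[where 'a=wiener]
  by (rule wiener_eqI) (simp add: fc_cst fc_one scaleR_conv_of_real[where 'a=complex])

lemma scaleR_conv_cst: "r *\<^sub>R f = cst (of_real r) * f"
  by (rule wiener_eqI) (simp add: scaleR_conv_of_real[where 'a=complex])

lift_definition cnjw :: "wiener \<Rightarrow> wiener" is "\<lambda>c k. cnj (c (- k))"
proof -
  fix c :: "int \<Rightarrow> complex"
  assume "(\<lambda>k. cmod (c k)) summable_on UNIV"
  thus "(\<lambda>k. cmod (cnj (c (- k)))) summable_on UNIV"
    using summable_on_reindex_bij_betw[of uminus UNIV UNIV "\<lambda>k. cmod (c k)"]
    by (simp add: bij_uminus)
qed

lemma fc_cnjw [simp]: "fc (cnjw f) k = cnj (fc f (- k))"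
  by (simp add: cnjw.rep_eq)

lemma ev_cnjw: "ev a b (cnjw f) x = cnj (ev a b f x)"
proof -
  have "ev a b (cnjw f) x = infsum (\<lambda>k. cnj (fc f (- k) * cis (wavenumber a b (- k) * x))) UNIV"
    unfolding ev_def trig_series_def by (simp add: wavenumber_def cis_cnj)
  also have "\<dots> = cnj (infsum (\<lambda>k. fc f (- k) * cis (wavenumber a b (- k) * x)) UNIV)"
    by (rule infsum_cnj)
  also have "infsum (\<lambda>k. fc f (- k) * cis (wavenumber a b (- k) * x)) UNIV = ev a b f x"
    unfolding ev_def trig_series_def
    using infsum_reindex_bij_betw[of uminus UNIV UNIV "\<lambda>k. fc f k * cis (wavenumber a b k * x)"]
    by (simp add: bij_uminus)
  finally show ?thesis .
qed

lemma cnjw_add: "cnjw (f + g) = cnjw f + cnjw g"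
  and cnjw_scaleR: "cnjw (r *\<^sub>R f) = r *\<^sub>R cnjw f"
  and cnjw_minus: "cnjw (f - g) = cnjw f - cnjw g"
  and cnjw_cst: "cnjw (cst z) = cst (cnj z)"
  and cnjw_cnjw [simp]: "cnjw (cnjw f) = f"
  by (rule wiener_eqI; simp add: fc_cst)+

lemma cnjw_mult: "cnjw (f * g) = cnjw f * cnjw g"
  by (rule ev_inj[of 0 1]) (simp_all add: ev_cnjw ev_mult)

section \<open>A scale of weighted norms\<close>

text \<open>This weight is submultiplicative with constant 1, so the weighted norms become algebra
  norms without constants. It ignores the length of the interval, which is accounted for by
  \<open>om\<close> later.\<close>

definition wt :: "int \<Rightarrow> real" where "wt k = 1 + \<bar>of_int k\<bar>"

lemma wt_ge_1: "wt k \<ge> 1" by (simp add: wt_def)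

lemma wt_pos [simp]: "wt k > 0" "wt k \<ge> 0" "wt k \<noteq> 0" using wt_ge_1[of k] by auto

lemma wt_add_le: "wt (j + l) \<le> wt j * wt l"
proof -
  have "\<bar>real_of_int (j + l)\<bar> \<le> \<bar>of_int j\<bar> + \<bar>of_int l\<bar>" by simp
  moreover have "0 \<le> \<bar>real_of_int j\<bar> * \<bar>real_of_int l\<bar>" by (intro mult_nonneg_nonneg abs_ge_zero)
  ultimately have "\<bar>real_of_int (j + l)\<bar> \<le> \<bar>of_int j\<bar> + (\<bar>of_int l\<bar> + \<bar>real_of_int j\<bar> * \<bar>real_of_int l\<bar>)"
    by linarith
  thus ?thesis by (simp add: wt_def distrib_left distrib_right)
qed

lemma wt_uminus [simp]: "wt (- k) = wt k" by (simp add: wt_def)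

definition W :: "nat \<Rightarrow> wiener set" where
  "W m = {f. (\<lambda>k. wt k ^ m * cmod (fc f k)) summable_on UNIV}"

text \<open>Outside \<open>W m\<close> the sum does not converge and \<open>infsum\<close> returns
  0; for this reason estimates on \<open>nrm\<close> travel with a membership in
  \<open>W m\<close>.\<close>

definition nrm :: "nat \<Rightarrow> wiener \<Rightarrow> real" where
  "nrm m f = infsum (\<lambda>k. wt k ^ m * cmod (fc f k)) UNIV"

lemma W_0 [simp]: "f \<in> W 0" by (simp add: W_def)

lemma nrm_0: "nrm 0 f = norm f" by (simp add: nrm_def norm_wiener_eq)

lemma nrm_nonneg [simp]: "nrm m f \<ge> 0" unfolding nrm_def by (rule infsum_nonneg) simp

lemma sum_le_nrm: "f \<in> W m \<Longrightarrow> finite K \<Longrightarrow> (\<Sum>k\<in>K. wt k ^ m * cmod (fc f k)) \<le> nrm m f"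
  unfolding nrm_def W_def by (rule finite_sum_le_infsum) auto

text \<open>Bounds on all finite sections give membership and the norm bound at once. Comparisons,
  sums, products and the mean value inequality below are reduced to finite sets of modes in this
  way.\<close>

lemma nrm_leI:
  assumes "\<And>K. finite K \<Longrightarrow> (\<Sum>k\<in>K. wt k ^ m * cmod (fc f k)) \<le> B"
  shows "f \<in> W m" "nrm m f \<le> B"
proof -
  have "(\<lambda>k. wt k ^ m * cmod (fc f k)) summable_on UNIV"
    by (rule nonneg_bdd_above_summable_on) (auto intro!: bdd_aboveI2[where M=B] assms)
  thus "f \<in> W m" by (simp add: W_def)
  thus "nrm m f \<le> B" unfolding nrm_def W_def by (intro infsum_le_finite_sums assms) auto
qed

lemma nrm_le_compare:
  assumes g: "g \<in> W n" and B: "\<And>k. wt k ^ m * cmod (fc f k) \<le> B * (wt k ^ n * cmod (fc g k))" "B \<ge> 0"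
  shows "f \<in> W m" "nrm m f \<le> B * nrm n g"
proof -
  have "(\<Sum>k\<in>K. wt k ^ m * cmod (fc f k)) \<le> B * nrm n g" if "finite K" for K
  proof -
    have "(\<Sum>k\<in>K. wt k ^ m * cmod (fc f k)) \<le> (\<Sum>k\<in>K. B * (wt k ^ n * cmod (fc g k)))"
      by (intro sum_mono B)
    also have "\<dots> \<le> B * nrm n g"
      unfolding sum_distrib_left[symmetric] using sum_le_nrm[OF g that] B(2) by (rule mult_left_mono)
    finally show ?thesis .
  qed
  from nrm_leI[OF this] show "f \<in> W m" "nrm m f \<le> B * nrm n g" by blast+
qed

lemma W_mono: "f \<in> W n \<Longrightarrow> m \<le> n \<Longrightarrow> f \<in> W m"
  and nrm_mono: "f \<in> W n \<Longrightarrow> m \<le> n \<Longrightarrow> nrm m f \<le> nrm n f"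
  using nrm_le_compare[of f n m f 1] by (simp_all add: mult_right_mono power_increasing wt_ge_1)

lemma norm_le_nrm: "f \<in> W m \<Longrightarrow> norm f \<le> nrm m f"
  using nrm_mono[of f m 0] by (simp add: nrm_0)

lemma W_add [intro]: "f \<in> W m \<Longrightarrow> g \<in> W m \<Longrightarrow> f + g \<in> W m"
  and nrm_add_le: "f \<in> W m \<Longrightarrow> g \<in> W m \<Longrightarrow> nrm m (f + g) \<le> nrm m f + nrm m g"
proof -
  assume f: "f \<in> W m" and g: "g \<in> W m"
  have "(\<Sum>k\<in>K. wt k ^ m * cmod (fc (f + g) k)) \<le> nrm m f + nrm m g" if "finite K" for K
  proof -
    have "(\<Sum>k\<in>K. wt k ^ m * cmod (fc (f + g) k)) \<le>
        (\<Sum>k\<in>K. wt k ^ m * cmod (fc f k) + wt k ^ m * cmod (fc g k))"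
      unfolding distrib_left[symmetric] by (intro sum_mono mult_left_mono) (auto simp: norm_triangle_ineq)
    thus ?thesis using sum_le_nrm[OF f that] sum_le_nrm[OF g that] by (simp add: sum.distrib)
  qed
  from nrm_leI[OF this] show "f + g \<in> W m" "nrm m (f + g) \<le> nrm m f + nrm m g" by blast+
qed

lemma W_cst_mult [intro]: "f \<in> W m \<Longrightarrow> cst z * f \<in> W m"
  and nrm_cst_mult_le: "f \<in> W m \<Longrightarrow> nrm m (cst z * f) \<le> cmod z * nrm m f"
  using nrm_le_compare[of f m m "cst z * f" "cmod z"] by (auto simp: norm_mult)

lemma W_scaleR [intro]: "f \<in> W m \<Longrightarrow> r *\<^sub>R f \<in> W m"
  and nrm_scaleR_le: "f \<in> W m \<Longrightarrow> nrm m (r *\<^sub>R f) \<le> \<bar>r\<bar> * nrm m f"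
  using nrm_cst_mult_le[of f m "of_real r"] by (auto simp: scaleR_conv_cst)

lemma W_uminus [intro]: "f \<in> W m \<Longrightarrow> - f \<in> W m"
  using W_scaleR[of f m "-1"] by simp

lemma nrm_uminus [simp]: "nrm m (- f) = nrm m f"
  by (simp add: nrm_def)

lemma W_minus [intro]: "f \<in> W m \<Longrightarrow> g \<in> W m \<Longrightarrow> f - g \<in> W m"
  using W_add[of f m "- g"] by auto

lemma W_zero [simp, intro]: "0 \<in> W m" and nrm_zero [simp]: "nrm m 0 = 0"
  by (simp_all add: W_def nrm_def)

lemma W_sum [intro]: "(\<And>i. i \<in> I \<Longrightarrow> f i \<in> W m) \<Longrightarrow> (\<Sum>i\<in>I. f i) \<in> W m"
  by (induction I rule: infinite_finite_induct) auto

lemma nrm_sum_le: "(\<And>i. i \<in> I \<Longrightarrow> f i \<in> W m) \<Longrightarrow> nrm m (\<Sum>i\<in>I. f i) \<le> (\<Sum>i\<in>I. nrm m (f i))"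
proof (induction I rule: infinite_finite_induct)
  case (insert x F)
  have "nrm m (f x + sum f F) \<le> nrm m (f x) + nrm m (sum f F)"
    using insert.prems by (intro nrm_add_le W_sum) auto
  also have "\<dots> \<le> nrm m (f x) + (\<Sum>i\<in>F. nrm m (f i))" using insert by auto
  finally show ?case using insert.hyps by simp
qed auto

text \<open>By submultiplicativity of \<open>wt\<close>, the weighted coefficients of a product are
  dominated by the convolution of the weighted coefficients of the factors, whose total is the
  product of the two totals.\<close>

lemma W_mult [intro]: "f \<in> W m \<Longrightarrow> g \<in> W m \<Longrightarrow> f * g \<in> W m"
  and nrm_mult_le: "f \<in> W m \<Longrightarrow> g \<in> W m \<Longrightarrow> nrm m (f * g) \<le> nrm m f * nrm m g"
proof -
  assume f: "f \<in> W m" and g: "g \<in> W m"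
  let ?F = "\<lambda>k. wt k ^ m * cmod (fc f k)" and ?G = "\<lambda>k. wt k ^ m * cmod (fc g k)"
  have FG: "?F abs_summable_on UNIV" "?G abs_summable_on UNIV" using f g by (simp_all add: W_def)
  have le: "wt k ^ m * cmod (fc (f * g) k) \<le> conv ?F ?G k" for k
  proof -
    have s: "(\<lambda>j. cmod (fc f j * fc g (k - j))) summable_on UNIV"
      by (rule conv_inner) auto
    have "wt k ^ m * cmod (fc (f * g) k) \<le> wt k ^ m * infsum (\<lambda>j. cmod (fc f j * fc g (k - j))) UNIV"
      unfolding fc_times conv_def by (intro mult_left_mono norm_infsum_bound s) auto
    also have "\<dots> = infsum (\<lambda>j. wt k ^ m * cmod (fc f j * fc g (k - j))) UNIV"
      using s by (intro infsum_cmult_right[symmetric]) auto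
    also have "\<dots> \<le> conv ?F ?G k"
      unfolding conv_def
    proof (intro infsum_mono summable_on_cmult_right s)
      show "(\<lambda>j. ?F j * ?G (k - j)) summable_on UNIV"
        using conv_inner[OF FG] by (rule abs_summable_summable)
      show "wt k ^ m * cmod (fc f j * fc g (k - j)) \<le> ?F j * ?G (k - j)" for j
      proof -
        have "wt k ^ m \<le> (wt j * wt (k - j)) ^ m" 
          using wt_add_le[of j "k - j"] by (intro power_mono) auto
        hence "wt k ^ m * (cmod (fc f j) * cmod (fc g (k - j))) \<le>
            (wt j * wt (k - j)) ^ m * (cmod (fc f j) * cmod (fc g (k - j)))"
          by (intro mult_right_mono) auto
        thus ?thesis by (simp add: norm_mult power_mult_distrib mult_ac)
      qed
    qed
    finally show ?thesis .
  qed
  have "(\<Sum>k\<in>K. wt k ^ m * cmod (fc (f * g) k)) \<le> nrm m f * nrm m g" if "finite K" for K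
  proof -
    have "(\<Sum>k\<in>K. wt k ^ m * cmod (fc (f * g) k)) \<le> (\<Sum>k\<in>K. conv ?F ?G k)"
      by (intro sum_mono le)
    also have "\<dots> \<le> infsum (conv ?F ?G) UNIV"
      by (rule finite_sum_le_infsum[OF abs_summable_summable[OF conv_abs_summable[OF FG]] that])
         (auto simp: conv_def intro!: infsum_nonneg)
    also have "\<dots> = nrm m f * nrm m g" by (simp add: infsum_conv[OF FG] nrm_def)
    finally show ?thesis .
  qed
  from nrm_leI[OF this] show "f * g \<in> W m" "nrm m (f * g) \<le> nrm m f * nrm m g" by blast+
qed

lemma W_cst [simp, intro]: "cst z \<in> W m"
proof -
  have "{k. wt k ^ m * cmod (fc (cst z) k) \<noteq> 0} \<subseteq> {0}"
    by (simp add: fc_cst subset_iff)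
  hence "finite {k. wt k ^ m * cmod (fc (cst z) k) \<noteq> 0}"
    by (rule finite_subset) simp
  hence "(\<lambda>k. wt k ^ m * cmod (fc (cst z) k)) summable_on UNIV"
    by (intro finite_nonzero_values_imp_summable_on) simp
  thus ?thesis by (simp only: W_def mem_Collect_eq)
qed

lemma W_cnjw [intro]: "f \<in> W m \<Longrightarrow> cnjw f \<in> W m"
  and nrm_cnjw [simp]: "nrm m (cnjw f) = nrm m f"
proof -
  have b: "bij_betw uminus (UNIV::int set) UNIV" by (simp add: bij_uminus)
  have eq: "(\<lambda>k. wt k ^ m * cmod (fc (cnjw f) k)) = (\<lambda>k. wt (- k) ^ m * cmod (fc f (- k)))" by simp
  show "f \<in> W m \<Longrightarrow> cnjw f \<in> W m"
    unfolding W_def mem_Collect_eq eq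
    by (subst summable_on_reindex_bij_betw[OF b, of "\<lambda>k. wt k ^ m * cmod (fc f k)"])
  show "nrm m (cnjw f) = nrm m f"
    unfolding nrm_def eq
    by (rule infsum_reindex_bij_betw[OF b, of "\<lambda>k. wt k ^ m * cmod (fc f k)"])
qed

section \<open>Fourier multipliers\<close>

text \<open>The value is the junk \<open>0\<close> when the multiplied series does not converge absolutely.\<close>

definition mulop :: "(int \<Rightarrow> complex) \<Rightarrow> wiener \<Rightarrow> wiener" where
  "mulop \<phi> f = Abs_wiener (\<lambda>k. if (\<lambda>k. cmod (\<phi> k * fc f k)) summable_on UNIV then \<phi> k * fc f k else 0)"

lemma fc_mulop:
  assumes "\<And>k. cmod (\<phi> k) \<le> B * wt k ^ d" "f \<in> W d"
  shows "fc (mulop \<phi> f) k = \<phi> k * fc f k"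
proof -
  have "(\<lambda>k. cmod (\<phi> k * fc f k)) summable_on UNIV"
  proof (rule Infinite_Sum.abs_summable_on_comparison_test')
    show "(\<lambda>k. B * (wt k ^ d * cmod (fc f k))) summable_on UNIV"
      using assms(2) unfolding W_def by (intro summable_on_cmult_right) auto
    show "cmod (\<phi> k * fc f k) \<le> B * (wt k ^ d * cmod (fc f k))" for k
      using mult_right_mono[OF assms(1)[of k], of "cmod (fc f k)"] by (simp add: norm_mult mult_ac)
  qed
  thus ?thesis by (simp add: mulop_def Abs_wiener_inverse)
qed

lemma W_mulop:
  assumes "\<And>k. cmod (\<phi> k) \<le> B * wt k ^ d" "f \<in> W (m + d)"
  shows "mulop \<phi> f \<in> W m" and nrm_mulop_le: "nrm m (mulop \<phi> f) \<le> B * nrm (m + d) f"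
proof -
  have f: "f \<in> W d" using assms(2) by (rule W_mono) auto
  \<comment> \<open>Mode 0 has weight 1, so the symbol bound at that mode already forces B to be
    nonnegative.\<close>
  have "B * wt 0 ^ d \<ge> 0" using assms(1)[of 0] norm_ge_zero order_trans by blast
  hence B: "B \<ge> 0" by (simp add: wt_def)
  have "wt k ^ m * cmod (fc (mulop \<phi> f) k) \<le> B * (wt k ^ (m + d) * cmod (fc f k))" for k
    using mult_right_mono[OF assms(1)[of k], of "wt k ^ m * cmod (fc f k)"]
    by (simp add: fc_mulop[OF assms(1) f] norm_mult power_add mult_ac)
  from nrm_le_compare[OF assms(2) this B]
  show "mulop \<phi> f \<in> W m" "nrm m (mulop \<phi> f) \<le> B * nrm (m + d) f" by auto
qed

section \<open>Expansions in powers of the step size\<close>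

text \<open>
  The interval is closed at \<open>0\<close>, so that an expansion of order at least one also fixes the value \<open>f 0\<close>.
\<close>

definition expd :: "nat \<Rightarrow> nat \<Rightarrow> (real \<Rightarrow> wiener) \<Rightarrow> wiener fps \<Rightarrow> bool" where
  "expd n m f c \<longleftrightarrow> (\<forall>q<n. fps_nth c q \<in> W m) \<and>
     (\<exists>C \<delta>. \<delta> > 0 \<and> (\<forall>t\<in>{0..\<delta>}. f t \<in> W m \<and>
        nrm m (f t - (\<Sum>q<n. t ^ q *\<^sub>R fps_nth c q)) \<le> C * t ^ n))"

lemma expdI:
  assumes "\<And>q. q < n \<Longrightarrow> fps_nth c q \<in> W m" "\<delta> > 0"
    "\<And>t. 0 \<le> t \<Longrightarrow> t \<le> \<delta> \<Longrightarrow> f t \<in> W m"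
    "\<And>t. 0 \<le> t \<Longrightarrow> t \<le> \<delta> \<Longrightarrow> nrm m (f t - (\<Sum>q<n. t ^ q *\<^sub>R fps_nth c q)) \<le> C * t ^ n"
  shows "expd n m f c"
  unfolding expd_def
  by (rule conjI, use assms in blast, rule exI[of _ C], rule exI[of _ \<delta>]) (use assms in auto)

text \<open>An expansion with explicit witnesses, normalised to C >= 0 and to a time interval inside
  [0, 1], where powers of t decrease with the exponent.\<close>

definition expd_on :: "nat \<Rightarrow> nat \<Rightarrow> (real \<Rightarrow> wiener) \<Rightarrow> wiener fps \<Rightarrow> real \<Rightarrow> real \<Rightarrow> bool" where
  "expd_on n m f c C \<delta> \<longleftrightarrow> C \<ge> 0 \<and> 0 < \<delta> \<and> \<delta> \<le> 1 \<and> (\<forall>q<n. fps_nth c q \<in> W m) \<and>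
     (\<forall>t. 0 \<le> t \<longrightarrow> t \<le> \<delta> \<longrightarrow> f t \<in> W m \<and>
        nrm m (f t - (\<Sum>q<n. t ^ q *\<^sub>R fps_nth c q)) \<le> C * t ^ n)"

lemma expd_onD:
  assumes "expd_on n m f c C \<delta>"
  shows "C \<ge> 0" "\<delta> > 0" "\<delta> \<le> 1" "\<And>q. q < n \<Longrightarrow> fps_nth c q \<in> W m"
    "\<And>t. 0 \<le> t \<Longrightarrow> t \<le> \<delta> \<Longrightarrow> f t \<in> W m"
    "\<And>t. 0 \<le> t \<Longrightarrow> t \<le> \<delta> \<Longrightarrow> nrm m (f t - (\<Sum>q<n. t ^ q *\<^sub>R fps_nth c q)) \<le> C * t ^ n"
    "\<And>t. (\<Sum>q<n. t ^ q *\<^sub>R fps_nth c q) \<in> W m"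
    "\<And>t. 0 \<le> t \<Longrightarrow> t \<le> \<delta> \<Longrightarrow> f t - (\<Sum>q<n. t ^ q *\<^sub>R fps_nth c q) \<in> W m"
proof -
  show P: "(\<Sum>q<n. t ^ q *\<^sub>R fps_nth c q) \<in> W m" for t
    using assms by (intro W_sum W_scaleR) (auto simp: expd_on_def)
  show "f t - (\<Sum>q<n. t ^ q *\<^sub>R fps_nth c q) \<in> W m" if "0 \<le> t" "t \<le> \<delta>" for t
    using assms that by (intro W_minus P) (auto simp: expd_on_def)
qed (use assms in \<open>auto simp: expd_on_def\<close>)

lemma expdE:
  assumes "expd n m f c"
  obtains C \<delta> where "expd_on n m f c C \<delta>"
proof -
  have nth: "\<forall>q<n. fps_nth c q \<in> W m" using assms by (simp add: expd_def)
  from assms have "\<exists>C \<delta>. \<delta> > 0 \<and> (\<forall>t\<in>{0..\<delta>}. f t \<in> W m \<and>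
      nrm m (f t - (\<Sum>q<n. t ^ q *\<^sub>R fps_nth c q)) \<le> C * t ^ n)"
    by (simp add: expd_def)
  then obtain C \<delta> where C: "\<delta> > 0" "\<forall>t\<in>{0..\<delta>}. f t \<in> W m \<and>
      nrm m (f t - (\<Sum>q<n. t ^ q *\<^sub>R fps_nth c q)) \<le> C * t ^ n"
    by blast
  have "expd_on n m f c (max C 0) (min \<delta> 1)"
    unfolding expd_on_def
  proof (intro conjI allI impI nth)
    fix t :: real assume t: "0 \<le> t" "t \<le> min \<delta> 1"
    have "C * t ^ n \<le> max C 0 * t ^ n" using t by (intro mult_right_mono) auto
    thus "nrm m (f t - (\<Sum>q<n. t ^ q *\<^sub>R fps_nth c q)) \<le> max C 0 * t ^ n"
      using C(2) t by force
    show "f t \<in> W m" using C(2) t by auto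
  qed (use C nth in auto)
  thus ?thesis by (rule that)
qed

lemma nrm_poly_le:
  assumes "\<And>q. q < n \<Longrightarrow> c q \<in> W m" "0 \<le> t" "t \<le> 1"
  shows "(\<Sum>q<n. t ^ q *\<^sub>R c q) \<in> W m" "nrm m (\<Sum>q<n. t ^ q *\<^sub>R c q) \<le> (\<Sum>q<n. nrm m (c q))"
proof -
  show "(\<Sum>q<n. t ^ q *\<^sub>R c q) \<in> W m" using assms by auto
  have "nrm m (\<Sum>q<n. t ^ q *\<^sub>R c q) \<le> (\<Sum>q<n. nrm m (t ^ q *\<^sub>R c q))"
    using assms by (intro nrm_sum_le) auto
  also have "\<dots> \<le> (\<Sum>q<n. nrm m (c q))"
  proof (intro sum_mono)
    fix q assume q: "q \<in> {..<n}"
    have "nrm m (t ^ q *\<^sub>R c q) \<le> \<bar>t ^ q\<bar> * nrm m (c q)" using q assms by (intro nrm_scaleR_le) auto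
    also have "\<dots> \<le> 1 * nrm m (c q)" using assms by (intro mult_right_mono) (auto simp: power_le_one)
    finally show "nrm m (t ^ q *\<^sub>R c q) \<le> nrm m (c q)" by simp
  qed
  finally show "nrm m (\<Sum>q<n. t ^ q *\<^sub>R c q) \<le> (\<Sum>q<n. nrm m (c q))" .
qed

text \<open>The truncated product series consists of the pairs with i + j < n. The remaining pairs
  have i + j >= n, and t <= 1 makes each of them O(t^n).\<close>

lemma nrm_double_sum_trunc:
  assumes b: "\<And>i j. i < n \<Longrightarrow> j < n \<Longrightarrow> b i j \<in> W m" and t: "0 \<le> t" "t \<le> 1"
  shows "nrm m ((\<Sum>i<n. \<Sum>j<n. t ^ (i + j) *\<^sub>R b i j) - (\<Sum>q<n. t ^ q *\<^sub>R (\<Sum>i\<le>q. b i (q - i))))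
     \<le> (\<Sum>i<n. \<Sum>j<n. nrm m (b i j)) * t ^ n"
proof -
  let ?S = "{..<n} \<times> {..<n}" and ?T = "{(i,j). i + j < n}" and ?g = "\<lambda>(i,j). t ^ (i + j) *\<^sub>R b i j"
  have T: "?T \<subseteq> ?S" by auto
  have "(\<Sum>q<n. t ^ q *\<^sub>R (\<Sum>i\<le>q. b i (q - i))) = (\<Sum>q<n. \<Sum>i\<le>q. t ^ (i + (q - i)) *\<^sub>R b i (q - i))"
    by (simp add: scaleR_right.sum)
  also have "\<dots> = sum ?g ?T"
    using sum.triangle_reindex[of "\<lambda>i j. t ^ (i + j) *\<^sub>R b i j" n] by simp
  finally have "(\<Sum>i<n. \<Sum>j<n. t ^ (i + j) *\<^sub>R b i j) - (\<Sum>q<n. t ^ q *\<^sub>R (\<Sum>i\<le>q. b i (q - i))) =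
      sum ?g ?S - sum ?g ?T"
    by (simp add: sum.cartesian_product)
  also have "\<dots> = sum ?g (?S - ?T)"
    using T by (simp add: sum_diff)
  also have "nrm m \<dots> \<le> (\<Sum>p\<in>?S - ?T. nrm m (?g p))"
    using b by (intro nrm_sum_le) auto
  also have "\<dots> \<le> (\<Sum>p\<in>?S - ?T. nrm m (case p of (i,j) \<Rightarrow> b i j) * t ^ n)"
  proof (intro sum_mono)
    fix p assume p: "p \<in> ?S - ?T"
    obtain i j where ij: "p = (i,j)" "i < n" "j < n" "n \<le> i + j" using p by (cases p) auto
    have "nrm m (t ^ (i + j) *\<^sub>R b i j) \<le> \<bar>t ^ (i + j)\<bar> * nrm m (b i j)"
      using b ij by (intro nrm_scaleR_le) auto
    also have "\<dots> \<le> t ^ n * nrm m (b i j)"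
      using ij t by (intro mult_right_mono) (auto simp: power_decreasing)
    finally show "nrm m (?g p) \<le> nrm m (case p of (i,j) \<Rightarrow> b i j) * t ^ n" by (simp add: ij mult.commute)
  qed
  also have "\<dots> \<le> (\<Sum>p\<in>?S. nrm m (case p of (i,j) \<Rightarrow> b i j) * t ^ n)"
    using t by (intro sum_mono2) auto
  also have "\<dots> = (\<Sum>i<n. \<Sum>j<n. nrm m (b i j)) * t ^ n"
    by (simp add: sum.cartesian_product sum_distrib_right case_prod_unfold)
  finally show ?thesis .
qed

lemma expd_mono:
  assumes "expd n m f c" "m' \<le> m"
  shows "expd n m' f c"
proof -
  from assms(1) obtain C \<delta> where "expd_on n m f c C \<delta>" by (rule expdE)
  note * = expd_onD[OF this]
  show ?thesis
  proof (rule expdI[OF _ *(2)])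
    fix t assume t: "0 \<le> t" "t \<le> \<delta>"
    have "f t - (\<Sum>q<n. t ^ q *\<^sub>R fps_nth c q) \<in> W m" using * t by auto
    from order_trans[OF nrm_mono[OF this assms(2)] *(6)[OF t]]
    show "nrm m' (f t - (\<Sum>q<n. t ^ q *\<^sub>R fps_nth c q)) \<le> C * t ^ n" .
    show "f t \<in> W m'" using *(5)[OF t] assms(2) by (rule W_mono)
  qed (use * assms(2) W_mono in blast)
qed

lemma expd_coeff_cong:
  assumes "expd n m f c" "\<And>q. q < n \<Longrightarrow> fps_nth d q = fps_nth c q"
  shows "expd n m f d"
  using assms by (simp add: expd_def cong: sum.cong_simp)

lemma expd_order_mono:
  assumes "expd n m f c" "n' \<le> n"
  shows "expd n' m f c"
proof -
  from assms(1) obtain C \<delta> where "expd_on n m f c C \<delta>" by (rule expdE)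
  note * = expd_onD[OF this]
  show ?thesis
  proof (rule expdI[OF _ *(2)])
    fix t assume t: "0 \<le> t" "t \<le> \<delta>"
    have t1: "t \<le> 1" using t * by simp
    show "f t \<in> W m" using *(5)[OF t] .
    let ?P = "\<lambda>n. \<Sum>q<n. t ^ q *\<^sub>R fps_nth c q"
    have "?P n = ?P n' + (\<Sum>q=n'..<n. t ^ q *\<^sub>R fps_nth c q)"
      using assms(2) by (simp add: sum.atLeastLessThan_concat lessThan_atLeast0)
    hence eq: "f t - ?P n' = (f t - ?P n) + (\<Sum>q=n'..<n. t ^ q *\<^sub>R fps_nth c q)" by simp
    have "nrm m (\<Sum>q=n'..<n. t ^ q *\<^sub>R fps_nth c q) \<le> (\<Sum>q=n'..<n. nrm m (t ^ q *\<^sub>R fps_nth c q))"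
      using * by (intro nrm_sum_le) auto
    also have "\<dots> \<le> (\<Sum>q=n'..<n. t ^ n' * nrm m (fps_nth c q))"
    proof (intro sum_mono)
      fix q assume q: "q \<in> {n'..<n}"
      have "nrm m (t ^ q *\<^sub>R fps_nth c q) \<le> \<bar>t ^ q\<bar> * nrm m (fps_nth c q)"
        using q * by (intro nrm_scaleR_le) auto
      also have "\<dots> \<le> t ^ n' * nrm m (fps_nth c q)"
        using q t t1 by (intro mult_right_mono) (auto simp: power_decreasing)
      finally show "nrm m (t ^ q *\<^sub>R fps_nth c q) \<le> t ^ n' * nrm m (fps_nth c q)" .
    qed
    finally have 1: "nrm m (\<Sum>q=n'..<n. t ^ q *\<^sub>R fps_nth c q) \<le> (\<Sum>q=n'..<n. nrm m (fps_nth c q)) * t ^ n'"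
      by (simp add: sum_distrib_left mult.commute)
    have 2: "nrm m (f t - ?P n) \<le> C * t ^ n'"
      by (rule order_trans[OF *(6)[OF t]]) (use * t t1 assms in \<open>auto intro!: mult_left_mono power_decreasing\<close>)
    have "nrm m (f t - ?P n') \<le> nrm m (f t - ?P n) + nrm m (\<Sum>q=n'..<n. t ^ q *\<^sub>R fps_nth c q)"
      unfolding eq using * t by (intro nrm_add_le W_sum W_scaleR) auto
    thus "nrm m (f t - ?P n') \<le> (C + (\<Sum>q=n'..<n. nrm m (fps_nth c q))) * t ^ n'"
      using 1 2 by (simp add: algebra_simps)
  qed (use * assms(2) in auto)
qed

lemma expd_add:
  assumes "expd n m f c" "expd n m g d"
  shows "expd n m (\<lambda>t. f t + g t) (c + d)"
proof -
  from assms(1) obtain C \<delta> where "expd_on n m f c C \<delta>" by (rule expdE)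
  note * = expd_onD[OF this]
  from assms(2) obtain C' \<delta>' where "expd_on n m g d C' \<delta>'" by (rule expdE)
  note ** = expd_onD[OF this]
  show ?thesis
  proof (rule expdI[of _ _ _ "min \<delta> \<delta>'"])
    fix t assume t: "0 \<le> t" "t \<le> min \<delta> \<delta>'"
    have "f t + g t - (\<Sum>q<n. t ^ q *\<^sub>R fps_nth (c + d) q) =
        (f t - (\<Sum>q<n. t ^ q *\<^sub>R fps_nth c q)) + (g t - (\<Sum>q<n. t ^ q *\<^sub>R fps_nth d q))"
      by (simp add: scaleR_add_right sum.distrib)
    also have "nrm m \<dots> \<le> nrm m (f t - (\<Sum>q<n. t ^ q *\<^sub>R fps_nth c q)) + nrm m (g t - (\<Sum>q<n. t ^ q *\<^sub>R fps_nth d q))"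
      using *(8)[of t] **(8)[of t] t by (intro nrm_add_le) auto
    also have "\<dots> \<le> (C + C') * t ^ n"
      using *(6)[of t] **(6)[of t] t by (simp add: algebra_simps)
    finally show "nrm m (f t + g t - (\<Sum>q<n. t ^ q *\<^sub>R fps_nth (c + d) q)) \<le> (C + C') * t ^ n" .
  qed (use * ** in auto)
qed

definition fps_map :: "(wiener \<Rightarrow> wiener) \<Rightarrow> wiener fps \<Rightarrow> wiener fps" where
  "fps_map T c = Abs_fps (\<lambda>q. T (fps_nth c q))"

lemma fps_map_nth [simp]: "fps_nth (fps_map T c) q = T (fps_nth c q)"
  by (simp add: fps_map_def)

text \<open>Linearity is asked only on \<open>W m'\<close> because a Fourier multiplier takes the
  default value 0 outside its domain and is not additive there.\<close>

lemma expd_map: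
  assumes f: "expd n m' f c"
    and T: "\<And>f g. f \<in> W m' \<Longrightarrow> g \<in> W m' \<Longrightarrow> T (f + g) = T f + T g"
      "\<And>r f. f \<in> W m' \<Longrightarrow> T (r *\<^sub>R f) = r *\<^sub>R T f"
      "\<And>f. f \<in> W m' \<Longrightarrow> T f \<in> W m" "\<And>f. f \<in> W m' \<Longrightarrow> nrm m (T f) \<le> B * nrm m' f" "B \<ge> 0"
  shows "expd n m (\<lambda>t. T (f t)) (fps_map T c)"
proof -
  from f obtain C \<delta> where "expd_on n m' f c C \<delta>" by (rule expdE)
  note * = expd_onD[OF this]
  have T0: "T 0 = 0" using T(2)[of 0 0] by simp
  have Tsum: "T (\<Sum>q\<in>I. h q) = (\<Sum>q\<in>I. T (h q))" if "\<And>q. q \<in> I \<Longrightarrow> h q \<in> W m'" for h and I :: "nat set"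
    using that by (induction I rule: infinite_finite_induct) (auto simp: T0 T(1) W_sum)
  have Tm: "T (f - g) = T f - T g" if "f \<in> W m'" "g \<in> W m'" for f g
    using T(1)[of f "- g"] T(2)[of g "-1"] that by auto
  show ?thesis
  proof (rule expdI[OF _ *(2)])
    fix t assume t: "0 \<le> t" "t \<le> \<delta>"
    have "T (f t) - (\<Sum>q<n. t ^ q *\<^sub>R fps_nth (fps_map T c) q) = T (f t - (\<Sum>q<n. t ^ q *\<^sub>R fps_nth c q))"
    proof -
      have "T (\<Sum>q<n. t ^ q *\<^sub>R fps_nth c q) = (\<Sum>q<n. T (t ^ q *\<^sub>R fps_nth c q))"
        using *(4) by (intro Tsum W_scaleR) auto
      also have "\<dots> = (\<Sum>q<n. t ^ q *\<^sub>R T (fps_nth c q))"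
        using *(4) by (intro sum.cong T(2)) auto
      finally show ?thesis using Tm[OF *(5)[OF t] *(7)] by simp
    qed
    also have "nrm m \<dots> \<le> B * nrm m' (f t - (\<Sum>q<n. t ^ q *\<^sub>R fps_nth c q))"
      using * t by (intro T(4)) auto
    also have "\<dots> \<le> B * (C * t ^ n)" using *(6)[OF t] T(5) by (intro mult_left_mono) auto
    finally show "nrm m (T (f t) - (\<Sum>q<n. t ^ q *\<^sub>R fps_nth (fps_map T c) q)) \<le> (B * C) * t ^ n" by simp
  qed (use * T in auto)
qed

lemma expd_cst_mult:
  assumes "expd n m f c"
  shows "expd n m (\<lambda>t. cst z * f t) (fps_map (\<lambda>x. cst z * x) c)"
  by (rule expd_map[OF assms, where B="cmod z"]) (auto simp: distrib_left nrm_cst_mult_le)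

lemma expd_scaleR:
  assumes "expd n m f c"
  shows "expd n m (\<lambda>t. r *\<^sub>R f t) (fps_map (\<lambda>x. r *\<^sub>R x) c)"
  by (rule expd_map[OF assms, where B="\<bar>r\<bar>"])
     (auto simp: scaleR_add_right nrm_scaleR_le)

lemma expd_uminus:
  assumes "expd n m f c"
  shows "expd n m (\<lambda>t. - f t) (fps_map uminus c)"
  by (rule expd_map[OF assms, where B=1]) auto

lemma expd_cnjw:
  assumes "expd n m f c"
  shows "expd n m (\<lambda>t. cnjw (f t)) (fps_map cnjw c)"
  by (rule expd_map[OF assms, where B=1]) (auto simp: cnjw_add cnjw_scaleR)

lemma expd_const:
  assumes "u \<in> W m"
  shows "expd n m (\<lambda>_. u) (fps_const u)"
proof (rule expdI[of _ _ _ 1 _ "nrm m u"])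
  fix t :: real assume t: "0 \<le> t"
  have "(\<Sum>q<n. t ^ q *\<^sub>R fps_nth (fps_const u) q) = (if n = 0 then 0 else u)"
    by (cases n) (auto simp: sum.lessThan_Suc_shift simp del: sum.lessThan_Suc)
  thus "nrm m (u - (\<Sum>q<n. t ^ q *\<^sub>R fps_nth (fps_const u) q)) \<le> nrm m u * t ^ n"
    using t by auto
qed (use assms in auto)

lemma expd_sum:
  assumes "\<And>i. i \<in> I \<Longrightarrow> expd n m (f i) (c i)"
  shows "expd n m (\<lambda>t. \<Sum>i\<in>I. f i t) (\<Sum>i\<in>I. c i)"
  using assms
proof (induction I rule: infinite_finite_induct)
  case (insert x F)
  thus ?case by (simp add: expd_add)
qed (use expd_const[of 0] in auto)

lemma expd_times_step:
  assumes "expd n m f c"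
  shows "expd n m (\<lambda>t. t *\<^sub>R f t) (fps_X * c)"
proof -
  from assms(1) obtain C \<delta> where "expd_on n m f c C \<delta>" by (rule expdE)
  note * = expd_onD[OF this]
  show ?thesis
  proof (rule expdI[OF _ *(2)])
    fix t assume t: "0 \<le> t" "t \<le> \<delta>"
    have t1: "t \<le> 1" using t * by simp
    define R where "R = f t - (\<Sum>q<n. t ^ q *\<^sub>R fps_nth c q)"
    have R: "R \<in> W m" "nrm m R \<le> C * t ^ n" unfolding R_def using * t by auto
    have tR: "nrm m (t *\<^sub>R R) \<le> C * t ^ n"
      using order_trans[OF nrm_scaleR_le[OF R(1), of t]] R(2) t t1
        mult_left_le_one_le[of "nrm m R" t] by fastforce
    \<comment> \<open>The shifted series is cut at the same order n, so the coefficient of index n -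
      1 of \<open>c\<close> moves into the remainder; for n = 0 there is none.\<close>
    show "nrm m (t *\<^sub>R f t - (\<Sum>q<n. t ^ q *\<^sub>R fps_nth (fps_X * c) q))
        \<le> (C + (if n = 0 then 0 else nrm m (fps_nth c (n - 1)))) * t ^ n"
    proof (cases n)
      case 0
      thus ?thesis using tR by (simp add: R_def)
    next
      case (Suc n')
      have "t *\<^sub>R f t - (\<Sum>q<n. t ^ q *\<^sub>R fps_nth (fps_X * c) q) = t *\<^sub>R R + t ^ n *\<^sub>R fps_nth c n'"
        unfolding Suc R_def
        by (subst sum.lessThan_Suc_shift) (simp add: algebra_simps scaleR_right.sum scaleR_sum_right)
      also have "nrm m \<dots> \<le> nrm m (t *\<^sub>R R) + nrm m (t ^ n *\<^sub>R fps_nth c n')"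
        using R * Suc by (intro nrm_add_le) auto
      also have "\<dots> \<le> C * t ^ n + \<bar>t ^ n\<bar> * nrm m (fps_nth c n')"
        using * Suc by (intro add_mono tR nrm_scaleR_le) auto
      finally show ?thesis using t Suc by (simp add: algebra_simps)
    qed
  next
    fix q assume "q < n"
    thus "fps_nth (fps_X * c) q \<in> W m" using * by (cases q) auto
  qed (use * in auto)
qed

lemma expd_bound:
  assumes "expd n m f c"
  obtains B \<delta> where "\<delta> > 0" "B \<ge> 0" "\<And>t. 0 \<le> t \<Longrightarrow> t \<le> \<delta> \<Longrightarrow> f t \<in> W m \<and> nrm m (f t) \<le> B"
proof -
  have "expd 0 m f c" using assms by (rule expd_order_mono) simp
  then obtain C \<delta> where "expd_on 0 m f c C \<delta>" by (rule expdE)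
  note * = expd_onD[OF this]
  show ?thesis using that[of \<delta> C] * by auto
qed

lemma expd_mult:
  assumes "expd n m f c" "expd n m g d"
  shows "expd n m (\<lambda>t. f t * g t) (c * d)"
proof -
  from assms(1) obtain C \<delta> where "expd_on n m f c C \<delta>" by (rule expdE)
  note * = expd_onD[OF this]
  from assms(2) obtain C' \<delta>' where "expd_on n m g d C' \<delta>'" by (rule expdE)
  note ** = expd_onD[OF this]
  from assms(2) obtain B \<epsilon> where B: "\<epsilon> > 0" "B \<ge> 0" "\<And>t. 0 \<le> t \<Longrightarrow> t \<le> \<epsilon> \<Longrightarrow> g t \<in> W m \<and> nrm m (g t) \<le> B"
    by (rule expd_bound) blast
  let ?A = "\<Sum>q<n. nrm m (fps_nth c q)"
  let ?E = "\<Sum>i<n. \<Sum>j<n. nrm m (fps_nth c i * fps_nth d j)"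
  have nn: "?A \<ge> 0" by (simp add: sum_nonneg)
  show ?thesis
  proof (rule expdI[of _ _ _ "min \<epsilon> (min \<delta> \<delta>')"])
    fix q assume "q < n"
    thus "fps_nth (c * d) q \<in> W m" using * ** by (auto simp: fps_mult_nth intro!: W_sum W_mult)
  next
    fix t assume t: "0 \<le> t" "t \<le> min \<epsilon> (min \<delta> \<delta>')"
    show "f t * g t \<in> W m" using t * ** by auto
    let ?P = "\<Sum>q<n. t ^ q *\<^sub>R fps_nth c q" and ?Q = "\<Sum>q<n. t ^ q *\<^sub>R fps_nth d q"
    let ?T = "\<Sum>q<n. t ^ q *\<^sub>R fps_nth (c * d) q"
    have PQ: "?P * ?Q = (\<Sum>i<n. \<Sum>j<n. t ^ (i + j) *\<^sub>R (fps_nth c i * fps_nth d j))"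
      by (simp add: sum_product power_add mult_ac)
    have P: "?P \<in> W m" "nrm m ?P \<le> ?A" using * t by (auto intro!: nrm_poly_le)
    have Q: "?Q \<in> W m" using ** t by (auto intro!: nrm_poly_le)
    have T: "?T \<in> W m" using * ** by (auto simp: fps_mult_nth intro!: W_sum W_mult)
    have t': "0 \<le> t" "t \<le> \<delta>" "t \<le> \<delta>'" "t \<le> \<epsilon>" "t \<le> 1" using t *(3) by auto
    have g: "g t \<in> W m" "nrm m (g t) \<le> B" using B(3)[OF t'(1,4)] by auto
    have e1: "nrm m ((f t - ?P) * g t) \<le> (C * t ^ n) * B"
      by (rule order_trans[OF nrm_mult_le[OF *(8)[OF t'(1,2)] g(1)]
            mult_mono[OF *(6)[OF t'(1,2)] g(2)]]) (use * t' in simp_all)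
    have e2: "nrm m (?P * (g t - ?Q)) \<le> ?A * (C' * t ^ n)"
      by (rule order_trans[OF nrm_mult_le[OF P(1) **(8)[OF t'(1,3)]]
            mult_mono[OF P(2) **(6)[OF t'(1,3)] nn]]) simp
    have cd: "fps_nth c i * fps_nth d j \<in> W m" if "i < n" "j < n" for i j
      using that by (intro W_mult *(4) **(4))
    have e3: "nrm m (?P * ?Q - ?T) \<le> ?E * t ^ n"
      unfolding PQ fps_mult_nth atMost_atLeast0[symmetric]
      by (rule nrm_double_sum_trunc[OF cd t'(1,5)])
    \<comment> \<open>Telescoping from f g over P g and P Q to the truncated product: the first two
      differences are a remainder times a bounded factor, the last one collects the terms of degree
      at least n.\<close>
    have eq: "f t * g t - ?T = (f t - ?P) * g t + (?P * (g t - ?Q) + (?P * ?Q - ?T))"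
      by (simp add: algebra_simps)
    have le: "nrm m (f t * g t - ?T) \<le>
        nrm m ((f t - ?P) * g t) + (nrm m (?P * (g t - ?Q)) + nrm m (?P * ?Q - ?T))"
      unfolding eq
      by (intro order_trans[OF nrm_add_le] add_left_mono nrm_add_le W_mult W_add W_minus
          *(5)[OF t'(1,2)] **(5)[OF t'(1,3)] g P Q T order_refl)
    show "nrm m (f t * g t - ?T) \<le> (C * B + ?A * C' + ?E) * t ^ n"
    proof -
      have "x + (y + z) \<le> (C * B + A * C' + E) * t ^ n"
        if "x \<le> C * t ^ n * B" "y \<le> A * (C' * t ^ n)" "z \<le> E * t ^ n" for x y z A E :: real
        using add_mono[OF that(1) add_mono[OF that(2,3)]] by (simp add: algebra_simps)
      from order_trans[OF le this[OF e1 e2 e3]] show ?thesis .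
    qed
  qed (use * ** B in auto)
qed

text \<open>This is how agreement of coefficients becomes a local error bound: the difference has an
  expansion whose coefficients below n all vanish.\<close>

lemma expd_diff_bound:
  assumes "expd n m f c" "expd n m g d" "\<And>q. q < n \<Longrightarrow> fps_nth c q = fps_nth d q"
  obtains C \<delta> where "C \<ge> 0" "\<delta> > 0" "\<And>t. 0 \<le> t \<Longrightarrow> t \<le> \<delta> \<Longrightarrow>
    f t \<in> W m \<and> g t \<in> W m \<and> nrm m (f t - g t) \<le> C * t ^ n"
proof -
  have "expd n m (\<lambda>t. f t + - g t) (c + fps_map uminus d)"
    by (intro expd_add expd_uminus assms)
  then obtain C \<delta> where "expd_on n m (\<lambda>t. f t + - g t) (c + fps_map uminus d) C \<delta>" by (rule expdE)
  note * = expd_onD[OF this]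
  from assms(1) obtain C1 \<delta>1 where "expd_on n m f c C1 \<delta>1" by (rule expdE)
  note 1 = expd_onD[OF this]
  from assms(2) obtain C2 \<delta>2 where "expd_on n m g d C2 \<delta>2" by (rule expdE)
  note 2 = expd_onD[OF this]
  show ?thesis
    by (rule that[of C "min \<delta> (min \<delta>1 \<delta>2)"]) (use *(1,2,6) 1(2,5) 2(2,5) assms(3) in auto)
qed

section \<open>The derivative and the linear group as Fourier multipliers\<close>

locale torus =
  fixes a b :: real
  assumes ab: "a < b"
begin

definition om :: real where "om = 2 * pi / (b - a)"

lemma om_pos: "om > 0" using ab by (simp add: om_def)

lemma wn_eq: "wavenumber a b k = om * of_int k"
  by (simp add: wavenumber_def om_def)

lemma wn_le: "\<bar>wavenumber a b k\<bar> \<le> om * wt k"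
  using om_pos by (simp add: wn_eq wt_def abs_mult)

definition D :: "wiener \<Rightarrow> wiener" where "D = mulop (\<lambda>k. \<i> * wavenumber a b k)"

lemma D_symbol: "cmod (\<i> * wavenumber a b k) \<le> om * wt k ^ 1"
  using wn_le by (simp add: norm_mult)

lemma fc_D: "f \<in> W 1 \<Longrightarrow> fc (D f) k = \<i> * wavenumber a b k * fc f k"
  unfolding D_def by (rule fc_mulop[OF D_symbol])

lemma W_D: "f \<in> W (Suc m) \<Longrightarrow> D f \<in> W m"
  and nrm_D_le: "f \<in> W (Suc m) \<Longrightarrow> nrm m (D f) \<le> om * nrm (Suc m) f"
  unfolding D_def using W_mulop[OF D_symbol, of f m] nrm_mulop_le[OF D_symbol, of f m] by auto

lemma norm_D_le: "f \<in> W 1 \<Longrightarrow> norm (D f) \<le> om * nrm 1 f"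
  using nrm_D_le[of f 0] by (simp add: nrm_0)

lemma D_add: "f \<in> W 1 \<Longrightarrow> g \<in> W 1 \<Longrightarrow> D (f + g) = D f + D g"
  by (rule wiener_eqI) (simp add: fc_D W_add distrib_left)

lemma D_minus: "f \<in> W 1 \<Longrightarrow> g \<in> W 1 \<Longrightarrow> D (f - g) = D f - D g"
  by (rule wiener_eqI) (simp add: fc_D W_minus right_diff_distrib)

lemma D_uminus: "f \<in> W 1 \<Longrightarrow> D (- f) = - D f"
  by (rule wiener_eqI) (simp add: fc_D W_uminus)

lemma D_scaleR: "f \<in> W 1 \<Longrightarrow> D (r *\<^sub>R f) = r *\<^sub>R D f"
  by (rule wiener_eqI) (simp add: fc_D W_scaleR)

lemma D_cst_mult: "f \<in> W 1 \<Longrightarrow> D (cst z * f) = cst z * D f"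
  by (rule wiener_eqI) (simp add: fc_D W_cst_mult)

lemma D_cnjw: "f \<in> W 1 \<Longrightarrow> D (cnjw f) = cnjw (D f)"
  by (rule wiener_eqI) (simp add: fc_D W_cnjw wn_eq)

text \<open>The Leibniz rule is additivity of the wavenumber, w_k = w_j + w_(k - j), inside the
  convolution sum.\<close>

lemma D_mult:
  assumes f: "f \<in> W 1" and g: "g \<in> W 1"
  shows "D (f * g) = D f * g + f * D g"
proof (rule wiener_eqI)
  fix k
  have s: "(\<lambda>j. fc p j * fc q (k - j)) summable_on UNIV" for p q
    using conv_inner[OF fc_abs_summable fc_abs_summable, of p q k] by (rule abs_summable_summable)
  have "fc (D (f * g)) k = infsum (\<lambda>j. \<i> * wavenumber a b k * (fc f j * fc g (k - j))) UNIV"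
    unfolding fc_D[OF W_mult[OF f g]] fc_times conv_def by (rule infsum_cmult_right[symmetric]) (rule s)
  also have "\<dots> = infsum (\<lambda>j. fc (D f) j * fc g (k - j) + fc f j * fc (D g) (k - j)) UNIV"
    by (rule infsum_cong) (simp add: fc_D[OF f] fc_D[OF g] wn_eq algebra_simps)
  also have "\<dots> = infsum (\<lambda>j. fc (D f) j * fc g (k - j)) UNIV + infsum (\<lambda>j. fc f j * fc (D g) (k - j)) UNIV"
    by (rule infsum_add[OF s s])
  finally show "fc (D (f * g)) k = fc (D f * g + f * D g) k"
    by (simp add: fc_times conv_def)
qed

lemma fc_D_0: "f \<in> W 1 \<Longrightarrow> fc (D f) 0 = 0"
  by (simp add: fc_D wn_eq)

text \<open>Two weights are spent because the derivative is obtained from a quadratic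
  remainder.\<close>

lemma ev_has_vector_derivative:
  assumes "f \<in> W 2"
  shows "(ev a b f has_vector_derivative ev a b (D f) x) (at x)"
proof -
  have f1: "f \<in> W 1" using assms by (rule W_mono) simp
  have D: "fc (D f) = (\<lambda>k. \<i> * wavenumber a b k * fc f k)" using fc_D[OF f1] by auto
  have "(\<lambda>k. (wavenumber a b k)\<^sup>2 * cmod (fc f k)) summable_on UNIV"
  proof (rule summable_on_comparison_test[where f="\<lambda>k. om\<^sup>2 * (wt k ^ 2 * cmod (fc f k))"])
    show "(\<lambda>k. om\<^sup>2 * (wt k ^ 2 * cmod (fc f k))) summable_on UNIV"
      using assms unfolding W_def by (intro summable_on_cmult_right) auto
    show "(wavenumber a b k)\<^sup>2 * cmod (fc f k) \<le> om\<^sup>2 * (wt k ^ 2 * cmod (fc f k))" for k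
      using power_mono[OF wn_le[of k], of 2]
      by (auto simp: power_mult_distrib mult.assoc[symmetric] intro!: mult_right_mono)
  qed auto
  thus ?thesis
    unfolding ev_def D using fc_abs_summable[of "D f"] unfolding D
    by (intro has_vector_derivative_trig_series) auto
qed

lemma dx_ev: "f \<in> W 2 \<Longrightarrow> dx (ev a b f) = ev a b (D f)"
  unfolding dx_def using ev_has_vector_derivative vector_derivative_at by blast

definition eL :: "real \<Rightarrow> wiener \<Rightarrow> wiener" where
  "eL t = mulop (\<lambda>k. cis (- (t * (wavenumber a b k)\<^sup>2)))"

lemma eL_symbol: "cmod (cis (- (t * (wavenumber a b k)\<^sup>2))) \<le> 1 * wt k ^ 0"
  by simp

lemma fc_eL [simp]: "fc (eL t f) k = cis (- (t * (wavenumber a b k)\<^sup>2)) * fc f k"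
  unfolding eL_def by (rule fc_mulop[OF eL_symbol W_0])

lemma W_eL_iff [simp]: "eL t f \<in> W m \<longleftrightarrow> f \<in> W m"
  and nrm_eL [simp]: "nrm m (eL t f) = nrm m f"
  and norm_eL [simp]: "norm (eL t f) = norm f"
  by (simp_all add: W_def nrm_def norm_mult norm_wiener_eq)

lemma eL_add: "eL t (f + g) = eL t f + eL t g"
  and eL_minus: "eL t (f - g) = eL t f - eL t g"
  and eL_scaleR: "eL t (r *\<^sub>R f) = r *\<^sub>R eL t f"
  and eL_zero [simp]: "eL t 0 = 0"
  and eL_0 [simp]: "eL 0 f = f"
  by (rule wiener_eqI; simp add: ring_distribs mult.left_commute)+

lemma eL_eL: "eL s (eL t f) = eL (s + t) f"
  by (rule wiener_eqI) (simp add: cis_mult algebra_simps flip: mult.assoc)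

lemma eL_sum: "eL t (\<Sum>i\<in>I. f i) = (\<Sum>i\<in>I. eL t (f i))"
  by (induction I rule: infinite_finite_induct) (auto simp: eL_add)

lemma expL_ev: "expL a b t (ev a b f) = ev a b (eL t f)"
  unfolding expL_def fourier_coeff_ev[OF ab] by (rule ext) (simp add: ev_def trig_series_def)

text \<open>The Taylor coefficient \<open>L^q / q!\<close> of the unitary group; each power of the
  linear operator costs two weights.\<close>

definition Lpow :: "nat \<Rightarrow> wiener \<Rightarrow> wiener" where
  "Lpow q = mulop (\<lambda>k. (\<i> * of_real (- ((wavenumber a b k)\<^sup>2))) ^ q / fact q)"

lemma Lpow_symbol: "cmod ((\<i> * of_real (- ((wavenumber a b k)\<^sup>2))) ^ q / fact q) \<le> om ^ (2 * q) * wt k ^ (2 * q)"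
proof -
  have "cmod ((\<i> * of_real (- ((wavenumber a b k)\<^sup>2))) ^ q / fact q) = (\<bar>wavenumber a b k\<bar> ^ 2) ^ q / fact q"
    by (simp add: norm_divide norm_power norm_mult)
  also have "\<dots> \<le> (\<bar>wavenumber a b k\<bar> ^ 2) ^ q / 1"
    by (intro divide_left_mono) (auto simp: fact_ge_1)
  also have "\<dots> = \<bar>wavenumber a b k\<bar> ^ (2 * q)" by (simp add: power_mult)
  also have "\<dots> \<le> (om * wt k) ^ (2 * q)" by (intro power_mono wn_le) auto
  finally show ?thesis by (simp add: power_mult_distrib)
qed

lemma fc_Lpow: "f \<in> W (2 * q) \<Longrightarrow> fc (Lpow q f) k = (\<i> * of_real (- ((wavenumber a b k)\<^sup>2))) ^ q / fact q * fc f k"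
  unfolding Lpow_def by (rule fc_mulop[OF Lpow_symbol])

lemma W_Lpow: "f \<in> W (m + 2 * q) \<Longrightarrow> Lpow q f \<in> W m"
  unfolding Lpow_def by (rule W_mulop(1)[OF Lpow_symbol])

text \<open>At a purely imaginary argument the remainder of the exponential is at most |s w_k^2|^n,
  for either sign of s. The group generated by an unbounded operator therefore has Taylor expansions
  at the price of 2 n weights.\<close>

lemma nrm_eL_Taylor:
  assumes f: "f \<in> W (m + 2 * n)"
  shows "nrm m (eL s f - (\<Sum>q<n. s ^ q *\<^sub>R Lpow q f)) \<le> \<bar>s\<bar> ^ n * om ^ (2 * n) * nrm (m + 2 * n) f"
proof -
  have fq: "f \<in> W (2 * q)" if "q < n" for q using f by (rule W_mono) (use that in auto)
  have "wt k ^ m * cmod (fc (eL s f - (\<Sum>q<n. s ^ q *\<^sub>R Lpow q f)) k)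
      \<le> (\<bar>s\<bar> ^ n * om ^ (2 * n)) * (wt k ^ (m + 2 * n) * cmod (fc f k))" for k
  proof -
    let ?y = "- (s * (wavenumber a b k)\<^sup>2)"
    have "fc (\<Sum>q<n. s ^ q *\<^sub>R Lpow q f) k = (\<Sum>q<n. fc (s ^ q *\<^sub>R Lpow q f) k)"
      by (rule linear_sum[OF bounded_linear.linear[OF bounded_linear_fc]])
    also have "\<dots> = (\<Sum>q<n. (\<i> * of_real ?y) ^ q / fact q * fc f k)"
    proof (rule sum.cong)
      fix q assume "q \<in> {..<n}"
      hence "fc (s ^ q *\<^sub>R Lpow q f) k = of_real (s ^ q) * ((\<i> * of_real (- ((wavenumber a b k)\<^sup>2))) ^ q / fact q * fc f k)"
        by (simp only: fc_scaleR scaleR_conv_of_real[where 'a=complex] fc_Lpow fq lessThan_iff)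
      also have "of_real (s ^ q) * (\<i> * of_real (- ((wavenumber a b k)\<^sup>2))) ^ q = (\<i> * of_real ?y) ^ q"
        by (simp only: of_real_power power_mult_distrib[symmetric]) (simp add: mult_ac)
      hence "of_real (s ^ q) * ((\<i> * of_real (- ((wavenumber a b k)\<^sup>2))) ^ q / fact q * fc f k) =
          (\<i> * of_real ?y) ^ q / fact q * fc f k" by (metis mult.assoc times_divide_eq_right)
      finally show "fc (s ^ q *\<^sub>R Lpow q f) k = (\<i> * of_real ?y) ^ q / fact q * fc f k" .
    qed simp
    finally have "fc (eL s f - (\<Sum>q<n. s ^ q *\<^sub>R Lpow q f)) k = (cis ?y - (\<Sum>q<n. (\<i> * of_real ?y) ^ q / fact q)) * fc f k"
      by (simp add: sum_distrib_right left_diff_distrib)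
    hence "cmod (fc (eL s f - (\<Sum>q<n. s ^ q *\<^sub>R Lpow q f)) k) \<le> \<bar>?y\<bar> ^ n * cmod (fc f k)"
      by (simp only: norm_mult) (intro mult_right_mono norm_cis_Taylor, auto)
    also have "\<bar>?y\<bar> ^ n = \<bar>s\<bar> ^ n * \<bar>wavenumber a b k\<bar> ^ (2 * n)"
      by (simp add: abs_mult power_mult_distrib power_mult)
    also have "\<dots> \<le> \<bar>s\<bar> ^ n * (om * wt k) ^ (2 * n)"
      by (intro mult_left_mono power_mono wn_le) auto
    finally have "cmod (fc (eL s f - (\<Sum>q<n. s ^ q *\<^sub>R Lpow q f)) k) \<le> \<bar>s\<bar> ^ n * (om * wt k) ^ (2 * n) * cmod (fc f k)"
      by (simp add: mult_right_mono)
    hence "wt k ^ m * cmod (fc (eL s f - (\<Sum>q<n. s ^ q *\<^sub>R Lpow q f)) k) \<le>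
        wt k ^ m * (\<bar>s\<bar> ^ n * (om * wt k) ^ (2 * n) * cmod (fc f k))"
      by (intro mult_left_mono) auto
    thus ?thesis by (simp add: power_add power_mult_distrib mult_ac)
  qed
  from nrm_le_compare(2)[OF f this] om_pos show ?thesis by simp
qed

text \<open>Coefficients of exp(gamma t L) f(t) in powers of t: the Cauchy product of the series of
  f with that of the group.\<close>

definition eLs :: "real \<Rightarrow> wiener fps \<Rightarrow> wiener fps" where
  "eLs \<gamma> c = Abs_fps (\<lambda>q. \<Sum>i\<le>q. \<gamma> ^ (q - i) *\<^sub>R Lpow (q - i) (fps_nth c i))"

lemma expd_eL:
  assumes "expd n (m + 2 * n) f c"
  shows "expd n m (\<lambda>t. eL (\<gamma> * t) (f t)) (eLs \<gamma> c)"
proof -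
  from assms obtain C \<delta> where "expd_on n (m + 2 * n) f c C \<delta>" by (rule expdE)
  note * = expd_onD[OF this]
  define B where "B i j = \<gamma> ^ j *\<^sub>R Lpow j (fps_nth c i)" for i j
  have B: "B i j \<in> W m" if "i < n" "j < n" for i j
    unfolding B_def by (intro W_scaleR W_Lpow W_mono[OF *(4)]) (use that in auto)
  have nth: "fps_nth (eLs \<gamma> c) q = (\<Sum>i\<le>q. B i (q - i))" for q by (simp add: eLs_def B_def)
  let ?A = "\<Sum>i<n. \<bar>\<gamma>\<bar> ^ n * om ^ (2 * n) * nrm (m + 2 * n) (fps_nth c i)"
  let ?E = "\<Sum>i<n. \<Sum>j<n. nrm m (B i j)"
  show ?thesis
  proof (rule expdI[OF _ *(2)])
    show "fps_nth (eLs \<gamma> c) q \<in> W m" if "q < n" for q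
      unfolding nth using B that by (intro W_sum) auto
    fix t assume t: "0 \<le> t" "t \<le> \<delta>"
    have t1: "t \<le> 1" using t * by simp
    show "eL (\<gamma> * t) (f t) \<in> W m" using *(5)[OF t] by (auto intro: W_mono)
    let ?P = "\<Sum>q<n. t ^ q *\<^sub>R fps_nth c q" and ?T = "\<Sum>q<n. t ^ q *\<^sub>R fps_nth (eLs \<gamma> c) q"
    have R: "f t - ?P \<in> W (m + 2 * n)" using * t by auto
    define r where "r i = eL (\<gamma> * t) (fps_nth c i) - (\<Sum>j<n. (\<gamma> * t) ^ j *\<^sub>R Lpow j (fps_nth c i))" for i
    have rW: "r i \<in> W m" if "i < n" for i
      unfolding r_def using that by (auto intro!: W_minus W_sum W_scaleR W_Lpow W_mono[OF *(4)])
    have r: "nrm m (r i) \<le> \<bar>\<gamma>\<bar> ^ n * om ^ (2 * n) * nrm (m + 2 * n) (fps_nth c i) * t ^ n" if "i < n" for i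
      unfolding r_def using nrm_eL_Taylor[OF *(4)[OF that], of "\<gamma> * t"] t
      by (simp add: abs_mult power_mult_distrib mult_ac)
    have e1: "nrm m (eL (\<gamma> * t) (f t - ?P)) \<le> C * t ^ n"
      using order_trans[OF nrm_mono[OF R, of m] *(6)[OF t]] by simp
    have "nrm m (\<Sum>i<n. t ^ i *\<^sub>R r i) \<le> (\<Sum>i<n. nrm m (r i))"
      using rW t t1 by (intro nrm_poly_le) auto
    also have "\<dots> \<le> (\<Sum>i<n. \<bar>\<gamma>\<bar> ^ n * om ^ (2 * n) * nrm (m + 2 * n) (fps_nth c i) * t ^ n)"
      using r by (intro sum_mono) auto
    finally have e2: "nrm m (\<Sum>i<n. t ^ i *\<^sub>R r i) \<le> ?A * t ^ n" by (simp add: sum_distrib_right)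
    have e3: "nrm m ((\<Sum>i<n. \<Sum>j<n. t ^ (i + j) *\<^sub>R B i j) - ?T) \<le> ?E * t ^ n"
      unfolding nth using B t t1 by (intro nrm_double_sum_trunc) auto
    have "(\<Sum>i<n. \<Sum>j<n. t ^ (i + j) *\<^sub>R B i j) =
        (\<Sum>i<n. t ^ i *\<^sub>R (\<Sum>j<n. (\<gamma> * t) ^ j *\<^sub>R Lpow j (fps_nth c i)))"
      unfolding B_def scaleR_sum_right
      by (intro sum.cong refl) (simp add: power_add power_mult_distrib mult_ac)
    hence "(\<Sum>i<n. t ^ i *\<^sub>R r i) + (\<Sum>i<n. \<Sum>j<n. t ^ (i + j) *\<^sub>R B i j) = eL (\<gamma> * t) ?P"
      by (simp add: r_def scaleR_diff_right sum_subtractf eL_sum eL_scaleR)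
    moreover have "x - z = (x - p) + (u + (v - z))" if "u + v = p" for x z p u v :: wiener
      using that by auto
    ultimately have eq: "eL (\<gamma> * t) (f t) - ?T = eL (\<gamma> * t) (f t - ?P) + ((\<Sum>i<n. t ^ i *\<^sub>R r i) +
        ((\<Sum>i<n. \<Sum>j<n. t ^ (i + j) *\<^sub>R B i j) - ?T))"
      unfolding eL_minus by blast
    have le: "nrm m (eL (\<gamma> * t) (f t) - ?T) \<le> nrm m (eL (\<gamma> * t) (f t - ?P)) + (nrm m (\<Sum>i<n. t ^ i *\<^sub>R r i) +
        nrm m ((\<Sum>i<n. \<Sum>j<n. t ^ (i + j) *\<^sub>R B i j) - ?T))"
      unfolding eq using W_mono[OF R, of m] rW B
      by (intro order_trans[OF nrm_add_le] add_left_mono nrm_add_le)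
         (auto intro!: W_add W_sum W_scaleR W_minus simp: nth)
    show "nrm m (eL (\<gamma> * t) (f t) - ?T) \<le> (C + ?A + ?E) * t ^ n"
    proof -
      have "x + (y + z) \<le> (C + A + E) * t ^ n"
        if "x \<le> C * t ^ n" "y \<le> A * t ^ n" "z \<le> E * t ^ n" for x y z A E :: real
        using add_mono[OF that(1) add_mono[OF that(2,3)]] by (simp add: algebra_simps)
      from order_trans[OF le this[OF e1 e2 e3]] show ?thesis .
    qed
  qed
qed

lemma expd_D:
  assumes "expd n (Suc m) f c"
  shows "expd n m (\<lambda>t. D (f t)) (fps_map D c)"
proof (rule expd_map[OF assms, where B=om])
  have 1: "f \<in> W 1" if "f \<in> W (Suc m)" for f using that by (rule W_mono) simp
  show "D (f + g) = D f + D g" if "f \<in> W (Suc m)" "g \<in> W (Suc m)" for f g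
    using that by (intro D_add 1)
  show "D (r *\<^sub>R f) = r *\<^sub>R D f" if "f \<in> W (Suc m)" for r f
    using that by (intro D_scaleR 1)
qed (use om_pos in \<open>auto intro: W_D nrm_D_le\<close>)

definition Nw :: "wiener \<Rightarrow> wiener" where "Nw f = - D (f * cnjw f * f)"

definition Nws :: "wiener fps \<Rightarrow> wiener fps" where
  "Nws c = fps_map uminus (fps_map D (c * fps_map cnjw c * c))"

lemma expd_Nw: "expd n (Suc m) f c \<Longrightarrow> expd n m (\<lambda>t. Nw (f t)) (Nws c)"
  unfolding Nw_def Nws_def by (intro expd_uminus expd_D expd_mult expd_cnjw)

text \<open>Series of F(gamma t, v(t)) in the interaction picture. The parameter is 1 along the
  exact solution and the node c_i at stage i.\<close>

definition Fs :: "real \<Rightarrow> wiener fps \<Rightarrow> wiener fps" where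
  "Fs \<gamma> c = eLs (- \<gamma>) (Nws (eLs \<gamma> c))"

lemma expd_F:
  assumes "expd n (m + 4 * n + 1) f c"
  shows "expd n m (\<lambda>t. eL (- \<gamma> * t) (Nw (eL (\<gamma> * t) (f t)))) (Fs \<gamma> c)"
  unfolding Fs_def
  by (intro expd_eL expd_Nw) (use assms in \<open>simp add: algebra_simps\<close>)

end

section \<open>Order conditions\<close>

text \<open>
  A rooted tree is encoded by a natural number: the root of \<open>n\<close> carries the subtrees \<open>list_decode n\<close>.
  The system \<open>y\<^sub>n' = (\<Prod>l\<leftarrow>list_decode n. y\<^sub>l)\<close> with zero initial value has monomial solutions and
  monomial Runge-Kutta stages, whose coefficients are \<open>tree_exact n\<close> and \<open>tree_stage A s n i\<close>.
\<close>

lemma list_decode_less: "l \<in> set (list_decode n) \<Longrightarrow> l < n"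
proof (induction n arbitrary: l rule: less_induct)
  case (less n)
  show ?case
  proof (cases n)
    case (Suc m)
    obtain x y where xy: "prod_decode m = (x, y)" by (cases "prod_decode m")
    have m: "prod_encode (x, y) = m" by (metis xy prod_decode_inverse)
    have "x \<le> m" "y \<le> m" using le_prod_encode_1[of x y] le_prod_encode_2[of y x] m by auto
    moreover have "l = x \<or> l \<in> set (list_decode y)" using less.prems by (auto simp: Suc xy)
    ultimately show ?thesis using less.IH[of y l] Suc by auto
  qed (use less in auto)
qed

function tree_order :: "nat \<Rightarrow> nat" where
  "tree_order n = Suc (\<Sum>l\<leftarrow>list_decode n. tree_order l)"
  by auto
termination by (relation "Wellfounded.measure id") (auto dest: list_decode_less)

function tree_exact :: "nat \<Rightarrow> real" where
  "tree_exact n = (\<Prod>l\<leftarrow>list_decode n. tree_exact l) / tree_order n"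
  by auto
termination by (relation "Wellfounded.measure id") (auto dest: list_decode_less)

function tree_stage :: "(nat \<Rightarrow> nat \<Rightarrow> real) \<Rightarrow> nat \<Rightarrow> nat \<Rightarrow> nat \<Rightarrow> real" where
  "tree_stage A s n i = (\<Sum>j<s. A i j * (\<Prod>l\<leftarrow>list_decode n. tree_stage A s l j))"
  by auto
termination by (relation "Wellfounded.measure (\<lambda>(A, s, n, i). n)") (auto dest: list_decode_less)

declare tree_order.simps [simp del] tree_exact.simps [simp del] tree_stage.simps [simp del]

text \<open>The systems attached to trees are polynomial, and this class is closed under partial
  derivatives; together with continuity this gives the smoothness that \<open>rk_order\<close> asks
  for.\<close>

inductive poly_fun :: "nat \<Rightarrow> ((nat \<Rightarrow> real) \<Rightarrow> real) \<Rightarrow> bool" for d where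
  const: "poly_fun d (\<lambda>_. c)"
| coord: "i < d \<Longrightarrow> poly_fun d (\<lambda>y. y i)"
| add: "poly_fun d f \<Longrightarrow> poly_fun d g \<Longrightarrow> poly_fun d (\<lambda>y. f y + g y)"
| mult: "poly_fun d f \<Longrightarrow> poly_fun d g \<Longrightarrow> poly_fun d (\<lambda>y. f y * g y)"

lemma poly_fun_continuous: "poly_fun d f \<Longrightarrow> continuous_on UNIV f"
  by (induction rule: poly_fun.induct) (auto intro!: continuous_intros)

lemma poly_fun_cong: "poly_fun d f \<Longrightarrow> (\<And>i. i < d \<Longrightarrow> y i = z i) \<Longrightarrow> f y = f z"
  by (induction rule: poly_fun.induct) auto

lemma poly_fun_partial:
  assumes "poly_fun d f"
  obtains f' where "poly_fun d f'" "\<And>y. ((\<lambda>u. f (y(i := u))) has_real_derivative f' y) (at (y i))"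
proof -
  have "\<exists>f'. poly_fun d f' \<and> (\<forall>y. ((\<lambda>u. f (y(i := u))) has_real_derivative f' y) (at (y i)))"
    using assms
  proof (induction rule: poly_fun.induct)
    case (const c)
    show ?case by (rule exI[of _ "\<lambda>_. 0"]) (auto intro: poly_fun.const)
  next
    case (coord j)
    show ?case
      by (rule exI[of _ "\<lambda>_. if j = i then 1 else 0"]) (auto intro: poly_fun.const intro!: derivative_eq_intros)
  next
    case (add f g)
    then obtain f' g' where "poly_fun d f'" "poly_fun d g'"
      "\<And>y. ((\<lambda>u. f (y(i := u))) has_real_derivative f' y) (at (y i))"
      "\<And>y. ((\<lambda>u. g (y(i := u))) has_real_derivative g' y) (at (y i))" by blast
    thus ?case
      by (intro exI[of _ "\<lambda>y. f' y + g' y"] conjI poly_fun.add allI DERIV_add)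
  next
    case (mult f g)
    then obtain f' g' where *: "poly_fun d f'" "poly_fun d g'"
      "\<And>y. ((\<lambda>u. f (y(i := u))) has_real_derivative f' y) (at (y i))"
      "\<And>y. ((\<lambda>u. g (y(i := u))) has_real_derivative g' y) (at (y i))" by blast
    have "((\<lambda>u. f (y(i := u)) * g (y(i := u))) has_real_derivative f' y * g y + g' y * f y) (at (y i))" for y
      using DERIV_mult[OF *(3)[of y] *(4)[of y]] by simp
    with *(1,2) mult.hyps show ?case
      by (intro exI[of _ "\<lambda>y. f' y * g y + g' y * f y"] conjI allI poly_fun.add poly_fun.mult)
  qed
  thus ?thesis using that by blast
qed

lemma poly_fun_iter_partial:
  assumes "poly_fun d f"
  shows "poly_fun d (iter_partial js f)"
proof (induction js)
  case Nil
  thus ?case using assms by (simp add: iter_partial_def)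
next
  case (Cons i js)
  obtain f' where f': "poly_fun d f'"
    "\<And>y. ((\<lambda>u. iter_partial js f (y(i := u))) has_real_derivative f' y) (at (y i))"
    using poly_fun_partial[OF Cons] by metis
  have "iter_partial (i # js) f = f'"
    using DERIV_imp_deriv[OF f'(2)] by (auto simp: iter_partial_def partial_deriv_def)
  thus ?case using f'(1) by simp
qed

lemma smooth_on_Rd_poly_fun:
  assumes "poly_fun d f"
  shows "smooth_on_Rd d f"
  unfolding smooth_on_Rd_def
proof (intro conjI allI impI)
  fix js
  show "continuous_on UNIV (iter_partial js f)"
    by (rule poly_fun_continuous[OF poly_fun_iter_partial[OF assms]])
  fix i y
  obtain f' where "((\<lambda>u. iter_partial js f (y(i := u))) has_real_derivative f' y) (at (y i))"
    using poly_fun_partial[OF poly_fun_iter_partial[OF assms]] by metis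
  thus "(\<lambda>u. iter_partial js f (y(i := u))) differentiable at (y i)"
    by (auto simp: real_differentiable_def)
next
  fix y z :: "nat \<Rightarrow> real"
  assume "\<forall>i<d. y i = z i"
  thus "f y = f z" using poly_fun_cong[OF assms] by blast
qed

lemma poly_fun_prod_list: "set ls \<subseteq> {..<d} \<Longrightarrow> poly_fun d (\<lambda>y. \<Prod>l\<leftarrow>ls. y l)"
  by (induction ls) (auto intro: poly_fun.intros)

lemma prod_list_monomial:
  "(\<Prod>l\<leftarrow>ls. c l * t ^ e l) = (\<Prod>l\<leftarrow>ls. c l) * (t::real) ^ (\<Sum>l\<leftarrow>ls. e l)"
  by (induction ls) (auto simp: power_add)

text \<open>For the system above, the local error in the component of the tree with branches
  \<open>ls\<close> is exactly a monomial K tau^(q + 1), with K the defect of the order condition.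
  Since q < p, it can be O(tau^(p + 1)) only if K = 0.\<close>

lemma rk_order_conditions:
  assumes rk: "rk_order s A w p" and q: "(\<Sum>l\<leftarrow>ls. tree_order l) < p"
  shows "(\<Sum>i<s. w i * (\<Prod>l\<leftarrow>ls. tree_stage A s l i)) =
     (\<Prod>l\<leftarrow>ls. tree_exact l) / Suc (\<Sum>l\<leftarrow>ls. tree_order l)"
proof -
  define n where "n = list_encode ls"
  \<comment> \<open>By \<open>list_decode_less\<close> every branch has a smaller code than its
    tree, so the system closes on the coordinates up to \<open>n\<close>.\<close>
  define d where "d = Suc n"
  define f :: "(nat \<Rightarrow> real) \<Rightarrow> nat \<Rightarrow> real" where "f y m = (\<Prod>l\<leftarrow>list_decode m. y l)" for y m
  define y where "y t m = tree_exact m * t ^ tree_order m" for t m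
  define Y where "Y \<tau> i m = tree_stage A s m i * \<tau> ^ tree_order m" for \<tau> :: real and i m
  have ls: "list_decode n = ls" by (simp add: n_def)
  have fy: "f (y t) m = (\<Prod>l\<leftarrow>list_decode m. tree_exact l) * t ^ (tree_order m - 1)" for t m
    unfolding f_def y_def prod_list_monomial by (subst tree_order.simps) simp
  have fY: "f (Y \<tau> i) m = (\<Prod>l\<leftarrow>list_decode m. tree_stage A s l i) * \<tau> ^ (tree_order m - 1)" for \<tau> i m
    unfolding f_def Y_def prod_list_monomial by (subst tree_order.simps) simp
  have ord: "tree_order m = Suc (tree_order m - 1)" for m by (simp add: tree_order.simps[of m])
  have "\<forall>m<d. smooth_on_Rd d (\<lambda>z. f z m)"
    unfolding f_def d_def
    by (intro allI impI smooth_on_Rd_poly_fun poly_fun_prod_list) (auto dest!: list_decode_less)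
  moreover have "ode_solution d f 1 y"
    unfolding ode_solution_def
  proof (intro ballI allI impI)
    fix t :: real and m
    have "((\<lambda>u. tree_exact m * u ^ tree_order m) has_real_derivative
        tree_exact m * (tree_order m * t ^ (tree_order m - 1))) (at t within {0..1})"
      by (auto intro!: derivative_eq_intros)
    also have "tree_exact m * (tree_order m * t ^ (tree_order m - 1)) = f (y t) m"
      unfolding fy by (subst tree_exact.simps) (use ord[of m] in auto)
    finally show "((\<lambda>u. y u m) has_real_derivative f (y t) m) (at t within {0..1})"
      unfolding y_def .
  qed
  moreover have "\<forall>\<^sub>F \<tau> in at_right 0. rk_stages s A d f (y 0) \<tau> (Y \<tau>)"
  proof (rule always_eventually, rule allI)
    fix \<tau> :: real
    have "Y \<tau> i m = y 0 m + \<tau> * (\<Sum>j<s. A i j * f (Y \<tau> j) m)" for i m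
    proof -
      have "y 0 m = 0" using ord[of m] unfolding y_def by (metis mult_zero_right power_0_Suc)
      moreover have "Y \<tau> i m = (\<Sum>j<s. A i j * (\<Prod>l\<leftarrow>list_decode m. tree_stage A s l j)) * \<tau> ^ Suc (tree_order m - 1)"
        using ord[of m] by (simp add: Y_def tree_stage.simps[of A s m i])
      moreover have "\<dots> = \<tau> * (\<Sum>j<s. A i j * f (Y \<tau> j) m)"
        by (simp add: fY sum_distrib_left sum_distrib_right mult_ac)
      ultimately show ?thesis by simp
    qed
    thus "rk_stages s A d f (y 0) \<tau> (Y \<tau>)" unfolding rk_stages_def by blast
  qed
  moreover have "\<forall>i<s. \<forall>m<d. ((\<lambda>\<tau>. Y \<tau> i m) \<longlongrightarrow> y 0 m) (at_right 0)"
  proof (intro allI impI)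
    fix i m
    have "((\<lambda>\<tau>. tree_stage A s m i * \<tau> ^ tree_order m) \<longlongrightarrow> tree_stage A s m i * 0 ^ tree_order m) (at_right 0)"
      by (intro tendsto_intros)
    thus "((\<lambda>\<tau>. Y \<tau> i m) \<longlongrightarrow> y 0 m) (at_right 0)"
      using ord[of m] unfolding Y_def y_def by (metis mult_zero_right power_0_Suc)
  qed
  ultimately have "\<forall>m<d. (\<lambda>\<tau>. y 0 m + \<tau> * (\<Sum>i<s. w i * f (Y \<tau> i) m) - y \<tau> m) \<in> O[at_right 0](\<lambda>\<tau>. \<tau> ^ (p + 1))"
    using rk[unfolded rk_order_def, rule_format, of d f 1 y Y] by simp
  hence O: "(\<lambda>\<tau>. y 0 n + \<tau> * (\<Sum>i<s. w i * f (Y \<tau> i) n) - y \<tau> n) \<in> O[at_right 0](\<lambda>\<tau>. \<tau> ^ (p + 1))"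
    by (simp add: d_def)
  let ?q = "\<Sum>l\<leftarrow>ls. tree_order l"
  define K where "K = (\<Sum>i<s. w i * (\<Prod>l\<leftarrow>ls. tree_stage A s l i)) - (\<Prod>l\<leftarrow>ls. tree_exact l) / Suc ?q"
  have on: "tree_order n = Suc ?q" by (subst tree_order.simps) (simp add: ls)
  have eq: "y 0 n + \<tau> * (\<Sum>i<s. w i * f (Y \<tau> i) n) - y \<tau> n = K * \<tau> ^ Suc ?q" for \<tau>
  proof -
    have "(\<Sum>i<s. w i * f (Y \<tau> i) n) = (\<Sum>i<s. w i * (\<Prod>l\<leftarrow>ls. tree_stage A s l i)) * \<tau> ^ ?q"
      unfolding fY on ls by (simp add: sum_distrib_right mult.assoc)
    moreover have "y 0 n = 0" "y \<tau> n = (\<Prod>l\<leftarrow>ls. tree_exact l) / Suc ?q * \<tau> ^ Suc ?q"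
      by (simp_all add: y_def tree_exact.simps[of n] on ls)
    ultimately show ?thesis by (simp add: K_def algebra_simps)
  qed
  have "(\<lambda>\<tau>. K * \<tau> ^ Suc ?q) \<in> O[at_right 0](\<lambda>\<tau>. \<tau> ^ (p + 1))"
    using O unfolding eq .
  then obtain C where C: "\<forall>\<^sub>F \<tau> in at_right 0. norm (K * \<tau> ^ Suc ?q) \<le> C * norm ((\<tau>::real) ^ (p + 1))"
    by (rule landau_o.bigE)
  \<comment> \<open>Division by tau^(q + 1) leaves a positive power of tau on the right-hand side,
    which tends to 0.\<close>
  have "p + 1 = Suc ?q + Suc (p - Suc ?q)" using q by simp
  hence pq: "\<tau> ^ (p + 1) = \<tau> ^ Suc ?q * \<tau> ^ Suc (p - Suc ?q)" for \<tau> :: real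
    by (simp only: power_add)
  have "\<forall>\<^sub>F \<tau> in at_right 0. \<bar>K\<bar> \<le> C * (\<tau>::real) ^ Suc (p - Suc ?q)"
    using C eventually_at_right_less[of 0]
  proof eventually_elim
    case (elim \<tau>)
    hence "\<bar>K\<bar> * \<tau> ^ Suc ?q \<le> (C * \<tau> ^ Suc (p - Suc ?q)) * \<tau> ^ Suc ?q"
      unfolding pq by (simp add: abs_mult mult_ac)
    thus ?case using elim(2) by (metis mult_le_cancel_right_pos zero_less_power)
  qed
  moreover have "((\<lambda>\<tau>::real. C * \<tau> ^ Suc (p - Suc ?q)) \<longlongrightarrow> C * 0 ^ Suc (p - Suc ?q)) (at_right 0)"
    by (intro tendsto_intros)
  ultimately have "\<bar>K\<bar> \<le> C * 0 ^ Suc (p - Suc ?q)"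
    by (intro tendsto_le[OF trivial_limit_at_right_real _ tendsto_const]) auto
  hence "K = 0" by simp
  thus ?thesis by (simp add: K_def)
qed

section \<open>Matching Taylor coefficients of the exact and the numerical solution\<close>

text \<open>
  \<open>tree_span A s q v Y\<close>: the exact quantity \<open>v\<close> and the family \<open>Y\<close> of its stage counterparts are the
  same real combination of forests of total order \<open>q\<close>, weighted by the exact and by the stage
  coefficients respectively.
\<close>

inductive tree_span ::
  "(nat \<Rightarrow> nat \<Rightarrow> real) \<Rightarrow> nat \<Rightarrow> nat \<Rightarrow> nat \<Rightarrow> wiener \<Rightarrow> (nat \<Rightarrow> wiener) \<Rightarrow> bool" for A s m q where
  forest: "(\<Sum>l\<leftarrow>ls. tree_order l) = q \<Longrightarrow> E \<in> W m \<Longrightarrow>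
     tree_span A s m q ((\<Prod>l\<leftarrow>ls. tree_exact l) *\<^sub>R E) (\<lambda>i. (\<Prod>l\<leftarrow>ls. tree_stage A s l i) *\<^sub>R E)"
| add: "tree_span A s m q v Y \<Longrightarrow> tree_span A s m q v' Y' \<Longrightarrow> tree_span A s m q (v + v') (\<lambda>i. Y i + Y' i)"

lemma tree_span_W:
  assumes "tree_span A s m q v Y"
  shows "v \<in> W m" "Y i \<in> W m"
  using assms by (induction rule: tree_span.induct) auto

lemma tree_span_map:
  assumes "tree_span A s m' q v Y"
    and T: "\<And>f g. f \<in> W m' \<Longrightarrow> g \<in> W m' \<Longrightarrow> T (f + g) = T f + T g"
      "\<And>r f. f \<in> W m' \<Longrightarrow> T (r *\<^sub>R f) = r *\<^sub>R T f" "\<And>f. f \<in> W m' \<Longrightarrow> T f \<in> W m"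
  shows "tree_span A s m q (T v) (\<lambda>i. T (Y i))"
  using assms(1)
proof (induction rule: tree_span.induct)
  case (forest ls E)
  thus ?case by (simp add: T tree_span.forest)
next
  case (add v Y v' Y')
  have "T (v + v') = T v + T v'" "\<And>i. T (Y i + Y' i) = T (Y i) + T (Y' i)"
    using tree_span_W[OF add.hyps(1)] tree_span_W[OF add.hyps(2)] by (simp_all add: T)
  thus ?case using tree_span.add[OF add.IH] by simp
qed

text \<open>Forests multiply by concatenation: total orders add, and both kinds of weights are
  multiplicative.\<close>

lemma tree_span_mult_forest:
  assumes "tree_span A s m r v Y" "(\<Sum>l\<leftarrow>ls. tree_order l) = q" "E \<in> W m"
  shows "tree_span A s m (q + r) ((\<Prod>l\<leftarrow>ls. tree_exact l) *\<^sub>R E * v)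
     (\<lambda>i. (\<Prod>l\<leftarrow>ls. tree_stage A s l i) *\<^sub>R E * Y i)"
  using assms(1)
proof (induction rule: tree_span.induct)
  case (forest ls' E')
  have "tree_span A s m (q + r) ((\<Prod>l\<leftarrow>ls @ ls'. tree_exact l) *\<^sub>R (E * E'))
     (\<lambda>i. (\<Prod>l\<leftarrow>ls @ ls'. tree_stage A s l i) *\<^sub>R (E * E'))"
    using forest assms by (intro tree_span.forest) auto
  thus ?case by (simp add: mult_ac)
next
  case (add v Y v' Y')
  from tree_span.add[OF add.IH] show ?case by (simp add: distrib_left)
qed

lemma tree_span_mult:
  assumes "tree_span A s m q v Y" "tree_span A s m r v' Y'"
  shows "tree_span A s m (q + r) (v * v') (\<lambda>i. Y i * Y' i)"
  using assms(1)
proof (induction rule: tree_span.induct)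
  case (forest ls E)
  thus ?case by (rule tree_span_mult_forest[OF assms(2)])
next
  case (add v Y v' Y')
  from tree_span.add[OF add.IH] show ?case by (simp add: distrib_right)
qed

lemma tree_order_0: "tree_order 0 = 1" and tree_exact_0: "tree_exact 0 = 1"
  and tree_stage_0: "tree_stage A s 0 i = rk_node s A i"
  by (simp_all add: tree_order.simps[of 0] tree_exact.simps[of 0] tree_stage.simps[of A s 0] rk_node_def)

lemma tree_span_zero: "tree_span A s m q 0 (\<lambda>_. 0)"
  \<comment> \<open>A forest of q single nodes has the required total order; its vector is taken to
    be 0.\<close>
  using tree_span.forest[of "replicate q 0" q 0 m A s] by (simp add: tree_order_0 sum_list_replicate)

lemma tree_span_sum:
  assumes "\<And>j. j \<in> J \<Longrightarrow> tree_span A s m q (v j) (Y j)"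
  shows "tree_span A s m q (\<Sum>j\<in>J. v j) (\<lambda>i. \<Sum>j\<in>J. Y j i)"
  using assms
proof (induction J rule: infinite_finite_induct)
  case (insert x F)
  have "tree_span A s m q (v x + sum v F) (\<lambda>i. Y x i + (\<Sum>j\<in>F. Y j i))"
    using insert by (intro tree_span.add) auto
  thus ?case using insert.hyps by simp
qed (auto intro: tree_span_zero)

text \<open>The k-th power of the node is the stage weight of k single nodes, and their exact weight
  is 1. In this way explicit time dependence is expressed by trees.\<close>

lemma tree_span_node:
  assumes "tree_span A s m q v Y"
  shows "tree_span A s m (q + k) v (\<lambda>i. rk_node s A i ^ k *\<^sub>R Y i)"
  using assms
proof (induction rule: tree_span.induct)
  case (forest ls E)
  have "tree_span A s m (q + k) ((\<Prod>l\<leftarrow>ls @ replicate k 0. tree_exact l) *\<^sub>R E)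
     (\<lambda>i. (\<Prod>l\<leftarrow>ls @ replicate k 0. tree_stage A s l i) *\<^sub>R E)"
    using forest by (intro tree_span.forest) (auto simp: sum_list_replicate tree_order_0)
  thus ?case by (simp add: prod_list_replicate tree_exact_0 tree_stage_0 mult_ac)
next
  case (add v Y v' Y')
  from tree_span.add[OF add.IH] show ?case by (simp add: scaleR_add_right)
qed

text \<open>Integration grafts a forest onto a new root: the exact weight is divided by the order q
  + 1 of the new tree, and the stage weights are summed against \<open>A\<close>.\<close>

lemma tree_span_integrate:
  assumes "tree_span A s m q v Y"
  shows "tree_span A s m (Suc q) ((1 / Suc q) *\<^sub>R v) (\<lambda>i. \<Sum>j<s. A i j *\<^sub>R Y j)"
  using assms
proof (induction rule: tree_span.induct)
  case (forest ls E)
  have "tree_span A s m (Suc q) ((\<Prod>l\<leftarrow>[list_encode ls]. tree_exact l) *\<^sub>R E)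
     (\<lambda>i. (\<Prod>l\<leftarrow>[list_encode ls]. tree_stage A s l i) *\<^sub>R E)"
    using forest by (intro tree_span.forest) (auto simp: tree_order.simps[of "list_encode ls"])
  thus ?case
    using forest by (simp add: tree_exact.simps[of "list_encode ls"] tree_stage.simps[of A s "list_encode ls"]
        tree_order.simps[of "list_encode ls"] scaleR_sum_left)
next
  case (add v Y v' Y')
  from tree_span.add[OF add.IH] show ?case by (simp add: scaleR_add_right sum.distrib)
qed

text \<open>The order conditions are applied forest by forest, for a common vector; additivity
  extends them to all combinations.\<close>

lemma tree_span_rk_order:
  assumes "rk_order s A w p" "q < p" "tree_span A s m q v Y"
  shows "(\<Sum>i<s. w i *\<^sub>R Y i) = (1 / Suc q) *\<^sub>R v"
  using assms(3)
proof (induction rule: tree_span.induct)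
  case (forest ls E)
  have "(\<Sum>i<s. w i * (\<Prod>l\<leftarrow>ls. tree_stage A s l i)) = (\<Prod>l\<leftarrow>ls. tree_exact l) / Suc q"
    using rk_order_conditions[OF assms(1), of ls] forest(1) assms(2) by simp
  thus ?case by (simp flip: scaleR_sum_left)
next
  case (add v Y v' Y')
  thus ?case by (simp add: scaleR_add_right sum.distrib)
qed

definition matched ::
  "(nat \<Rightarrow> nat \<Rightarrow> real) \<Rightarrow> nat \<Rightarrow> nat \<Rightarrow> nat \<Rightarrow> wiener fps \<Rightarrow> (nat \<Rightarrow> wiener fps) \<Rightarrow> bool" where
  "matched A s m n c C \<longleftrightarrow> (\<forall>q<n. tree_span A s m q (fps_nth c q) (\<lambda>i. fps_nth (C i) q))"

lemma matched_mult:
  assumes "matched A s m n c C" "matched A s m n d E"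
  shows "matched A s m n (c * d) (\<lambda>i. C i * E i)"
  unfolding matched_def fps_mult_nth
proof (intro allI impI tree_span_sum)
  fix q j assume q: "q < n" and j: "j \<in> {0..q}"
  have "tree_span A s m (j + (q - j)) (fps_nth c j * fps_nth d (q - j)) (\<lambda>i. fps_nth (C i) j * fps_nth (E i) (q - j))"
    using assms q j by (intro tree_span_mult) (auto simp: matched_def)
  thus "tree_span A s m q (fps_nth c j * fps_nth d (q - j)) (\<lambda>i. fps_nth (C i) j * fps_nth (E i) (q - j))"
    using j by simp
qed

lemma matched_map:
  assumes "matched A s m' n c C"
    and "\<And>f g. f \<in> W m' \<Longrightarrow> g \<in> W m' \<Longrightarrow> T (f + g) = T f + T g"
      "\<And>r f. f \<in> W m' \<Longrightarrow> T (r *\<^sub>R f) = r *\<^sub>R T f" "\<And>f. f \<in> W m' \<Longrightarrow> T f \<in> W m"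
  shows "matched A s m n (fps_map T c) (\<lambda>i. fps_map T (C i))"
  unfolding matched_def fps_map_nth
proof (intro allI impI)
  fix q assume "q < n"
  hence "tree_span A s m' q (fps_nth c q) (\<lambda>i. fps_nth (C i) q)" using assms(1) by (simp add: matched_def)
  thus "tree_span A s m q (T (fps_nth c q)) (\<lambda>i. T (fps_nth (C i) q))"
    by (rule tree_span_map) (fact assms)+
qed

context torus
begin

lemma Lpow_add: "f \<in> W (2 * q) \<Longrightarrow> g \<in> W (2 * q) \<Longrightarrow> Lpow q (f + g) = Lpow q f + Lpow q g"
  by (rule wiener_eqI) (simp add: fc_Lpow W_add distrib_left)

lemma Lpow_scaleR: "f \<in> W (2 * q) \<Longrightarrow> Lpow q (r *\<^sub>R f) = r *\<^sub>R Lpow q f"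
  by (rule wiener_eqI) (simp add: fc_Lpow W_scaleR)

text \<open>The exact series uses the time sigma t, stage i uses sigma c_i t. A power L^k therefore
  carries c_i^k at the stage, that is, k further single nodes, while its k powers of t raise the
  degree by k as well.\<close>

lemma matched_eLs:
  assumes "matched A s (m + 2 * n) n c C"
  shows "matched A s m n (eLs \<sigma> c) (\<lambda>i. eLs (\<sigma> * rk_node s A i) (C i))"
  unfolding matched_def eLs_def fps_nth_Abs_fps
proof (intro allI impI tree_span_sum)
  fix q j assume q: "q < n" and j: "j \<in> {..q}"
  have c: "tree_span A s (m + 2 * n) j (fps_nth c j) (\<lambda>i. fps_nth (C i) j)"
    using assms q j by (auto simp: matched_def)
  have w: "f \<in> W (2 * (q - j))" "f \<in> W (m + 2 * (q - j))" if "f \<in> W (m + 2 * n)" for f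
    using W_mono[OF that] q by auto
  have "tree_span A s m j (\<sigma> ^ (q - j) *\<^sub>R Lpow (q - j) (fps_nth c j))
      (\<lambda>i. \<sigma> ^ (q - j) *\<^sub>R Lpow (q - j) (fps_nth (C i) j))"
    by (rule tree_span_map[OF c])
       (auto simp: Lpow_add Lpow_scaleR w scaleR_add_right W_Lpow intro!: W_scaleR)
  from tree_span_node[OF this, of "q - j"]
  show "tree_span A s m q (\<sigma> ^ (q - j) *\<^sub>R Lpow (q - j) (fps_nth c j))
      (\<lambda>i. (\<sigma> * rk_node s A i) ^ (q - j) *\<^sub>R Lpow (q - j) (fps_nth (C i) j))"
    using j by (simp add: power_mult_distrib mult.commute)
qed

lemma matched_Nws:
  assumes "matched A s (Suc m) n c C"
  shows "matched A s m n (Nws c) (\<lambda>i. Nws (C i))"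
proof -
  have 1: "f \<in> W (Suc 0)" if "f \<in> W (Suc m)" for f using that by (rule W_mono) simp
  have "matched A s (Suc m) n (fps_map cnjw c) (\<lambda>i. fps_map cnjw (C i))"
    by (rule matched_map[OF assms]) (auto simp: cnjw_add cnjw_scaleR)
  hence "matched A s (Suc m) n (c * fps_map cnjw c * c) (\<lambda>i. C i * fps_map cnjw (C i) * C i)"
    by (intro matched_mult assms)
  hence "matched A s m n (fps_map D (c * fps_map cnjw c * c)) (\<lambda>i. fps_map D (C i * fps_map cnjw (C i) * C i))"
    by (rule matched_map) (auto simp: D_add D_scaleR W_D 1)
  thus ?thesis unfolding Nws_def by (rule matched_map) auto
qed

lemma matched_Fs:
  assumes "matched A s (m + 4 * n + 1) n c C"
  shows "matched A s m n (Fs 1 c) (\<lambda>i. Fs (rk_node s A i) (C i))"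
proof -
  have "matched A s (Suc (m + 2 * n)) n (eLs 1 c) (\<lambda>i. eLs (1 * rk_node s A i) (C i))"
    by (rule matched_eLs) (use assms in \<open>simp add: algebra_simps\<close>)
  from matched_eLs[OF matched_Nws[OF this], of "-1"] show ?thesis by (simp add: Fs_def)
qed

text \<open>Formal Picard iterates of v = u + integral of F. They start from the constant series, as
  the sweeps of the method do, so the two iterations can be compared sweep by sweep.\<close>

primrec exact_fps :: "wiener \<Rightarrow> nat \<Rightarrow> wiener fps" where
  "exact_fps u 0 = fps_const u"
| "exact_fps u (Suc l) =
     Abs_fps (\<lambda>q. case q of 0 \<Rightarrow> u | Suc q' \<Rightarrow> (1 / Suc q') *\<^sub>R fps_nth (Fs 1 (exact_fps u l)) q')"

primrec stage_fps :: "(nat \<Rightarrow> nat \<Rightarrow> real) \<Rightarrow> nat \<Rightarrow> wiener \<Rightarrow> nat \<Rightarrow> nat \<Rightarrow> wiener fps" where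
  "stage_fps A s u 0 i = fps_const u"
| "stage_fps A s u (Suc l) i = fps_const u +
     fps_X * (\<Sum>j<s. fps_map (\<lambda>x. A i j *\<^sub>R x) (Fs (rk_node s A j) (stage_fps A s u l j)))"

lemma exact_fps_0: "fps_nth (exact_fps u l) 0 = u"
  by (cases l) auto

text \<open>One more sweep is one more integration: division by q + 1 on the exact side, summation
  with \<open>A\<close> at the stages. The loss of weights in \<open>matched_Fs\<close> grows with
  the number of coefficients; the fixed rate 4 N + 1 dominates it in every sweep.\<close>

lemma matched_exact_stage:
  assumes "l < N" "u \<in> W (m + l * (4 * N + 1))"
  shows "matched A s m (Suc l) (exact_fps u l) (stage_fps A s u l)"
  using assms
proof (induction l arbitrary: m)
  case 0
  thus ?case using tree_span.forest[of "[]" 0 u m A s] by (simp add: matched_def)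
next
  case (Suc l)
  have "matched A s (m + 4 * Suc l + 1) (Suc l) (exact_fps u l) (stage_fps A s u l)"
    by (rule Suc.IH) (use Suc.prems in \<open>auto intro: W_mono\<close>)
  hence F: "matched A s m (Suc l) (Fs 1 (exact_fps u l)) (\<lambda>i. Fs (rk_node s A i) (stage_fps A s u l i))"
    by (rule matched_Fs)
  show ?case
    unfolding matched_def
  proof (intro allI impI)
    fix q assume q: "q < Suc (Suc l)"
    show "tree_span A s m q (fps_nth (exact_fps u (Suc l)) q) (\<lambda>i. fps_nth (stage_fps A s u (Suc l) i) q)"
    proof (cases q)
      case 0
      have "u \<in> W m" using Suc.prems by (auto intro: W_mono)
      thus ?thesis using tree_span.forest[of "[]" 0 u m A s] by (simp add: 0)
    next
      case (Suc q')
      have "tree_span A s m q' (fps_nth (Fs 1 (exact_fps u l)) q')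
          (\<lambda>i. fps_nth (Fs (rk_node s A i) (stage_fps A s u l i)) q')"
        using F q Suc by (auto simp: matched_def)
      from tree_span_integrate[OF this] show ?thesis by (simp add: Suc fps_sum_nth)
    qed
  qed
qed

text \<open>For q <= M the slopes are matched after M sweeps, and for q < p the final quadrature
  acts on matched slopes as the factor 1 / (q + 1) of exact integration.\<close>

lemma numerical_coeff_eq_exact_coeff:
  assumes rk: "rk_order s A w p" and q: "q < p" "q \<le> M" and u: "u \<in> W (Suc M * (4 * Suc M + 1))"
  shows "(\<Sum>i<s. w i *\<^sub>R fps_nth (Fs (rk_node s A i) (stage_fps A s u M i)) q) =
     fps_nth (exact_fps u (Suc M)) (Suc q)"
proof -
  have "matched A s (0 + 4 * Suc M + 1) (Suc M) (exact_fps u M) (stage_fps A s u M)"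
    by (rule matched_exact_stage[of M "Suc M"]) (use u in \<open>auto intro: W_mono\<close>)
  from matched_Fs[OF this] have "tree_span A s 0 q (fps_nth (Fs 1 (exact_fps u M)) q)
      (\<lambda>i. fps_nth (Fs (rk_node s A i) (stage_fps A s u M i)) q)"
    using q by (auto simp: matched_def)
  from tree_span_rk_order[OF rk q(1) this] show ?thesis by simp
qed

end

section \<open>The exact solution in the Wiener algebra\<close>

lemma summable_on_inverse_wt_square: "(\<lambda>k. (1 / wt k)\<^sup>2) summable_on UNIV"
proof -
  have "summable (\<lambda>n. inverse ((real (Suc n))\<^sup>2))"
    using inverse_power_summable[of 2, where 'a=real] by (subst summable_Suc_iff) auto
  hence s: "summable (\<lambda>n. (1 / (1 + real n))\<^sup>2)" by (simp add: power_divide field_simps)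
  have n: "(\<lambda>n. (1 / (1 + real n))\<^sup>2) summable_on UNIV"
    by (rule norm_summable_imp_summable_on) (use s in simp)
  have "(\<lambda>k. (1 / wt k)\<^sup>2) summable_on (range int)"
    by (subst summable_on_reindex) (use n in \<open>auto simp: o_def wt_def\<close>)
  moreover have "(\<lambda>k. (1 / wt k)\<^sup>2) summable_on (range (\<lambda>n. - int n))"
    by (subst summable_on_reindex) (use n in \<open>auto simp: o_def wt_def inj_def\<close>)
  moreover have "range int \<union> range (\<lambda>n. - int n) = UNIV"
  proof -
    have "k \<in> range int \<union> range (\<lambda>n. - int n)" for k
      by (cases k rule: int_cases2) auto
    thus ?thesis by blast
  qed
  ultimately show ?thesis using summable_on_union by metis
qed

context torus
begin

text \<open>The constant comes from (1 + |k|)^2 <= 2 (1 + k^2) and k = w_k / om.\<close>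

lemma wt_power_le:
  assumes "r \<ge> real m + 1"
  shows "wt k ^ (2 * (m + 1)) \<le> (2 * (1 + 1 / om\<^sup>2)) ^ (m + 1) * (1 + (wavenumber a b k)\<^sup>2) powr r"
proof -
  let ?w = "(wavenumber a b k)\<^sup>2"
  have "(wt k)\<^sup>2 \<le> 2 * (1 + (of_int k)\<^sup>2)"
    using sum_squares_bound[of 1 "\<bar>real_of_int k\<bar>"] by (simp add: wt_def power2_eq_square algebra_simps)
  also have "\<dots> = 2 * (1 + ?w / om\<^sup>2)" using om_pos by (simp add: wn_eq power_mult_distrib)
  also have "\<dots> \<le> 2 * (1 + 1 / om\<^sup>2) * (1 + ?w)" using om_pos by (simp add: field_simps)
  finally have "((wt k)\<^sup>2) ^ (m + 1) \<le> (2 * (1 + 1 / om\<^sup>2) * (1 + ?w)) ^ (m + 1)"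
    by (rule power_mono) simp
  also have "\<dots> = (2 * (1 + 1 / om\<^sup>2)) ^ (m + 1) * (1 + ?w) ^ (m + 1)" by (rule power_mult_distrib)
  also have "(1 + ?w) ^ (m + 1) = (1 + ?w) powr (real (m + 1))"
    by (rule powr_realpow[symmetric]) (simp add: add_pos_nonneg)
  also have "(2 * (1 + 1 / om\<^sup>2)) ^ (m + 1) * \<dots> \<le> (2 * (1 + 1 / om\<^sup>2)) ^ (m + 1) * (1 + ?w) powr r"
    using assms by (intro mult_left_mono powr_mono) auto
  finally show ?thesis by (simp only: power_mult)
qed

definition emb :: "nat \<Rightarrow> real" where
  "emb m = sqrt ((2 * (1 + 1 / om\<^sup>2)) ^ (m + 1) * infsum (\<lambda>k. (1 / wt k)\<^sup>2) UNIV)"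

text \<open>Cauchy-Schwarz after splitting off the square-summable factor 1 / (1 + |k|), which
  accounts for the extra unit in r >= m + 1.\<close>

lemma weighted_l1_le:
  assumes r: "r \<ge> real m + 1"
    and s: "(\<lambda>k. (1 + (wavenumber a b k)\<^sup>2) powr r * (cmod (c k))\<^sup>2) summable_on UNIV" and K: "finite K"
  shows "(\<Sum>k\<in>K. wt k ^ m * cmod (c k)) \<le>
     emb m * sqrt (infsum (\<lambda>k. (1 + (wavenumber a b k)\<^sup>2) powr r * (cmod (c k))\<^sup>2) UNIV)"
proof -
  let ?H = "infsum (\<lambda>k. (1 + (wavenumber a b k)\<^sup>2) powr r * (cmod (c k))\<^sup>2) UNIV"
  let ?S = "infsum (\<lambda>k. (1 / wt k)\<^sup>2) UNIV" and ?C = "(2 * (1 + 1 / om\<^sup>2)) ^ (m + 1)"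
  have C: "?C \<ge> 0" by simp
  have "(\<Sum>k\<in>K. wt k ^ m * cmod (c k)) = (\<Sum>k\<in>K. \<bar>wt k ^ (m + 1) * cmod (c k)\<bar> * \<bar>1 / wt k\<bar>)"
    by (intro sum.cong refl) (simp add: abs_mult)
  also have "\<dots> \<le> L2_set (\<lambda>k. wt k ^ (m + 1) * cmod (c k)) K * L2_set (\<lambda>k. 1 / wt k) K"
    by (rule L2_set_mult_ineq)
  also have "\<dots> \<le> sqrt (?C * ?H) * sqrt ?S"
  proof (intro mult_mono real_sqrt_le_mono)
    have "(\<Sum>k\<in>K. (wt k ^ (m + 1) * cmod (c k))\<^sup>2) = (\<Sum>k\<in>K. wt k ^ (2 * (m + 1)) * (cmod (c k))\<^sup>2)"
      by (simp only: power_mult_distrib power_mult[symmetric] mult.commute)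
    also have "\<dots> \<le> (\<Sum>k\<in>K. ?C * ((1 + (wavenumber a b k)\<^sup>2) powr r * (cmod (c k))\<^sup>2))"
    proof (intro sum_mono)
      fix k
      show "wt k ^ (2 * (m + 1)) * (cmod (c k))\<^sup>2 \<le> ?C * ((1 + (wavenumber a b k)\<^sup>2) powr r * (cmod (c k))\<^sup>2)"
        using mult_right_mono[OF wt_power_le[OF r, of k], of "(cmod (c k))\<^sup>2"] by (simp only: mult.assoc) simp
    qed
    also have "\<dots> \<le> ?C * ?H"
      unfolding sum_distrib_left[symmetric]
      by (intro mult_left_mono finite_sum_le_infsum s K C) auto
    finally show "L2_set (\<lambda>k. wt k ^ (m + 1) * cmod (c k)) K \<le> sqrt (?C * ?H)"
      unfolding L2_set_def by (rule real_sqrt_le_mono)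
    show "L2_set (\<lambda>k. 1 / wt k) K \<le> sqrt ?S"
      unfolding L2_set_def
      by (intro real_sqrt_le_mono finite_sum_le_infsum summable_on_inverse_wt_square K) auto
  qed (auto simp: L2_set_nonneg intro!: infsum_nonneg mult_nonneg_nonneg C)
  also have "\<dots> = emb m * sqrt ?H" by (simp add: emb_def real_sqrt_mult mult_ac)
  finally show ?thesis .
qed

text \<open>Elements of \<open>H_per\<close> are functions, not classes; continuity selects the
  representative that equals its Fourier series at every point.\<close>

lemma H_per_ev:
  assumes f: "f \<in> H_per a b r" "continuous_on UNIV f" and r: "r \<ge> real m + 1"
  obtains g where "f = ev a b g" "g \<in> W m" "nrm m g \<le> emb m / sqrt (b - a) * H_per_norm a b r f"
proof -
  have s: "(\<lambda>k. (1 + (wavenumber a b k)\<^sup>2) powr r * (cmod (fourier_coeff a b f k))\<^sup>2) summable_on UNIV"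
    and per: "periodic_fun a b f" using f by (auto simp: H_per_def)
  define B where "B m = emb m * sqrt (infsum (\<lambda>k. (1 + (wavenumber a b k)\<^sup>2) powr r * (cmod (fourier_coeff a b f k))\<^sup>2) UNIV)" for m
  have le: "(\<Sum>k\<in>K. wt k ^ m * cmod (fourier_coeff a b f k)) \<le> B m" if "finite K" "r \<ge> real m + 1" for K m
    unfolding B_def by (rule weighted_l1_le[OF that(2) s that(1)])
  have "(\<lambda>k. cmod (fourier_coeff a b f k)) summable_on UNIV"
    by (rule nonneg_bdd_above_summable_on) (use le[of _ 0] r in \<open>auto intro!: bdd_aboveI2[where M="B 0"]\<close>)
  hence c: "fourier_coeff a b f abs_summable_on UNIV" .
  define g where "g = Abs_wiener (fourier_coeff a b f)"
  have fg: "fc g = fourier_coeff a b f" unfolding g_def using c by (simp add: Abs_wiener_inverse)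
  have "f = ev a b g" unfolding ev_def fg by (rule trig_series_fourier_coeff[OF ab per f(2) c])
  moreover have g: "g \<in> W m" "nrm m g \<le> B m" using nrm_leI[of m g "B m"] le r by (auto simp: fg)
  moreover have "B m = emb m / sqrt (b - a) * H_per_norm a b r f"
    using ab by (simp add: B_def H_per_norm_def real_sqrt_mult)
  ultimately show ?thesis using that by metis
qed

end

section \<open>Curves in the weighted spaces and the mean value inequality\<close>

definition contW :: "nat \<Rightarrow> (real \<Rightarrow> wiener) \<Rightarrow> real set \<Rightarrow> bool" where
  "contW m F I \<longleftrightarrow> (\<forall>t\<in>I. F t \<in> W m) \<and>
     (\<forall>t\<in>I. ((\<lambda>u. nrm m (F u - F t)) \<longlongrightarrow> 0) (at t within I))"

lemma contW_tendsto_0I: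
  assumes "(g \<longlongrightarrow> 0) (at t within I)" "\<And>u. u \<in> I \<Longrightarrow> nrm m (f u) \<le> g u"
  shows "((\<lambda>u. nrm m (f u)) \<longlongrightarrow> 0) (at t within I)"
proof (rule tendsto_sandwich[OF _ _ tendsto_const assms(1)])
  show "\<forall>\<^sub>F u in at t within I. nrm m (f u) \<le> g u"
    using assms(2) by (auto simp: eventually_at_filter)
qed auto

lemma contW_continuous_on:
  assumes "contW m F I"
  shows "continuous_on I F"
  unfolding continuous_on_def
proof
  fix t assume t: "t \<in> I"
  have "((\<lambda>u. nrm 0 (F u - F t)) \<longlongrightarrow> 0) (at t within I)"
    by (rule contW_tendsto_0I[where g="\<lambda>u. nrm m (F u - F t)"])
       (use assms t in \<open>auto simp: contW_def intro!: nrm_mono W_minus\<close>)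
  thus "(F \<longlongrightarrow> F t) (at t within I)" by (simp add: nrm_0 tendsto_iff dist_norm)
qed

lemma contW_mono:
  assumes "contW n F I" "m \<le> n"
  shows "contW m F I"
  unfolding contW_def
proof (intro conjI ballI)
  fix t assume t: "t \<in> I"
  show "F t \<in> W m" using assms t by (auto simp: contW_def intro: W_mono)
  show "((\<lambda>u. nrm m (F u - F t)) \<longlongrightarrow> 0) (at t within I)"
    by (rule contW_tendsto_0I[where g="\<lambda>u. nrm n (F u - F t)"])
       (use assms t in \<open>auto simp: contW_def intro!: nrm_mono W_minus\<close>)
qed

lemma contW_map:
  assumes F: "contW n F I"
    and T: "\<And>f g. f \<in> W n \<Longrightarrow> g \<in> W n \<Longrightarrow> T (f - g) = T f - T g"
      "\<And>f. f \<in> W n \<Longrightarrow> T f \<in> W m" "\<And>f. f \<in> W n \<Longrightarrow> nrm m (T f) \<le> B * nrm n f"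
  shows "contW m (\<lambda>t. T (F t)) I"
  unfolding contW_def
proof (intro conjI ballI)
  fix t assume t: "t \<in> I"
  show "T (F t) \<in> W m" using F T t by (auto simp: contW_def)
  show "((\<lambda>u. nrm m (T (F u) - T (F t))) \<longlongrightarrow> 0) (at t within I)"
  proof (rule contW_tendsto_0I)
    show "((\<lambda>u. B * nrm n (F u - F t)) \<longlongrightarrow> 0) (at t within I)"
      using F t by (auto simp: contW_def intro!: tendsto_mult_right_zero)
    show "nrm m (T (F u) - T (F t)) \<le> B * nrm n (F u - F t)" if "u \<in> I" for u
    proof -
      have "F u \<in> W n" "F t \<in> W n" using F t that by (auto simp: contW_def)
      thus ?thesis using T(1)[of "F u" "F t"] T(3)[of "F u - F t"] by (simp add: W_minus)
    qed
  qed
qed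

lemma contW_add:
  assumes "contW m F I" "contW m G I"
  shows "contW m (\<lambda>t. F t + G t) I"
  unfolding contW_def
proof (intro conjI ballI)
  fix t assume t: "t \<in> I"
  show "F t + G t \<in> W m" using assms t by (auto simp: contW_def)
  show "((\<lambda>u. nrm m (F u + G u - (F t + G t))) \<longlongrightarrow> 0) (at t within I)"
  proof (rule contW_tendsto_0I)
    show "((\<lambda>u. nrm m (F u - F t) + nrm m (G u - G t)) \<longlongrightarrow> 0) (at t within I)"
      using assms t by (auto simp: contW_def intro!: tendsto_add_zero)
    show "nrm m (F u + G u - (F t + G t)) \<le> nrm m (F u - F t) + nrm m (G u - G t)" if "u \<in> I" for u
      unfolding add_diff_add by (rule nrm_add_le) (use assms t that in \<open>auto simp: contW_def\<close>)
  qed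
qed

lemma contW_mult:
  assumes "contW m F I" "contW m G I"
  shows "contW m (\<lambda>t. F t * G t) I"
  unfolding contW_def
proof (intro conjI ballI)
  fix t assume t: "t \<in> I"
  have W: "F u \<in> W m" "G u \<in> W m" if "u \<in> I" for u using assms that by (auto simp: contW_def)
  show "F t * G t \<in> W m" using W t by auto
  show "((\<lambda>u. nrm m (F u * G u - F t * G t)) \<longlongrightarrow> 0) (at t within I)"
  proof (rule contW_tendsto_0I)
    let ?a = "\<lambda>u. nrm m (F u - F t)" and ?b = "\<lambda>u. nrm m (G u - G t)"
    have ab: "(?a \<longlongrightarrow> 0) (at t within I)" "(?b \<longlongrightarrow> 0) (at t within I)"
      using assms t by (auto simp: contW_def)
    have "((\<lambda>u. ?a u * ?b u + ?a u * nrm m (G t) + nrm m (F t) * ?b u) \<longlongrightarrow> 0 * 0 + 0 * nrm m (G t) + nrm m (F t) * 0) (at t within I)"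
      by (intro tendsto_intros ab)
    thus "((\<lambda>u. ?a u * ?b u + ?a u * nrm m (G t) + nrm m (F t) * ?b u) \<longlongrightarrow> 0) (at t within I)" by simp
    show "nrm m (F u * G u - F t * G t) \<le> ?a u * ?b u + ?a u * nrm m (G t) + nrm m (F t) * ?b u" if u: "u \<in> I" for u
    proof -
      have d: "F u - F t \<in> W m" "G u - G t \<in> W m" using W u t by auto
      \<comment> \<open>Expansion in the increments at t, so that apart from small factors only
        norms at the fixed time t occur.\<close>
      have "F u * G u - F t * G t = (F u - F t) * (G u - G t) + ((F u - F t) * G t + F t * (G u - G t))"
        by (simp add: algebra_simps)
      hence "nrm m (F u * G u - F t * G t) \<le>
          nrm m ((F u - F t) * (G u - G t)) + (nrm m ((F u - F t) * G t) + nrm m (F t * (G u - G t)))"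
        using d W[OF t] by (auto intro!: order_trans[OF nrm_add_le] add_left_mono nrm_add_le)
      also have "\<dots> \<le> ?a u * ?b u + (?a u * nrm m (G t) + nrm m (F t) * ?b u)"
        using d W[OF t] by (intro add_mono nrm_mult_le)
      finally show ?thesis by simp
    qed
  qed
qed

lemma contW_cnjw: "contW m F I \<Longrightarrow> contW m (\<lambda>t. cnjw (F t)) I"
  by (rule contW_map[where B=1]) (auto simp: cnjw_minus)

lemma contW_uminus: "contW m F I \<Longrightarrow> contW m (\<lambda>t. - F t) I"
  by (rule contW_map[where B=1]) auto

lemma contW_cst_mult: "contW m F I \<Longrightarrow> contW m (\<lambda>t. cst z * F t) I"
  by (rule contW_map[where B="cmod z"]) (auto simp: right_diff_distrib nrm_cst_mult_le)

text \<open>Only single coefficients are assumed differentiable. Pairing finitely many of them with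
  weighted phases gives a scalar curve to which the classical mean value inequality applies, with a
  bound that does not depend on the set of modes.\<close>

lemma wiener_mvt:
  assumes t: "t0 \<le> t1"
    and F: "\<And>s k. s \<in> {t0..t1} \<Longrightarrow> ((\<lambda>u. fc (F u) k) has_vector_derivative fc (G s) k) (at s within {t0..t1})"
    and G: "\<And>s. s \<in> {t0..t1} \<Longrightarrow> G s \<in> W m \<and> nrm m (G s) \<le> h s"
    and H: "\<And>s. s \<in> {t0..t1} \<Longrightarrow> (H has_real_derivative h s) (at s within {t0..t1})"
  shows "F t1 - F t0 \<in> W m" "nrm m (F t1 - F t0) \<le> H t1 - H t0"
proof -
  have "(\<Sum>k\<in>K. wt k ^ m * cmod (fc (F t1 - F t0) k)) \<le> H t1 - H t0" if K: "finite K" for K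
  proof (cases "t0 < t1")
    case True
    define z where "z k = fc (F t1) k - fc (F t0) k" for k
    \<comment> \<open>The phases are those of the total increment, so that its pairing with them is
      exactly the weighted sum of moduli.\<close>
    define \<sigma> where "\<sigma> k = of_real (wt k ^ m) * cnj (sgn (z k))" for k
    have \<sigma>: "cmod (\<sigma> k) \<le> wt k ^ m" for k
      by (simp add: \<sigma>_def norm_mult norm_power norm_sgn)
    have \<sigma>z: "\<sigma> k * z k = of_real (wt k ^ m * cmod (z k))" for k
    proof -
      have "cnj (sgn (z k)) * z k = of_real (cmod (z k))"
      proof (cases "z k = 0")
        case False
        have "cnj (z k) * z k = of_real (cmod (z k)) * of_real (cmod (z k))"
          using complex_norm_square[of "z k"] by (simp add: power2_eq_square mult.commute)
        thus ?thesis using False by (simp add: sgn_eq)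
      qed simp
      thus ?thesis by (simp add: \<sigma>_def mult.assoc)
    qed
    define \<phi> where "\<phi> u = (\<Sum>k\<in>K. \<sigma> k * fc (F u) k)" for u
    define \<phi>' where "\<phi>' s = (\<Sum>k\<in>K. \<sigma> k * fc (G s) k)" for s
    have d: "(\<phi> has_vector_derivative \<phi>' s) (at s within {t0..t1})" if "s \<in> {t0..t1}" for s
      unfolding \<phi>_def \<phi>'_def
      by (intro has_vector_derivative_sum has_vector_derivative_mult_right F that)
    have "norm (\<phi> t1 - \<phi> t0) \<le> H t1 - H t0"
    proof (rule differentiable_bound_general[OF True])
      show "continuous_on {t0..t1} \<phi>"
        by (rule continuous_on_vector_derivative[OF d])
      show "continuous_on {t0..t1} H"
        by (rule DERIV_continuous_on[OF H])
      fix s assume s: "t0 < s" "s < t1"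
      hence n: "at s within {t0..t1} = at s" by (simp add: at_within_Icc_at)
      show "(\<phi> has_vector_derivative \<phi>' s) (at s)" using d[of s] s n by auto
      show "(H has_vector_derivative h s) (at s)"
        using H[of s] s n by (auto simp: has_real_derivative_iff_has_vector_derivative)
      have "norm (\<phi>' s) \<le> (\<Sum>k\<in>K. wt k ^ m * cmod (fc (G s) k))"
        unfolding \<phi>'_def
        by (rule order_trans[OF norm_sum sum_mono]) (simp add: norm_mult \<sigma> mult_right_mono)
      also have "\<dots> \<le> nrm m (G s)" using G[of s] s K by (intro sum_le_nrm) auto
      also have "\<dots> \<le> h s" using G[of s] s by auto
      finally show "norm (\<phi>' s) \<le> h s" .
    qed
    moreover have "\<phi> t1 - \<phi> t0 = of_real (\<Sum>k\<in>K. wt k ^ m * cmod (z k))"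
      unfolding \<phi>_def sum_subtractf[symmetric] right_diff_distrib[symmetric] z_def[symmetric] \<sigma>z by simp
    moreover have "(\<Sum>k\<in>K. wt k ^ m * cmod (z k)) \<ge> 0" by (intro sum_nonneg) auto
    ultimately have "(\<Sum>k\<in>K. wt k ^ m * cmod (z k)) \<le> H t1 - H t0"
      by (simp only: norm_of_real abs_of_nonneg)
    thus ?thesis by (simp add: z_def)
  qed (use t in auto)
  from nrm_leI[OF this] show "F t1 - F t0 \<in> W m" "nrm m (F t1 - F t0) \<le> H t1 - H t0" by blast+
qed

text \<open>Coefficientwise derivatives that form a norm-continuous curve are norm derivatives: the
  mean value inequality is applied to F(u) - u G(t), whose derivative G(s) - G(t) is small near
  t.\<close>

lemma wiener_has_vector_derivative:
  assumes F: "\<And>s k. s \<in> {t0..t1} \<Longrightarrow> ((\<lambda>u. fc (F u) k) has_vector_derivative fc (G s) k) (at s within {t0..t1})"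
    and G: "continuous_on {t0..t1} G" and t: "t \<in> {t0..t1}"
  shows "(F has_vector_derivative G t) (at t within {t0..t1})"
  unfolding has_vector_derivative_def has_derivative_within_alt
proof (intro conjI allI impI bounded_linear_scaleR_left)
  fix e :: real assume e: "e > 0"
  obtain d where d: "d > 0" "\<And>s. s \<in> {t0..t1} \<Longrightarrow> dist s t < d \<Longrightarrow> dist (G s) (G t) < e"
    using G t e unfolding continuous_on_iff by meson
  have key: "norm (F y - F x - (y - x) *\<^sub>R G t) \<le> e * (y - x)"
    if xy: "x \<le> y" "{x..y} \<subseteq> {t0..t1}" "\<And>s. s \<in> {x..y} \<Longrightarrow> dist s t < d" for x y
  proof -
    define F' where "F' u = F u - u *\<^sub>R G t" for u
    have "nrm 0 (F' y - F' x) \<le> e * y - e * x"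
    proof (rule wiener_mvt(2)[OF xy(1), where G="\<lambda>s. G s - G t" and h="\<lambda>_. e"])
      fix s k assume s: "s \<in> {x..y}"
      have "((\<lambda>u. fc (F u) k) has_vector_derivative fc (G s) k) (at s within {x..y})"
        using F[of s k] s xy(2) has_vector_derivative_within_subset by blast
      thus "((\<lambda>u. fc (F' u) k) has_vector_derivative fc (G s - G t) k) (at s within {x..y})"
        unfolding F'_def fc_minus fc_scaleR
        by (auto intro!: has_vector_derivative_eq_rhs[OF has_vector_derivative_diff] derivative_eq_intros)
      show "G s - G t \<in> W 0 \<and> nrm 0 (G s - G t) \<le> e"
        using d(2)[of s] s xy by (auto simp: nrm_0 dist_norm less_imp_le)
      show "((*) e has_real_derivative e) (at s within {x..y})" by (auto intro!: derivative_eq_intros)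
    qed
    thus ?thesis by (simp add: F'_def nrm_0 algebra_simps)
  qed
  show "\<exists>d>0. \<forall>y\<in>{t0..t1}. norm (y - t) < d \<longrightarrow> norm (F y - F t - (y - t) *\<^sub>R G t) \<le> e * norm (y - t)"
  proof (intro exI[of _ d] conjI ballI impI d(1))
    fix y assume y: "y \<in> {t0..t1}" "norm (y - t) < d"
    show "norm (F y - F t - (y - t) *\<^sub>R G t) \<le> e * norm (y - t)"
    proof (cases "t \<le> y")
      case True
      thus ?thesis using key[of t y] y t by (auto simp: dist_real_def)
    next
      case False
      have "norm (F t - F y - (t - y) *\<^sub>R G t) \<le> e * (t - y)"
        using key[of y t] y t False by (auto simp: dist_real_def)
      moreover have "F t - F y - (t - y) *\<^sub>R G t = - (F y - F t - (y - t) *\<^sub>R G t)"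
        by (simp add: algebra_simps)
      ultimately show ?thesis using False by (simp only: norm_minus_cancel) simp
    qed
  qed
qed

text \<open>The derivative of the new remainder is the old remainder, of size C s^n; the mean value
  inequality gains one order and keeps the weight \<open>m\<close>.\<close>

lemma expd_integrate:
  assumes F: "\<And>s k. s \<in> {0..T} \<Longrightarrow> ((\<lambda>u. fc (v u) k) has_vector_derivative fc (G s) k) (at s within {0..T})"
    and T: "T > 0" and v: "\<And>t. t \<in> {0..T} \<Longrightarrow> v t \<in> W m"
    and G: "expd n m G c"
    and d: "fps_nth d 0 = v 0" "\<And>q. q < n \<Longrightarrow> fps_nth d (Suc q) = (1 / Suc q) *\<^sub>R fps_nth c q"
  shows "expd (Suc n) m v d"
proof -
  from G obtain C \<delta> where "expd_on n m G c C \<delta>" by (rule expdE)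
  note * = expd_onD[OF this]
  have dW: "fps_nth d q \<in> W m" if "q < Suc n" for q
  proof (cases q)
    case 0
    thus ?thesis using v[of 0] T d(1) by auto
  next
    case (Suc q')
    thus ?thesis using that *(4) d(2) by auto
  qed
  show ?thesis
  proof (rule expdI[of _ _ _ "min \<delta> T"])
    fix t assume t: "0 \<le> t" "t \<le> min \<delta> T"
    show "v t \<in> W m" using v t by auto
    define g where "g t = v t - (\<Sum>q<Suc n. t ^ q *\<^sub>R fps_nth d q)" for t
    have "nrm m (g t - g 0) \<le> C * t ^ Suc n / Suc n - C * 0 ^ Suc n / Suc n"
    proof (rule wiener_mvt(2)[OF t(1), where G="\<lambda>s. G s - (\<Sum>q<n. s ^ q *\<^sub>R fps_nth c q)" and h="\<lambda>s. C * s ^ n"])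
      fix s k assume s: "s \<in> {0..t}"
      have fcs: "fc (\<Sum>q\<in>I. f q) k = (\<Sum>q\<in>I. fc (f q) k)" for f and I :: "nat set"
        by (rule linear_sum[OF bounded_linear.linear[OF bounded_linear_fc]])
      have 1: "((\<lambda>u. fc (v u) k) has_vector_derivative fc (G s) k) (at s within {0..t})"
        by (rule has_vector_derivative_within_subset[OF F[of s k]]) (use s t in auto)
      have 2: "((\<lambda>u. \<Sum>q<Suc n. u ^ q *\<^sub>R fc (fps_nth d q) k) has_vector_derivative
          (\<Sum>q<Suc n. (real q * s ^ (q - 1)) *\<^sub>R fc (fps_nth d q) k)) (at s within {0..t})"
        by (auto intro!: derivative_eq_intros has_vector_derivative_sum simp del: sum.lessThan_Suc)
      have 3: "(\<Sum>q<Suc n. (real q * s ^ (q - 1)) *\<^sub>R fc (fps_nth d q) k) = fc (\<Sum>q<n. s ^ q *\<^sub>R fps_nth c q) k"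
        unfolding fcs by (subst sum.lessThan_Suc_shift) (auto intro!: sum.cong simp: d(2))
      have 4: "(\<lambda>u. fc (g u) k) = (\<lambda>u. fc (v u) k - (\<Sum>q<Suc n. u ^ q *\<^sub>R fc (fps_nth d q) k))"
        unfolding g_def fc_minus fcs fc_scaleR ..
      show "((\<lambda>u. fc (g u) k) has_vector_derivative fc (G s - (\<Sum>q<n. s ^ q *\<^sub>R fps_nth c q)) k) (at s within {0..t})"
        unfolding 4 fc_minus 3[symmetric] by (rule has_vector_derivative_diff[OF 1 2])
      show "G s - (\<Sum>q<n. s ^ q *\<^sub>R fps_nth c q) \<in> W m \<and> nrm m (G s - (\<Sum>q<n. s ^ q *\<^sub>R fps_nth c q)) \<le> C * s ^ n"
        using *(6,8)[of s] s t by auto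
      show "((\<lambda>s. C * s ^ Suc n / Suc n) has_real_derivative C * s ^ n) (at s within {0..t})"
        by (auto intro!: derivative_eq_intros simp del: power_Suc)
    qed
    moreover have "g 0 = 0" by (simp add: g_def d(1) sum.lessThan_Suc_shift del: sum.lessThan_Suc)
    moreover have "C * t ^ Suc n / Suc n \<le> C * t ^ Suc n / 1"
      using *(1) t by (intro divide_left_mono) auto
    ultimately show "nrm m (v t - (\<Sum>q<Suc n. t ^ q *\<^sub>R fps_nth d q)) \<le> C * t ^ Suc n"
      by (simp add: g_def)
  qed (use dW * T in auto)
qed

lemma numeral_eq_cst: "(numeral n :: wiener) = cst (numeral n)"
  using cst_of_real[of "numeral n"] by simp

lemma cnjw_numeral [simp]: "cnjw (numeral n) = numeral n"
  by (simp add: numeral_eq_cst cnjw_cst)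

lemma bounded_linear_cnjw: "bounded_linear cnjw"
proof (rule bounded_linear_intro)
  show "norm (cnjw f) \<le> norm f * 1" for f by (simp flip: nrm_0)
qed (auto simp: cnjw_add cnjw_scaleR)

lemma has_vector_derivative_cnjw:
  assumes "(F has_vector_derivative G) (at t within I)"
  shows "((\<lambda>u. cnjw (F u)) has_vector_derivative cnjw G) (at t within I)"
  by (rule bounded_linear.has_vector_derivative[OF bounded_linear_cnjw assms])

lemma fc_has_vector_derivative:
  assumes "(F has_vector_derivative G) (at t within I)"
  shows "((\<lambda>u. fc (F u) k) has_vector_derivative fc G k) (at t within I)"
  by (rule bounded_linear.has_vector_derivative[OF bounded_linear_fc assms])

text \<open>The bound of |ev f x| by the norm of f is uniform in x. Hence the change of G and the
  change of x can be estimated one after the other.\<close>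

lemma continuous_on_ev_joint:
  assumes "continuous_on I G"
  shows "continuous_on (I \<times> S) (\<lambda>(u, x). ev a b (G u) x)"
  unfolding continuous_on_def
proof
  fix p assume p: "p \<in> I \<times> S"
  obtain t x where tx: "p = (t, x)" by (cases p)
  let ?F = "at p within I \<times> S"
  have Gc: "((\<lambda>q. G (fst q)) \<longlongrightarrow> G t) ?F"
  proof -
    have "continuous_on (I \<times> S) (\<lambda>q. G (fst q))"
      by (rule continuous_on_compose2[OF assms]) (auto intro!: continuous_intros)
    thus ?thesis using p by (auto simp: continuous_on_def tx)
  qed
  have 1: "((\<lambda>q. ev a b (G (fst q) - G t) (snd q)) \<longlongrightarrow> 0) ?F"
  proof (rule tendsto_norm_zero_cancel, rule tendsto_sandwich[OF _ _ tendsto_const])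
    show "((\<lambda>q. norm (G (fst q) - G t)) \<longlongrightarrow> 0) ?F"
      using Gc by (simp add: LIM_zero tendsto_norm_zero)
  qed (auto intro!: always_eventually norm_ev_le)
  have 2: "((\<lambda>q. ev a b (G t) (snd q)) \<longlongrightarrow> ev a b (G t) x) ?F"
  proof -
    have "continuous_on (I \<times> S) (\<lambda>q. ev a b (G t) (snd q))"
      by (rule continuous_on_compose2[OF continuous_on_ev[of UNIV]]) (auto intro!: continuous_intros)
    thus ?thesis using p by (auto simp: continuous_on_def tx)
  qed
  have "((\<lambda>q. ev a b (G (fst q)) (snd q)) \<longlongrightarrow> ev a b (G t) x) ?F"
    using tendsto_add[OF 1 2] by (simp add: ev_minus)
  thus "((\<lambda>(u, x). ev a b (G u) x) \<longlongrightarrow> (case p of (u, x) \<Rightarrow> ev a b (G u) x)) ?F"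
    by (simp add: case_prod_unfold tx)
qed

context torus
begin

lemma contW_D:
  assumes "contW (Suc m) F I"
  shows "contW m (\<lambda>t. D (F t)) I"
proof (rule contW_map[where T=D and B=om, OF assms])
  have 1: "f \<in> W 1" if "f \<in> W (Suc m)" for f using that by (rule W_mono) simp
  show "D (f - g) = D f - D g" if "f \<in> W (Suc m)" "g \<in> W (Suc m)" for f g
    using that by (intro D_minus 1)
qed (auto intro: W_D nrm_D_le)

lemma contW_Nw: "contW (Suc m) F I \<Longrightarrow> contW m (\<lambda>t. Nw (F t)) I"
  unfolding Nw_def by (intro contW_uminus contW_D contW_mult contW_cnjw)

lemma cubic_ev: "(\<lambda>y. complex_of_real ((cmod (ev a b f y))\<^sup>2) * ev a b f y) = ev a b (f * cnjw f * f)"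
  by (rule ext) (simp only: ev_mult ev_cnjw complex_norm_square)

lemma nonlin_ev: "f \<in> W 2 \<Longrightarrow> nonlin (ev a b f) = ev a b (Nw f)"
  unfolding nonlin_def cubic_ev Nw_def
  by (rule ext) (simp add: dx_ev W_mult W_cnjw ev_uminus)

lemma H_per_diff:
  assumes "f \<in> H_per a b r" "g \<in> H_per a b r" "continuous_on UNIV f" "continuous_on UNIV g"
  shows "(\<lambda>x. f x - g x) \<in> H_per a b r"
proof -
  have c: "continuous_on S f" "continuous_on S g" for S
    using assms(3,4) continuous_on_subset by blast+
  let ?w = "\<lambda>k. (1 + (wavenumber a b k)\<^sup>2) powr r"
  have "(\<lambda>k. ?w k * (cmod (fourier_coeff a b (\<lambda>x. f x - g x) k))\<^sup>2) summable_on UNIV"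
  proof (rule summable_on_comparison_test)
    show "(\<lambda>k. 2 * (?w k * (cmod (fourier_coeff a b f k))\<^sup>2) + 2 * (?w k * (cmod (fourier_coeff a b g k))\<^sup>2)) summable_on UNIV"
      using assms(1,2) by (intro summable_on_add summable_on_cmult_right) (auto simp: H_per_def)
    fix k
    let ?x = "cmod (fourier_coeff a b f k)" and ?y = "cmod (fourier_coeff a b g k)"
    have "(cmod (fourier_coeff a b (\<lambda>x. f x - g x) k))\<^sup>2 \<le> (?x + ?y)\<^sup>2"
      unfolding fourier_coeff_diff[OF c] by (intro power_mono norm_triangle_ineq4) auto
    also have "\<dots> \<le> 2 * ?x\<^sup>2 + 2 * ?y\<^sup>2" using sum_squares_bound[of ?x ?y] by (simp add: power2_sum)
    finally have "?w k * (cmod (fourier_coeff a b (\<lambda>x. f x - g x) k))\<^sup>2 \<le> ?w k * (2 * ?x\<^sup>2 + 2 * ?y\<^sup>2)"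
      by (intro mult_left_mono) auto
    thus "?w k * (cmod (fourier_coeff a b (\<lambda>x. f x - g x) k))\<^sup>2 \<le> 2 * (?w k * ?x\<^sup>2) + 2 * (?w k * ?y\<^sup>2)"
      by (simp add: algebra_simps)
  qed auto
  moreover have "(\<lambda>x. f x - g x) absolutely_integrable_on {a..b}"
    by (intro absolutely_integrable_continuous_real continuous_intros c)
  moreover have "(\<lambda>x. (cmod (f x - g x))\<^sup>2) integrable_on {a..b}"
    by (intro integrable_continuous_interval continuous_intros c)
  ultimately show ?thesis using assms(1,2) by (simp add: H_per_def periodic_fun_def)
qed

text \<open>Differences of the solution at two times are lifted once more. Injectivity of
  \<open>ev\<close> identifies that lift with the difference of the lifts, which turns continuity in
  H^r into continuity in \<open>nrm m\<close>.\<close>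

lemma dnls_lift:
  assumes C: "C_H_per a b r I \<psi>" and sol: "dnls_solution I \<psi>" and r: "r \<ge> real m + 1"
  obtains \<Psi> where "\<And>t. t \<in> I \<Longrightarrow> \<psi> t = ev a b (\<Psi> t)" "contW m \<Psi> I"
proof -
  have H: "\<psi> t \<in> H_per a b r" and c: "continuous_on UNIV (\<psi> t)" if "t \<in> I" for t
    using C sol that by (auto simp: C_H_per_def dnls_solution_def)
  have "\<forall>t\<in>I. \<exists>g. \<psi> t = ev a b g \<and> g \<in> W m"
    using H_per_ev[OF H c r] by metis
  then obtain \<Psi> where \<Psi>: "\<And>t. t \<in> I \<Longrightarrow> \<psi> t = ev a b (\<Psi> t)" "\<And>t. t \<in> I \<Longrightarrow> \<Psi> t \<in> W m"
    by metis
  have le: "nrm m (\<Psi> u - \<Psi> t) \<le> emb m / sqrt (b - a) * H_per_norm a b r (\<lambda>x. \<psi> u x - \<psi> t x)"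
    if ut: "u \<in> I" "t \<in> I" for u t
  proof -
    obtain g where g: "(\<lambda>x. \<psi> u x - \<psi> t x) = ev a b g"
      "nrm m g \<le> emb m / sqrt (b - a) * H_per_norm a b r (\<lambda>x. \<psi> u x - \<psi> t x)"
      using H_per_ev[OF H_per_diff[OF H[OF ut(1)] H[OF ut(2)] c[OF ut(1)] c[OF ut(2)]]
          continuous_on_diff[OF c[OF ut(1)] c[OF ut(2)]] r] by metis
    have "ev a b g x = ev a b (\<Psi> u - \<Psi> t) x" for x
      using fun_cong[OF g(1), of x] \<Psi>(1)[OF ut(1)] \<Psi>(1)[OF ut(2)] by (simp add: ev_minus)
    hence "g = \<Psi> u - \<Psi> t" by (rule ev_inj[OF ab])
    thus ?thesis using g(2) by simp
  qed
  have "contW m \<Psi> I"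
    unfolding contW_def
  proof (intro conjI ballI \<Psi>(2))
    fix t assume t: "t \<in> I"
    show "((\<lambda>u. nrm m (\<Psi> u - \<Psi> t)) \<longlongrightarrow> 0) (at t within I)"
    proof (rule contW_tendsto_0I)
      show "((\<lambda>u. emb m / sqrt (b - a) * H_per_norm a b r (\<lambda>x. \<psi> u x - \<psi> t x)) \<longlongrightarrow> 0) (at t within I)"
        using C t unfolding C_H_per_def by (intro tendsto_mult_right_zero) blast
    qed (rule le[OF _ t])
  qed
  with \<Psi>(1) show ?thesis by (rule that)
qed

definition rhs :: "wiener \<Rightarrow> wiener" where "rhs f = cst \<i> * D (D f) + Nw f"

lemma contW_rhs: "contW (Suc (Suc m)) F I \<Longrightarrow> contW m (\<lambda>t. rhs (F t)) I"
  unfolding rhs_def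
  by (intro contW_add contW_cst_mult contW_D contW_Nw) (auto elim: contW_mono)

text \<open>The equation is given pointwise in x. Differentiation under the integral, justified by
  joint continuity of the right-hand side, carries it over to the Fourier coefficients.\<close>

lemma dnls_coeff_ode:
  assumes \<psi>: "\<And>t. t \<in> {t0..t1} \<Longrightarrow> \<psi> t = ev a b (\<Psi> t)" and \<Psi>: "contW 3 \<Psi> {t0..t1}"
    and sol: "dnls_solution {t0..t1} \<psi>" and t: "t \<in> {t0..t1}"
  shows "((\<lambda>u. fc (\<Psi> u) k) has_vector_derivative fc (rhs (\<Psi> t)) k) (at t within {t0..t1})"
proof -
  let ?I = "{t0..t1}" and ?e = "\<lambda>x. cis (- (wavenumber a b k * x))"
  have W3: "\<Psi> s \<in> W 3" if "s \<in> ?I" for s using \<Psi> that by (auto simp: contW_def)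
  have d: "((\<lambda>u. \<psi> u x) has_vector_derivative ev a b (rhs (\<Psi> s)) x) (at s within ?I)" if s: "s \<in> ?I" for s x
  proof -
    have W2: "\<Psi> s \<in> W 2" "D (\<Psi> s) \<in> W 2"
      using W3[OF s] by (auto intro: W_mono W_D simp: numeral_2_eq_2 numeral_3_eq_3)
    obtain E where E: "((\<lambda>u. \<psi> u x) has_vector_derivative E) (at s within ?I)"
      "\<i> * E = - dx (dx (\<psi> s)) x - \<i> * dx (\<lambda>y. complex_of_real ((cmod (\<psi> s y))\<^sup>2) * \<psi> s y) x"
      using sol s unfolding dnls_solution_def by blast
    have "dx (\<lambda>y. complex_of_real ((cmod (\<psi> s y))\<^sup>2) * \<psi> s y) x = - nonlin (\<psi> s) x"
      by (simp add: nonlin_def)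
    also have "\<dots> = - ev a b (Nw (\<Psi> s)) x" using \<psi>[OF s] nonlin_ev[OF W2(1)] by simp
    finally have "\<i> * E = - ev a b (D (D (\<Psi> s))) x + \<i> * ev a b (Nw (\<Psi> s)) x"
      using E(2) \<psi>[OF s] by (simp add: dx_ev W2)
    hence "\<i> * (\<i> * E) = \<i> * (- ev a b (D (D (\<Psi> s))) x + \<i> * ev a b (Nw (\<Psi> s)) x)" by simp
    hence "E = \<i> * ev a b (D (D (\<Psi> s))) x + ev a b (Nw (\<Psi> s)) x"
      by (simp add: algebra_simps flip: mult.assoc)
    thus ?thesis using E(1) by (simp add: rhs_def ev_add ev_mult ev_cst)
  qed
  have "contW 1 (\<lambda>t. rhs (\<Psi> t)) ?I" using \<Psi> by (intro contW_rhs) (simp add: numeral_3_eq_3)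
  hence rc: "continuous_on ?I (\<lambda>t. rhs (\<Psi> t))" by (rule contW_continuous_on)
  have "((\<lambda>u. integral (cbox a b) (\<lambda>x. \<psi> u x * ?e x)) has_vector_derivative
      integral (cbox a b) (\<lambda>x. ev a b (rhs (\<Psi> t)) x * ?e x)) (at t within ?I)"
  proof (rule leibniz_rule_vector_derivative[where fx="\<lambda>t x. ev a b (rhs (\<Psi> t)) x * ?e x"])
    show "((\<lambda>u. \<psi> u x * ?e x) has_vector_derivative ev a b (rhs (\<Psi> s)) x * ?e x) (at s within ?I)"
      if "s \<in> ?I" for s x
      by (intro has_vector_derivative_mult_left d that)
    show "(\<lambda>x. \<psi> s x * ?e x) integrable_on cbox a b" if "s \<in> ?I" for s
      unfolding \<psi>[OF that]
      by (intro integrable_continuous continuous_intros continuous_on_ev)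
    have "continuous_on (?I \<times> cbox a b) (\<lambda>p. (case p of (u, x) \<Rightarrow> ev a b (rhs (\<Psi> u)) x) * ?e (snd p))"
      by (intro continuous_on_mult continuous_on_ev_joint rc continuous_intros)
    thus "continuous_on (?I \<times> cbox a b) (\<lambda>(u, x). ev a b (rhs (\<Psi> u)) x * ?e x)"
      by (simp add: case_prod_unfold)
  qed (use t in auto)
  hence "((\<lambda>u. fourier_coeff a b (\<psi> u) k) has_vector_derivative fourier_coeff a b (ev a b (rhs (\<Psi> t))) k) (at t within ?I)"
    unfolding fourier_coeff_def cbox_interval by (rule has_vector_derivative_mult_right)
  hence "((\<lambda>u. fourier_coeff a b (\<psi> u) k) has_vector_derivative fc (rhs (\<Psi> t)) k) (at t within ?I)"
    by (simp add: fourier_coeff_ev[OF ab])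
  thus ?thesis
    by (rule has_vector_derivative_transform[OF t, rotated]) (simp add: \<psi> fourier_coeff_ev[OF ab])
qed

text \<open>Bootstrapping: an expansion of v of order n gives one of the right-hand side, and
  integration gives order n + 1. The start is plain boundedness, which is an expansion of order 0.
  The rate 4 N + 1 dominates the loss 4 n + 1 of every step.\<close>

lemma expd_exact:
  assumes T: "T > 0" and v0: "v 0 = u"
    and ode: "\<And>t k. t \<in> {0..T} \<Longrightarrow>
      ((\<lambda>s. fc (v s) k) has_vector_derivative fc (eL (- t) (Nw (eL t (v t)))) k) (at t within {0..T})"
    and bd: "expd 0 (m + n * (4 * N + 1)) v 0" and W: "\<And>t. t \<in> {0..T} \<Longrightarrow> v t \<in> W (m + n * (4 * N + 1))"
    and n: "n \<le> Suc l" "n \<le> N"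
  shows "expd n m v (exact_fps u l)"
  using n bd W
proof (induction n arbitrary: m l)
  case 0
  thus ?case by (auto simp: expd_def)
next
  case (Suc n)
  have IH: "expd n (m + 4 * n + 1) v c"
    if "c = exact_fps u (l - 1)" for c
  proof -
    \<comment> \<open>For \<open>l = 0\<close> the truncated difference \<open>l - 1\<close> is 0
      again, and then \<open>n\<close> is 0 as well.\<close>
    have "n = 0 \<or> n \<le> Suc (l - 1)" using Suc.prems(1) by auto
    hence "n \<le> Suc (l - 1)" by auto
    moreover have "expd 0 (m + 4 * n + 1 + n * (4 * N + 1)) v 0"
      by (rule expd_mono[OF Suc.prems(3)]) (use Suc.prems in auto)
    moreover have "v t \<in> W (m + 4 * n + 1 + n * (4 * N + 1))" if "t \<in> {0..T}" for t
      by (rule W_mono[OF Suc.prems(4)[OF that]]) (use Suc.prems in auto)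
    ultimately show ?thesis unfolding that using Suc.prems(2) by (intro Suc.IH) auto
  qed
  have F: "expd n m (\<lambda>t. eL (- t) (Nw (eL t (v t)))) (Fs 1 (exact_fps u (l - 1)))"
    using expd_F[OF IH[OF refl], of 1] by simp
  show ?case
  proof (rule expd_integrate[OF ode T _ F])
    show "v t \<in> W m" if "t \<in> {0..T}" for t using Suc.prems(4)[OF that] by (rule W_mono) simp
    show "fps_nth (exact_fps u l) 0 = v 0" by (simp add: exact_fps_0 v0)
    show "fps_nth (exact_fps u l) (Suc q) = (1 / Suc q) *\<^sub>R fps_nth (Fs 1 (exact_fps u (l - 1))) q" if "q < n" for q
      using that Suc.prems(1) by (cases l) auto
  qed
qed

section \<open>Conservation laws\<close>

text \<open>
  The momentum and energy densities are scaled by \<open>2\<close> and \<open>8\<close> to make all coefficients integers,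
  and \<open>Im z\<close> is written as \<open>(z - cnj z) / (2 * \<i>)\<close>; the argument \<open>g\<close> stands for the derivative of \<open>f\<close>.
\<close>

definition mass_density :: "wiener \<Rightarrow> wiener" where
  "mass_density f = f * cnjw f"

definition momentum_density :: "wiener \<Rightarrow> wiener \<Rightarrow> wiener" where
  "momentum_density f g = cst \<i> * (f * cnjw g - g * cnjw f) + f * f * (cnjw f * cnjw f)"

definition energy_density :: "wiener \<Rightarrow> wiener \<Rightarrow> wiener" where
  "energy_density f g = 8 * (g * cnjw g)
     + cst \<i> * (6 * (f * f * (cnjw f * cnjw g)) - 6 * (f * g * (cnjw f * cnjw f)))
     + 4 * (f * f * f * (cnjw f * cnjw f * cnjw f))"

text \<open>The zeroth coefficient of an x-derivative vanishes, so a local conservation law with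
  flux \<open>J\<close> makes the mean of the density constant.\<close>

lemma fc_0_constant:
  assumes e: "\<And>t. t \<in> {t0..t1} \<Longrightarrow> (e has_vector_derivative D (J t)) (at t within {t0..t1})"
    and J: "\<And>t. t \<in> {t0..t1} \<Longrightarrow> J t \<in> W 1" and t: "t \<in> {t0..t1}"
  shows "fc (e t) 0 = fc (e t0) 0"
proof -
  have "((\<lambda>u. fc (e u) 0) has_vector_derivative 0) (at s within {t0..t1})" if "s \<in> {t0..t1}" for s
    using fc_has_vector_derivative[OF e[OF that], of 0] fc_D_0[OF J[OF that]] by simp
  then obtain c where "\<And>s. s \<in> {t0..t1} \<Longrightarrow> fc (e s) 0 = c"
    using has_vector_derivative_zero_constant[of "{t0..t1}" "\<lambda>u. fc (e u) 0"] by auto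
  thus ?thesis using t by simp
qed

lemma D_numeral_mult: "f \<in> W 1 \<Longrightarrow> D (numeral n * f) = numeral n * D f"
  by (simp only: numeral_eq_cst D_cst_mult)

lemma D_cst [simp]: "D (cst z) = 0"
  by (rule wiener_eqI) (simp add: fc_D fc_cst wn_eq)

lemma D_numeral [simp]: "D (numeral n) = 0"
  by (simp only: numeral_eq_cst D_cst)

lemma W_numeral [simp]: "(numeral n :: wiener) \<in> W m"
  by (simp only: numeral_eq_cst W_cst)

lemma cst_i_mult: "cst \<i> * (cst \<i> * f) = - f"
  by (simp add: cst_neg cst_1 flip: mult.assoc cst_mult)

lemma invariants_constant:
  assumes F: "\<And>t. t \<in> {t0..t1} \<Longrightarrow> F t \<in> W 4"
    and F': "\<And>t. t \<in> {t0..t1} \<Longrightarrow> (F has_vector_derivative rhs (F t)) (at t within {t0..t1})"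
    and DF': "\<And>t. t \<in> {t0..t1} \<Longrightarrow> ((\<lambda>u. D (F u)) has_vector_derivative D (rhs (F t))) (at t within {t0..t1})"
    and t: "t \<in> {t0..t1}"
  shows "fc (mass_density (F t)) 0 = fc (mass_density (F t0)) 0"
    and "fc (momentum_density (F t) (D (F t))) 0 = fc (momentum_density (F t0) (D (F t0))) 0"
    and "fc (energy_density (F t) (D (F t))) 0 = fc (energy_density (F t0) (D (F t0))) 0"
proof -
  let ?I = "{t0..t1}"
  \<comment> \<open>The solution, its conjugate and their x-derivatives become commuting symbols,
    with time derivatives given by the equation. Each conservation law is then a polynomial identity
    that normalisation verifies.\<close>
  define f1 f2 f3 where "f1 t = D (F t)" and "f2 t = D (f1 t)" and "f3 t = D (f2 t)" for t
  define q q1 q2 q3 where "q t = cnjw (F t)" and "q1 t = cnjw (f1 t)" and "q2 t = cnjw (f2 t)" and "q3 t = cnjw (f3 t)" for t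
  define ft where "ft t = cst \<i> * f2 t - (f1 t * q t * F t + F t * q1 t * F t + F t * q t * f1 t)" for t
  define f1t where "f1t t = cst \<i> * f3 t - (f2 t * q t * F t + 2 * f1 t * q1 t * F t + 2 * f1 t * q t * f1 t
     + F t * q2 t * F t + 2 * F t * q1 t * f1 t + F t * q t * f2 t)" for t
  define qt where "qt t = - (cst \<i> * q2 t) - (q1 t * F t * q t + q t * f1 t * q t + q t * F t * q1 t)" for t
  define q1t where "q1t t = - (cst \<i> * q3 t) - (q2 t * F t * q t + 2 * q1 t * f1 t * q t + 2 * q1 t * F t * q1 t
     + q t * f2 t * q t + 2 * q t * f1 t * q1 t + q t * F t * q2 t)" for t
  have W: "F t \<in> W (Suc 0)" "f1 t \<in> W (Suc 0)" "f2 t \<in> W (Suc 0)" "q t \<in> W (Suc 0)" "q1 t \<in> W (Suc 0)" "q2 t \<in> W (Suc 0)"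
    if "t \<in> ?I" for t
  proof -
    have 4: "F t \<in> W (Suc (Suc (Suc (Suc 0))))" using F[OF that] by (simp add: eval_nat_numeral)
    hence f1: "f1 t \<in> W (Suc (Suc (Suc 0)))" unfolding f1_def by (rule W_D)
    hence f2: "f2 t \<in> W (Suc (Suc 0))" unfolding f2_def by (rule W_D)
    show "F t \<in> W (Suc 0)" "f1 t \<in> W (Suc 0)" "f2 t \<in> W (Suc 0)" using 4 f1 f2 by (auto elim: W_mono)
    thus "q t \<in> W (Suc 0)" "q1 t \<in> W (Suc 0)" "q2 t \<in> W (Suc 0)"
      by (auto simp: q_def q1_def q2_def)
  qed
  note Wi = W_mult W_add W_minus W_cst W_uminus W_numeral
  have Dv: "D (F t) = f1 t" "D (f1 t) = f2 t" "D (f2 t) = f3 t" "D (q t) = q1 t" "D (q1 t) = q2 t" "D (q2 t) = q3 t"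
    if "t \<in> ?I" for t
    using W[OF that] by (simp_all add: f1_def f2_def f3_def q_def q1_def q2_def q3_def D_cnjw)
  note Ds = D_add D_minus D_mult D_cst_mult D_uminus D_numeral_mult
  have rhs: "rhs (F t) = ft t" if "t \<in> ?I" for t
    unfolding rhs_def Nw_def q_def[symmetric] ft_def
    by (simp add: Ds Dv[OF that] W[OF that] Wi algebra_simps)
  have Drhs: "D (rhs (F t)) = f1t t" if "t \<in> ?I" for t
    unfolding rhs[OF that] ft_def f1t_def
    by (simp add: Ds Dv[OF that] W[OF that] Wi algebra_simps)
  have qt: "cnjw (ft t) = qt t" for t
    by (simp add: ft_def qt_def q_def q1_def q2_def cnjw_minus cnjw_add cnjw_mult cnjw_cst cst_neg algebra_simps)
  have q1t: "cnjw (f1t t) = q1t t" for t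
    by (simp add: f1t_def q1t_def q_def q1_def q2_def q3_def cnjw_minus cnjw_add cnjw_mult cnjw_cst cst_neg algebra_simps)
  have d: "(F has_vector_derivative ft t) (at t within ?I)" "(f1 has_vector_derivative f1t t) (at t within ?I)"
    "(q has_vector_derivative qt t) (at t within ?I)" "(q1 has_vector_derivative q1t t) (at t within ?I)"
    if "t \<in> ?I" for t
    using F'[OF that] DF'[OF that] has_vector_derivative_cnjw[OF F'[OF that]] has_vector_derivative_cnjw[OF DF'[OF that]]
    unfolding rhs[OF that] Drhs[OF that, unfolded rhs[OF that]] qt q1t f1_def[symmetric] q_def[symmetric] q1_def[symmetric]
    by auto
  note dr = has_vector_derivative_add has_vector_derivative_diff has_vector_derivative_mult has_vector_derivative_const
  txt \<open>
    \<open>J1\<close>, \<open>J2\<close> and \<open>J3\<close> are the fluxes of the local conservation laws.  Giving \<open>F\<close> weight 1/2 and each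
    derivative weight 1, their coefficients come from comparing monomials of equal weight.
  \<close>
  define J1 where "J1 t = cst \<i> * (2 * (f1 t * q t) - 2 * (F t * q1 t)) - 3 * (F t * F t * (q t * q t))" for t
  \<comment> \<open>The mass density is doubled because its own flux would contain the coefficient
    3/2.\<close>
  have "((\<lambda>t. 2 * (F t * q t)) has_vector_derivative D (J1 t)) (at t within ?I)" if "t \<in> ?I" for t
    by (rule has_vector_derivative_eq_rhs, (rule dr d that)+, simp add: J1_def Ds Dv[OF that] W[OF that] Wi,
        simp add: ft_def qt_def cst_i_mult algebra_simps)
  from fc_0_constant[OF this _ t] 
  have 1: "fc (2 * (F t * q t)) 0 = fc (2 * (F t0 * q t0)) 0"
    by (simp add: J1_def W Wi)
  thus "fc (mass_density (F t)) 0 = fc (mass_density (F t0)) 0"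
    by (simp add: mass_density_def q_def numeral_eq_cst)
  define J2 where "J2 t = F t * q2 t - 2 * (f1 t * q1 t) + f2 t * q t +
     cst \<i> * (3 * (F t * f1 t * (q t * q t)) - 3 * (F t * F t * (q t * q1 t))) - 2 * (F t * F t * F t * (q t * q t * q t))" for t
  have E2: "((\<lambda>t. cst \<i> * (F t * q1 t - f1 t * q t) + F t * F t * (q t * q t)) has_vector_derivative D (J2 t)) (at t within ?I)" if "t \<in> ?I" for t
    by (rule has_vector_derivative_eq_rhs, (rule dr d that)+, simp add: J2_def Ds Dv[OF that] W[OF that] Wi,
        simp add: ft_def qt_def f1t_def q1t_def cst_i_mult algebra_simps)
  have JW2: "J2 t \<in> W 1" if "t \<in> ?I" for t by (simp add: J2_def W[OF that] Wi)
  from fc_0_constant[OF E2 JW2 t] show "fc (momentum_density (F t) (D (F t))) 0 = fc (momentum_density (F t0) (D (F t0))) 0"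
    by (simp only: momentum_density_def f1_def q_def q1_def)
  define J3 where "J3 t = cst \<i> * (8 * (f2 t * q1 t) - 8 * (f1 t * q2 t) + 18 * (F t * F t * f1 t * (q t * q t * q t))
        - 18 * (F t * F t * F t * (q t * q t * q1 t)))
     + 6 * (F t * F t * (q t * q2 t)) - 4 * (F t * F t * (q1 t * q1 t)) - 40 * (F t * f1 t * (q t * q1 t))
     + 6 * (F t * f2 t * (q t * q t)) - 4 * (f1 t * f1 t * (q t * q t))
     - 9 * (F t * F t * F t * F t * (q t * q t * q t * q t))" for t
  have E3: "((\<lambda>t. 8 * (f1 t * q1 t) + cst \<i> * (6 * (F t * F t * (q t * q1 t)) - 6 * (F t * f1 t * (q t * q t)))
     + 4 * (F t * F t * F t * (q t * q t * q t))) has_vector_derivative D (J3 t)) (at t within ?I)" if "t \<in> ?I" for t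
    by (rule has_vector_derivative_eq_rhs, (rule dr d that)+, simp add: J3_def Ds Dv[OF that] W[OF that] Wi,
        simp add: ft_def qt_def f1t_def q1t_def cst_i_mult algebra_simps)
  have JW3: "J3 t \<in> W 1" if "t \<in> ?I" for t by (simp add: J3_def W[OF that] Wi)
  from fc_0_constant[OF E3 JW3 t] show "fc (energy_density (F t) (D (F t))) 0 = fc (energy_density (F t0) (D (F t0))) 0"
    by (simp only: energy_density_def f1_def q_def q1_def)
qed

end

section \<open>Strict differentiability and the implicit function\<close>

text \<open>Both points vary in the remainder. This yields a small Lipschitz constant for the
  deviation from the linear part, which is what the contraction and the injectivity estimate below
  require.\<close>

definition sdiff :: "('a::real_normed_vector \<Rightarrow> 'b::real_normed_vector) \<Rightarrow> ('a \<Rightarrow> 'b) \<Rightarrow> 'a \<Rightarrow> bool" where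
  "sdiff F F' x \<longleftrightarrow> bounded_linear F' \<and> (\<forall>e>0. \<exists>d>0. \<forall>y z. norm (y - x) < d \<longrightarrow> norm (z - x) < d \<longrightarrow>
     norm (F y - F z - F' (y - z)) \<le> e * norm (y - z))"

lemma sdiffD:
  assumes "sdiff F F' x" "e > 0"
  obtains d where "d > 0" "\<And>y z. norm (y - x) < d \<Longrightarrow> norm (z - x) < d \<Longrightarrow>
     norm (F y - F z - F' (y - z)) \<le> e * norm (y - z)"
  using assms unfolding sdiff_def by meson

lemma sdiff_linear: "bounded_linear F \<Longrightarrow> sdiff F F x"
proof -
  assume F: "bounded_linear F"
  interpret bounded_linear F by (rule F)
  show ?thesis unfolding sdiff_def using F by (auto simp: diff intro!: exI[of _ 1])
qed

lemma sdiff_const: "sdiff (\<lambda>_. c) (\<lambda>_. 0) x"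
  unfolding sdiff_def by (auto intro!: exI[of _ 1])

lemma sdiff_lipschitz:
  assumes "sdiff F F' x"
  obtains K d where "K > 0" "d > 0" "\<And>y z. norm (y - x) < d \<Longrightarrow> norm (z - x) < d \<Longrightarrow>
     norm (F y - F z) \<le> K * norm (y - z)"
proof -
  obtain d where d: "d > 0" "\<And>y z. norm (y - x) < d \<Longrightarrow> norm (z - x) < d \<Longrightarrow>
     norm (F y - F z - F' (y - z)) \<le> 1 * norm (y - z)"
    using sdiffD[OF assms zero_less_one] by metis
  obtain B where B: "B > 0" "\<And>y. norm (F' y) \<le> norm y * B"
    using bounded_linear.pos_bounded[of F'] assms by (auto simp: sdiff_def)
  show ?thesis
  proof (rule that[of "1 + B" d])
    fix y z assume "norm (y - x) < d" "norm (z - x) < d"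
    from d(2)[OF this] B(2)[of "y - z"] norm_triangle_sub[of "F y - F z" "F' (y - z)"]
    show "norm (F y - F z) \<le> (1 + B) * norm (y - z)" by (simp add: algebra_simps)
  qed (use d B in auto)
qed

lemma sdiff_add:
  assumes "sdiff F F' x" "sdiff G G' x"
  shows "sdiff (\<lambda>y. F y + G y) (\<lambda>y. F' y + G' y) x"
  unfolding sdiff_def
proof (intro conjI allI impI)
  show "bounded_linear (\<lambda>y. F' y + G' y)"
    using assms by (auto simp: sdiff_def intro: bounded_linear_add)
  fix e :: real assume "e > 0"
  hence e: "e / 2 > 0" by simp
  obtain d where d: "d > 0" "\<And>y z. norm (y - x) < d \<Longrightarrow> norm (z - x) < d \<Longrightarrow>
     norm (F y - F z - F' (y - z)) \<le> e / 2 * norm (y - z)"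
    using sdiffD[OF assms(1) e] by metis
  obtain d' where d': "d' > 0" "\<And>y z. norm (y - x) < d' \<Longrightarrow> norm (z - x) < d' \<Longrightarrow>
     norm (G y - G z - G' (y - z)) \<le> e / 2 * norm (y - z)"
    using sdiffD[OF assms(2) e] by metis
  show "\<exists>d>0. \<forall>y z. norm (y - x) < d \<longrightarrow> norm (z - x) < d \<longrightarrow>
      norm (F y + G y - (F z + G z) - (F' (y - z) + G' (y - z))) \<le> e * norm (y - z)"
  proof (intro exI[of _ "min d d'"] conjI allI impI)
    fix y z assume yz: "norm (y - x) < min d d'" "norm (z - x) < min d d'"
    have "F y + G y - (F z + G z) - (F' (y - z) + G' (y - z)) =
        (F y - F z - F' (y - z)) + (G y - G z - G' (y - z))" by simp
    also have "norm \<dots> \<le> e / 2 * norm (y - z) + e / 2 * norm (y - z)"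
      using yz by (intro norm_triangle_mono d d') auto
    finally show "norm (F y + G y - (F z + G z) - (F' (y - z) + G' (y - z))) \<le> e * norm (y - z)" by simp
  qed (use d d' in auto)
qed

lemma sdiff_linear_compose:
  assumes L: "bounded_linear L" and F: "sdiff F F' x"
  shows "sdiff (\<lambda>y. L (F y)) (\<lambda>y. L (F' y)) x"
  unfolding sdiff_def
proof (intro conjI allI impI)
  show "bounded_linear (\<lambda>y. L (F' y))"
    using F L by (auto simp: sdiff_def intro: bounded_linear_compose)
  fix e :: real assume e: "e > 0"
  obtain B where B: "B > 0" "\<And>y. norm (L y) \<le> norm y * B"
    using bounded_linear.pos_bounded[OF L] by auto
  obtain d where d: "d > 0" "\<And>y z. norm (y - x) < d \<Longrightarrow> norm (z - x) < d \<Longrightarrow>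
     norm (F y - F z - F' (y - z)) \<le> e / B * norm (y - z)"
    using sdiffD[OF F, of "e / B"] e B by (metis divide_pos_pos)
  show "\<exists>d>0. \<forall>y z. norm (y - x) < d \<longrightarrow> norm (z - x) < d \<longrightarrow>
      norm (L (F y) - L (F z) - L (F' (y - z))) \<le> e * norm (y - z)"
  proof (intro exI[of _ d] conjI allI impI d(1))
    fix y z assume yz: "norm (y - x) < d" "norm (z - x) < d"
    have "L (F y) - L (F z) - L (F' (y - z)) = L (F y - F z - F' (y - z))"
      by (simp add: linear_diff[OF bounded_linear.linear[OF L]])
    also have "norm \<dots> \<le> norm (F y - F z - F' (y - z)) * B" by (rule B)
    also have "\<dots> \<le> e / B * norm (y - z) * B"
      using B yz by (intro mult_right_mono d) auto
    finally show "norm (L (F y) - L (F z) - L (F' (y - z))) \<le> e * norm (y - z)" using B by simp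
  qed
qed

text \<open>The error consists of F(y) times the remainder of G, the remainder of F times G(z), and
  two mixed terms that contain an increment from the base point x; each of the four receives a
  quarter of e.\<close>

lemma sdiff_mult:
  fixes F G :: "'a::real_normed_vector \<Rightarrow> 'b::real_normed_algebra"
  assumes F: "sdiff F F' x" and G: "sdiff G G' x"
  shows "sdiff (\<lambda>y. F y * G y) (\<lambda>y. F x * G' y + F' y * G x) x"
  unfolding sdiff_def
proof (intro conjI allI impI)
  have bl: "bounded_linear F'" "bounded_linear G'" using F G by (auto simp: sdiff_def)
  show "bounded_linear (\<lambda>y. F x * G' y + F' y * G x)"
    by (intro bounded_linear_add bounded_linear_const_mult bounded_linear_mult_const bl)
  fix e :: real assume e: "e > 0"
  obtain K1 d1 where 1: "K1 > 0" "d1 > 0" "\<And>y z. norm (y - x) < d1 \<Longrightarrow> norm (z - x) < d1 \<Longrightarrow>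
     norm (F y - F z) \<le> K1 * norm (y - z)" using sdiff_lipschitz[OF F] by metis
  obtain K2 d2 where 2: "K2 > 0" "d2 > 0" "\<And>y z. norm (y - x) < d2 \<Longrightarrow> norm (z - x) < d2 \<Longrightarrow>
     norm (G y - G z) \<le> K2 * norm (y - z)" using sdiff_lipschitz[OF G] by metis
  obtain B1 where B1: "B1 > 0" "\<And>y. norm (F' y) \<le> norm y * B1"
    using bounded_linear.pos_bounded[OF bl(1)] by auto
  obtain B2 where B2: "B2 > 0" "\<And>y. norm (G' y) \<le> norm y * B2"
    using bounded_linear.pos_bounded[OF bl(2)] by auto
  \<comment> \<open>A common bound for both factors on balls of radius at most 1; the final 1 keeps
    it positive.\<close>
  define a where "a = norm (F x) + K1 + norm (G x) + K2 + 1"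
  have a: "a > 0" "norm (F x) + K1 \<le> a" "norm (G x) + K2 \<le> a"
    using 1 2 norm_ge_zero[of "F x"] norm_ge_zero[of "G x"] unfolding a_def by linarith+
  define e' where "e' = e / (4 * a)"
  have e': "e' > 0" using e a by (simp add: e'_def)
  obtain d3 where d3: "d3 > 0" "\<And>y z. norm (y - x) < d3 \<Longrightarrow> norm (z - x) < d3 \<Longrightarrow>
     norm (F y - F z - F' (y - z)) \<le> e' * norm (y - z)"
    using sdiffD[OF F e'] by metis
  obtain d4 where d4: "d4 > 0" "\<And>y z. norm (y - x) < d4 \<Longrightarrow> norm (z - x) < d4 \<Longrightarrow>
     norm (G y - G z - G' (y - z)) \<le> e' * norm (y - z)"
    using sdiffD[OF G e'] by metis
  \<comment> \<open>The last two entries make each mixed term at most e / 4 times the distance; the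
    entry 1 validates the bound \<open>a\<close> on the factors.\<close>
  define d where "d = min (min (min d1 d2) (min d3 d4)) (min 1 (min (e / (4 * (K1 * B2))) (e / (4 * (K2 * B1)))))"
  have d: "d > 0" "d \<le> d1" "d \<le> d2" "d \<le> d3" "d \<le> d4" "d \<le> 1" "d \<le> e / (4 * (K1 * B2))" "d \<le> e / (4 * (K2 * B1))"
    using 1 2 d3 d4 e B1 B2 unfolding d_def by auto
  have KB: "K1 * d * B2 \<le> e / 4" "K2 * d * B1 \<le> e / 4"
    using d(7,8) 1(1) 2(1) B1(1) B2(1) by (simp_all add: pos_le_divide_eq mult_ac)
  show "\<exists>d>0. \<forall>y z. norm (y - x) < d \<longrightarrow> norm (z - x) < d \<longrightarrow>
      norm (F y * G y - F z * G z - (F x * G' (y - z) + F' (y - z) * G x)) \<le> e * norm (y - z)"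
  proof (intro exI[of _ d] conjI allI impI d(1))
    fix y z assume yz: "norm (y - x) < d" "norm (z - x) < d"
    let ?n = "norm (y - z)"
    have Fyx: "norm (F y - F x) \<le> K1 * d"
      using 1(3)[of y x] yz d 1(1) 1(2) by (intro order_trans[OF 1(3)[of y x]] mult_left_mono) auto
    have Gzx: "norm (G z - G x) \<le> K2 * d"
      using yz d 2(1,2) by (intro order_trans[OF 2(3)[of z x]] mult_left_mono) auto
    have Fy: "norm (F y) \<le> a"
    proof -
      have "norm (F y) \<le> norm (F x) + norm (F y - F x)" by (rule norm_triangle_sub)
      moreover have "K1 * d \<le> K1" using 1(1) d(6) by simp
      ultimately show ?thesis using Fyx a by linarith
    qed
    have Gz: "norm (G z) \<le> a"
    proof -
      have "norm (G z) \<le> norm (G x) + norm (G z - G x)" by (rule norm_triangle_sub)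
      moreover have "K2 * d \<le> K2" using 2(1) d(6) by simp
      ultimately show ?thesis using Gzx a by linarith
    qed
    have t1: "norm (F y * (G y - G z - G' (y - z))) \<le> a * (e' * ?n)"
      using yz d a by (intro order_trans[OF norm_mult_ineq] mult_mono Fy d4) auto
    have t2: "norm ((F y - F x) * G' (y - z)) \<le> (K1 * d) * (?n * B2)"
      using 1(1) d(1) by (intro order_trans[OF norm_mult_ineq] mult_mono Fyx B2) auto
    have t3: "norm ((F y - F z - F' (y - z)) * G z) \<le> (e' * ?n) * a"
      using yz d e' by (intro order_trans[OF norm_mult_ineq] mult_mono Gz d3) auto
    have t4: "norm (F' (y - z) * (G z - G x)) \<le> (?n * B1) * (K2 * d)"
      using B1(1) by (intro order_trans[OF norm_mult_ineq] mult_mono Gzx B1) auto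
    have eq: "F y * G y - F z * G z - (F x * G' (y - z) + F' (y - z) * G x) =
        (F y * (G y - G z - G' (y - z)) + (F y - F x) * G' (y - z)) +
        ((F y - F z - F' (y - z)) * G z + F' (y - z) * (G z - G x))"
      by (simp add: algebra_simps)
    have "norm (F y * G y - F z * G z - (F x * G' (y - z) + F' (y - z) * G x)) \<le>
        (a * (e' * ?n) + (K1 * d) * (?n * B2)) + ((e' * ?n) * a + (?n * B1) * (K2 * d))"
      unfolding eq by (intro norm_triangle_mono t1 t2 t3 t4)
    also have "\<dots> = (2 * (a * e') + K1 * d * B2 + K2 * d * B1) * ?n" by (simp add: algebra_simps)
    also have "\<dots> \<le> e * ?n"
    proof (intro mult_right_mono)
      have "a * e' = e / 4" using a(1) by (simp add: e'_def)
      thus "2 * (a * e') + K1 * d * B2 + K2 * d * B1 \<le> e" using KB by linarith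
    qed auto
    finally show "norm (F y * G y - F z * G z - (F x * G' (y - z) + F' (y - z) * G x)) \<le> e * ?n" .
  qed
qed

lemma norm_sum_component_le:
  fixes h :: "'n::finite \<Rightarrow> 'a::real_normed_vector" and \<alpha> :: "real ^ 'n"
  shows "norm (\<Sum>j\<in>UNIV. (\<alpha> $ j) *\<^sub>R h j) \<le> norm \<alpha> * (\<Sum>j\<in>UNIV. norm (h j))"
  unfolding sum_distrib_left
  by (rule order_trans[OF norm_sum sum_mono]) (simp add: component_le_norm_cart mult_right_mono)

lemma bounded_linear_sum_component:
  fixes h :: "'n::finite \<Rightarrow> 'a::real_normed_vector"
  shows "bounded_linear (\<lambda>\<alpha> :: real ^ 'n. \<Sum>j\<in>UNIV. (\<alpha> $ j) *\<^sub>R h j)"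
  by (intro bounded_linear_sum bounded_linear_compose[OF bounded_linear_scaleR_left bounded_linear_vec_nth])

text \<open>The identity at 0 is a separate assumption because the filter of small positive steps
  does not see the point 0, where the Jacobian is taken.\<close>

locale implicit_family =
  fixes Inv :: "'a::real_normed_vector \<Rightarrow> real ^ 'n::finite" and Inv' :: "'a \<Rightarrow> real ^ 'n"
    and P :: "real \<Rightarrow> 'a" and g :: "'n \<Rightarrow> real \<Rightarrow> 'a" and G :: "real \<Rightarrow> real ^ 'n \<Rightarrow> real ^ 'n"
    and c :: "real ^ 'n" and F :: "real filter"
  assumes Inv: "sdiff Inv Inv' (P 0)"
    and P: "(P \<longlongrightarrow> P 0) F" and g: "\<And>j. (g j \<longlongrightarrow> g j 0) F"
    and G: "\<forall>\<^sub>F \<tau> in F. \<forall>\<alpha>. G \<tau> \<alpha> = Inv (P \<tau> + (\<Sum>j\<in>UNIV. (\<alpha> $ j) *\<^sub>R g j \<tau>)) - c"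
    and G0: "\<And>\<alpha>. G 0 \<alpha> = Inv (P 0 + (\<Sum>j\<in>UNIV. (\<alpha> $ j) *\<^sub>R g j 0)) - c"
begin

definition L :: "real ^ 'n \<Rightarrow> real ^ 'n" where
  "L \<alpha> = Inv' (\<Sum>j\<in>UNIV. (\<alpha> $ j) *\<^sub>R g j 0)"

lemma bl: "bounded_linear Inv'" using Inv by (simp add: sdiff_def)

lemma bounded_linear_L: "bounded_linear L"
  unfolding L_def by (rule bounded_linear_compose[OF bl bounded_linear_sum_component])

lemma strict:
  assumes e: "e > 0"
  shows "\<exists>\<rho>>0. (\<forall>\<^sub>F \<tau> in F. \<forall>\<alpha>\<in>cball 0 \<rho>. \<forall>\<gamma>\<in>cball 0 \<rho>.
       norm (G \<tau> \<alpha> - G \<tau> \<gamma> - L (\<alpha> - \<gamma>)) \<le> e * norm (\<alpha> - \<gamma>)) \<and>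
     (\<forall>\<alpha>\<in>cball 0 \<rho>. \<forall>\<gamma>\<in>cball 0 \<rho>. norm (G 0 \<alpha> - G 0 \<gamma> - L (\<alpha> - \<gamma>)) \<le> e * norm (\<alpha> - \<gamma>))"
proof -
  \<comment> \<open>The extra 1 leaves room for the directions along the filter, whose norms only
    converge to those at 0.\<close>
  define K where "K = (\<Sum>j\<in>UNIV. norm (g j 0)) + 1"
  have K: "K > 0" unfolding K_def by (simp add: add_nonneg_pos sum_nonneg)
  obtain B where B: "B > 0" "\<And>y. norm (Inv' y) \<le> norm y * B"
    using bounded_linear.pos_bounded[OF bl] by auto
  define e' where "e' = e / (2 * K)"
  have e': "e' > 0" using e K by (simp add: e'_def)
  obtain d where d: "d > 0" "\<And>y z. norm (y - P 0) < d \<Longrightarrow> norm (z - P 0) < d \<Longrightarrow>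
     norm (Inv y - Inv z - Inv' (y - z)) \<le> e' * norm (y - z)"
    using sdiffD[OF Inv e'] by metis
  \<comment> \<open>For coefficients of norm at most rho the combination of directions is shorter
    than d / 2; the other half of d is left to the distance of the base point from P(0).\<close>
  define \<rho> where "\<rho> = d / (2 * K) / 2"
  have \<rho>: "\<rho> > 0" "\<rho> * K < d / 2" using d K by (simp_all add: \<rho>_def)
  \<comment> \<open>Stated for an arbitrary base point and arbitrary directions, because it is
    applied both at 0 and along the filter.\<close>
  have key: "norm (Inv (p + (\<Sum>j\<in>UNIV. (\<alpha> $ j) *\<^sub>R h j)) - Inv (p + (\<Sum>j\<in>UNIV. (\<gamma> $ j) *\<^sub>R h j)) - L (\<alpha> - \<gamma>))
      \<le> e * norm (\<alpha> - \<gamma>)"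
    if p: "norm (p - P 0) < d / 2" and h: "(\<Sum>j\<in>UNIV. norm (h j)) \<le> K"
      and hg: "(\<Sum>j\<in>UNIV. norm (h j - g j 0)) * B \<le> e / 2" and \<alpha>: "\<alpha> \<in> cball 0 \<rho>" "\<gamma> \<in> cball 0 \<rho>" for p h \<alpha> \<gamma>
  proof -
    let ?S = "\<lambda>\<alpha>. \<Sum>j\<in>UNIV. (\<alpha> $ j) *\<^sub>R h j"
    have near: "norm (p + ?S \<beta> - P 0) < d" if "\<beta> \<in> cball 0 \<rho>" for \<beta>
    proof -
      have "norm (?S \<beta>) \<le> norm \<beta> * (\<Sum>j\<in>UNIV. norm (h j))" by (rule norm_sum_component_le)
      also have "\<dots> \<le> \<rho> * K" using that h \<rho>(1) by (intro mult_mono) (auto simp: sum_nonneg)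
      finally have "norm (?S \<beta>) < d / 2" using \<rho>(2) by linarith
      moreover have "norm (p + ?S \<beta> - P 0) \<le> norm (p - P 0) + norm (?S \<beta>)"
        using norm_triangle_ineq[of "p - P 0" "?S \<beta>"] by (simp add: algebra_simps)
      ultimately show ?thesis using p by linarith
    qed
    have lin: "?S \<alpha> - ?S \<gamma> = ?S (\<alpha> - \<gamma>)" by (simp add: scaleR_diff_left sum_subtractf)
    have 1: "norm (Inv (p + ?S \<alpha>) - Inv (p + ?S \<gamma>) - Inv' (?S (\<alpha> - \<gamma>))) \<le> e' * norm (?S (\<alpha> - \<gamma>))"
      using d(2)[OF near[OF \<alpha>(1)] near[OF \<alpha>(2)]] by (simp add: lin)
    also have "\<dots> \<le> e' * (norm (\<alpha> - \<gamma>) * K)"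
      using e' h by (intro mult_left_mono order_trans[OF norm_sum_component_le]) auto
    also have "\<dots> = e / 2 * norm (\<alpha> - \<gamma>)" using K by (simp add: e'_def)
    finally have 1: "norm (Inv (p + ?S \<alpha>) - Inv (p + ?S \<gamma>) - Inv' (?S (\<alpha> - \<gamma>))) \<le> e / 2 * norm (\<alpha> - \<gamma>)" .
    have "Inv' (?S (\<alpha> - \<gamma>)) - L (\<alpha> - \<gamma>) = Inv' (\<Sum>j\<in>UNIV. ((\<alpha> - \<gamma>) $ j) *\<^sub>R (h j - g j 0))"
      unfolding L_def linear_diff[OF bounded_linear.linear[OF bl], symmetric]
      by (simp add: scaleR_diff_right sum_subtractf)
    also have "norm \<dots> \<le> norm (\<Sum>j\<in>UNIV. ((\<alpha> - \<gamma>) $ j) *\<^sub>R (h j - g j 0)) * B" by (rule B)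
    also have "\<dots> \<le> (norm (\<alpha> - \<gamma>) * (\<Sum>j\<in>UNIV. norm (h j - g j 0))) * B"
      using B by (intro mult_right_mono norm_sum_component_le) auto
    also have "\<dots> \<le> norm (\<alpha> - \<gamma>) * (e / 2)"
      using hg by (simp only: mult.assoc) (intro mult_left_mono, auto)
    finally have 2: "norm (Inv' (?S (\<alpha> - \<gamma>)) - L (\<alpha> - \<gamma>)) \<le> e / 2 * norm (\<alpha> - \<gamma>)" by (simp add: mult.commute)
    show ?thesis
      using norm_diff_triangle_le[OF 1 2] by simp
  qed
  have p0: "norm (P 0 - P 0) < d / 2" using d by simp
  have h0: "(\<Sum>j\<in>UNIV. norm (g j 0)) \<le> K" by (simp add: K_def)
  have hg0: "(\<Sum>j\<in>UNIV. norm (g j 0 - g j 0)) * B \<le> e / 2" using e by simp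
  show ?thesis
  proof (intro exI[of _ \<rho>] conjI \<rho>(1))
    show "\<forall>\<alpha>\<in>cball 0 \<rho>. \<forall>\<gamma>\<in>cball 0 \<rho>. norm (G 0 \<alpha> - G 0 \<gamma> - L (\<alpha> - \<gamma>)) \<le> e * norm (\<alpha> - \<gamma>)"
      using key[OF p0 h0 hg0] by (simp add: G0)
    have "((\<lambda>\<tau>. norm (P \<tau> - P 0)) \<longlongrightarrow> 0) F" using P by (simp add: LIM_zero tendsto_norm_zero)
    hence 1: "\<forall>\<^sub>F \<tau> in F. norm (P \<tau> - P 0) < d / 2" by (rule order_tendstoD) (use d in simp)
    have "((\<lambda>\<tau>. \<Sum>j\<in>UNIV. norm (g j \<tau>)) \<longlongrightarrow> (\<Sum>j\<in>UNIV. norm (g j 0))) F"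
      by (intro tendsto_sum tendsto_norm g)
    hence 2: "\<forall>\<^sub>F \<tau> in F. (\<Sum>j\<in>UNIV. norm (g j \<tau>)) < K" by (rule order_tendstoD) (simp add: K_def)
    have "((\<lambda>\<tau>. (\<Sum>j\<in>UNIV. norm (g j \<tau> - g j 0)) * B) \<longlongrightarrow> (\<Sum>j\<in>UNIV. norm (g j 0 - g j 0)) * B) F"
      by (intro tendsto_intros g)
    hence 3: "\<forall>\<^sub>F \<tau> in F. (\<Sum>j\<in>UNIV. norm (g j \<tau> - g j 0)) * B < e / 2"
      by (rule order_tendstoD) (use e in simp)
    show "\<forall>\<^sub>F \<tau> in F. \<forall>\<alpha>\<in>cball 0 \<rho>. \<forall>\<gamma>\<in>cball 0 \<rho>. norm (G \<tau> \<alpha> - G \<tau> \<gamma> - L (\<alpha> - \<gamma>)) \<le> e * norm (\<alpha> - \<gamma>)"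
      using 1 2 3 G
    proof eventually_elim
      case (elim \<tau>)
      show ?case
        using key[OF elim(1) less_imp_le[OF elim(2)] less_imp_le[OF elim(3)]] elim(4) by simp
    qed
  qed
qed

lemma G_has_derivative: "(G 0 has_derivative L) (at 0)"
  unfolding has_derivative_at_alt
proof (intro conjI allI impI bounded_linear_L)
  fix e :: real assume "e > 0"
  then obtain \<rho> where "\<rho> > 0" "\<forall>\<alpha>\<in>cball 0 \<rho>. \<forall>\<gamma>\<in>cball 0 \<rho>.
     norm (G 0 \<alpha> - G 0 \<gamma> - L (\<alpha> - \<gamma>)) \<le> e * norm (\<alpha> - \<gamma>)"
    using strict by blast
  moreover from this have "norm (G 0 y - G 0 0 - L (y - 0)) \<le> e * norm (y - 0)" if "norm (y - 0) < \<rho>" for y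
    using that by (metis dist_0_norm dist_self diff_zero less_imp_le mem_cball)
  ultimately show "\<exists>d>0. \<forall>y. norm (y - 0) < d \<longrightarrow> norm (G 0 y - G 0 0 - L (y - 0)) \<le> e * norm (y - 0)"
    by blast
qed

text \<open>On the ball, G differs from the invertible map L by a Lipschitz error of at most half
  the lower bound B of L. So alpha - R(G alpha), with R the inverse of L, contracts by 1/2, which
  gives a zero; and |G alpha - G gamma| >= B/2 |alpha - gamma|, which gives uniqueness and, later,
  the rate.\<close>

lemma solution_branch:
  assumes det: "det (jacobian (G 0) (at 0)) \<noteq> 0" and small: "((\<lambda>\<tau>. G \<tau> 0) \<longlongrightarrow> 0) F"
  obtains \<rho> K where "\<rho> > 0" "K > 0"
    "\<forall>\<^sub>F \<tau> in F. \<exists>\<alpha>\<in>ball 0 \<rho>. G \<tau> \<alpha> = 0"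
    "\<forall>\<^sub>F \<tau> in F. \<forall>\<alpha>\<in>ball 0 \<rho>. \<forall>\<gamma>\<in>ball 0 \<rho>. norm (\<alpha> - \<gamma>) \<le> K * norm (G \<tau> \<alpha> - G \<tau> \<gamma>)"
proof -
  have "frechet_derivative (G 0) (at 0) = L"
    using G_has_derivative frechet_derivative_at by metis
  hence det: "det (matrix L) \<noteq> 0" using det by (simp add: jacobian_def)
  have lin: "linear L" using bounded_linear_L by (rule bounded_linear.linear)
  have inj: "inj L" using det lin by (simp add: det_nz_iff_inj)
  obtain B where B: "B > 0" "\<And>x. B * norm x \<le> norm (L x)"
    using linear_inj_bounded_below_pos[OF lin inj] by blast
  have surj: "surj L" by (rule linear_inj_imp_surj[OF lin inj])
  define R where "R = inv L"
  have LR: "L (R y) = y" for y unfolding R_def by (rule surj_f_inv_f[OF surj])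
  have Rle: "norm (R y) \<le> norm y / B" for y
    using B(2)[of "R y"] B(1) by (simp add: LR pos_le_divide_eq mult.commute)
  have RL: "R (L x) = x" for x unfolding R_def by (rule inv_f_f[OF inj])
  have linR: "linear R"
  proof (rule linearI)
    show "R (x + y) = R x + R y" for x y
      by (rule injD[OF inj]) (simp add: LR linear_add[OF lin])
    show "R (c *\<^sub>R x) = c *\<^sub>R R x" for c x
      by (rule injD[OF inj]) (simp add: LR linear_cmul[OF lin])
  qed
  have B2: "B / 2 > 0" using B by simp
  obtain \<rho> where \<rho>: "\<rho> > 0" "\<forall>\<^sub>F \<tau> in F. \<forall>\<alpha>\<in>cball 0 \<rho>. \<forall>\<gamma>\<in>cball 0 \<rho>.
     norm (G \<tau> \<alpha> - G \<tau> \<gamma> - L (\<alpha> - \<gamma>)) \<le> B / 2 * norm (\<alpha> - \<gamma>)"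
    using strict[OF B2] by blast
  have "((\<lambda>\<tau>. norm (G \<tau> 0)) \<longlongrightarrow> 0) F" using small by (rule tendsto_norm_zero)
  \<comment> \<open>This threshold makes |T 0| at most rho / 4. With the factor 1/2 on the closed
    ball of radius rho / 2 it keeps T inside that ball, which lies in the open ball of radius
    rho.\<close>
  hence sm: "\<forall>\<^sub>F \<tau> in F. norm (G \<tau> 0) < B * \<rho> / 4"
    by (rule order_tendstoD) (use B \<rho> in simp)
  show ?thesis
  proof (rule that[OF \<rho>(1), of "2 / B"])
    show "\<forall>\<^sub>F \<tau> in F. \<forall>\<alpha>\<in>ball 0 \<rho>. \<forall>\<gamma>\<in>ball 0 \<rho>. norm (\<alpha> - \<gamma>) \<le> 2 / B * norm (G \<tau> \<alpha> - G \<tau> \<gamma>)"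
      using \<rho>(2)
    proof eventually_elim
      case (elim \<tau>)
      show ?case
      proof (intro ballI)
        fix \<alpha> \<gamma> :: "real ^ 'n" assume ag: "\<alpha> \<in> ball 0 \<rho>" "\<gamma> \<in> ball 0 \<rho>"
        have "norm (G \<tau> \<alpha> - G \<tau> \<gamma> - L (\<alpha> - \<gamma>)) \<le> B / 2 * norm (\<alpha> - \<gamma>)"
          using elim ag ball_subset_cball by blast
        moreover have "norm (L (\<alpha> - \<gamma>)) \<le> norm (G \<tau> \<alpha> - G \<tau> \<gamma>) + norm (G \<tau> \<alpha> - G \<tau> \<gamma> - L (\<alpha> - \<gamma>))"
          using norm_triangle_ineq4[of "G \<tau> \<alpha> - G \<tau> \<gamma>" "G \<tau> \<alpha> - G \<tau> \<gamma> - L (\<alpha> - \<gamma>)"] by simp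
        ultimately have "B / 2 * norm (\<alpha> - \<gamma>) \<le> norm (G \<tau> \<alpha> - G \<tau> \<gamma>)"
          using B(2)[of "\<alpha> - \<gamma>"] by linarith
        thus "norm (\<alpha> - \<gamma>) \<le> 2 / B * norm (G \<tau> \<alpha> - G \<tau> \<gamma>)"
          using B(1) by (simp add: field_simps)
      qed
    qed
    show "\<forall>\<^sub>F \<tau> in F. \<exists>\<alpha>\<in>ball 0 \<rho>. G \<tau> \<alpha> = 0"
      using \<rho>(2) sm
    proof eventually_elim
      case (elim \<tau>)
      let ?S = "cball (0 :: real ^ 'n) (\<rho> / 2)"
      define T where "T \<alpha> = \<alpha> - R (G \<tau> \<alpha>)" for \<alpha>
      have Tlip: "norm (T \<alpha> - T \<gamma>) \<le> 1 / 2 * norm (\<alpha> - \<gamma>)" if "\<alpha> \<in> ?S" "\<gamma> \<in> ?S" for \<alpha> \<gamma>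
      proof -
        have "T \<alpha> - T \<gamma> = - R (G \<tau> \<alpha> - G \<tau> \<gamma> - L (\<alpha> - \<gamma>))"
          by (simp add: T_def linear_diff[OF linR] RL)
        hence "norm (T \<alpha> - T \<gamma>) \<le> norm (G \<tau> \<alpha> - G \<tau> \<gamma> - L (\<alpha> - \<gamma>)) / B"
          using Rle by (metis norm_minus_cancel)
        also have "\<dots> \<le> (B / 2 * norm (\<alpha> - \<gamma>)) / B"
          using elim(1) that B(1) \<rho>(1) by (intro divide_right_mono) auto
        finally show ?thesis using B(1) by simp
      qed
      have "\<exists>!x\<in>?S. T x = x"
      proof (rule Banach_fix[where c="1/2"])
        show "complete ?S" by (intro compact_imp_complete compact_cball)
        show "T ` ?S \<subseteq> ?S"
        proof (intro image_subsetI)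
          fix \<alpha> assume \<alpha>: "\<alpha> \<in> ?S"
          have "norm (T 0) \<le> norm (G \<tau> 0) / B" using Rle[of "G \<tau> 0"] by (simp add: T_def)
          also have "\<dots> \<le> (B * \<rho> / 4) / B" using elim(2) B(1) by (intro divide_right_mono) auto
          finally have "norm (T 0) \<le> \<rho> / 4" using B(1) by simp
          moreover have "norm (T \<alpha> - T 0) \<le> 1 / 2 * norm \<alpha>" using Tlip[OF \<alpha>, of 0] \<rho>(1) by simp
          moreover have "norm (T \<alpha>) \<le> norm (T 0) + norm (T \<alpha> - T 0)" by (rule norm_triangle_sub)
          ultimately show "T \<alpha> \<in> ?S" using \<alpha> by simp
        qed
        show "dist (T x) (T y) \<le> 1 / 2 * dist x y" if "x \<in> ?S" "y \<in> ?S" for x y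
          using Tlip[OF that] by (simp add: dist_norm)
      qed (use \<rho>(1) in auto)
      then obtain \<alpha> where \<alpha>: "\<alpha> \<in> ?S" "T \<alpha> = \<alpha>" by blast
      have "R (G \<tau> \<alpha>) = 0" using \<alpha>(2) by (simp add: T_def)
      hence "G \<tau> \<alpha> = 0" using LR[of "G \<tau> \<alpha>"] by (simp add: linear_0[OF lin])
      moreover have "\<alpha> \<in> ball 0 \<rho>" using \<alpha>(1) \<rho>(1) by simp
      ultimately show ?case by blast
    qed
  qed (use B in simp)
qed

end

section \<open>The invariants on the Wiener algebra\<close>

lemma sdiff_fst: "sdiff fst fst x" and sdiff_snd: "sdiff snd snd x"
  by (rule sdiff_linear, rule bounded_linear_fst, rule sdiff_linear, rule bounded_linear_snd)

text \<open>Hiding the derivative lets introduction rules alone treat the polynomial invariants; the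
  derivative itself is never written out.\<close>

definition strictly_differentiable :: "('a::real_normed_vector \<Rightarrow> 'b::real_normed_vector) \<Rightarrow> 'a \<Rightarrow> bool" where
  "strictly_differentiable F x \<longleftrightarrow> (\<exists>F'. sdiff F F' x)"

named_theorems sdiff_intros

lemma strictly_differentiable_intros [sdiff_intros]:
  shows "strictly_differentiable (\<lambda>_. c) x"
    and "strictly_differentiable F x \<Longrightarrow> strictly_differentiable G x \<Longrightarrow> strictly_differentiable (\<lambda>y. F y + G y) x"
  unfolding strictly_differentiable_def by (blast intro: sdiff_const sdiff_add)+

lemma strictly_differentiable_mult [sdiff_intros]:
  fixes F G :: "'a::real_normed_vector \<Rightarrow> 'b::real_normed_algebra"
  shows "strictly_differentiable F x \<Longrightarrow> strictly_differentiable G x \<Longrightarrow> strictly_differentiable (\<lambda>y. F y * G y) x"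
  unfolding strictly_differentiable_def by (blast intro: sdiff_mult)

lemma strictly_differentiable_linear:
  "bounded_linear L \<Longrightarrow> strictly_differentiable F x \<Longrightarrow> strictly_differentiable (\<lambda>y. L (F y)) x"
  unfolding strictly_differentiable_def by (blast intro: sdiff_linear_compose)

lemma strictly_differentiable_fst_snd [sdiff_intros]:
  "strictly_differentiable (\<lambda>y. fst y) x" "strictly_differentiable (\<lambda>y. snd y) x"
  unfolding strictly_differentiable_def using sdiff_fst sdiff_snd by blast+

lemma strictly_differentiable_diff [sdiff_intros]:
  assumes "strictly_differentiable F x" "strictly_differentiable G x"
  shows "strictly_differentiable (\<lambda>y. F y - G y) x"
proof -
  have "strictly_differentiable (\<lambda>y. F y + - G y) x"
    by (intro sdiff_intros assms strictly_differentiable_linear[OF bounded_linear_minus[OF bounded_linear_ident]])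
  thus ?thesis by simp
qed

lemmas [sdiff_intros] = strictly_differentiable_linear[OF bounded_linear_cnjw]

context torus
begin

text \<open>The x-derivative is a second, independent argument: on pairs the invariants are built
  from bounded operations, although \<open>D\<close> is unbounded. The prefactors undo the scaling
  of the densities by 8 and 2 and turn a mean into an integral.\<close>

definition Inv :: "wiener \<times> wiener \<Rightarrow> real ^ 3" where
  "Inv p = vector [(b - a) / 8 * Re (fc (energy_density (fst p) (snd p)) 0),
     (b - a) * Re (fc (mass_density (fst p)) 0), (b - a) / 2 * Re (fc (momentum_density (fst p) (snd p)) 0)]"

lemma integral_Re_ev: "integral {a..b} (\<lambda>x. Re (ev a b f x)) = (b - a) * Re (fc f 0)"
proof -
  have "integral {a..b} (Re \<circ> ev a b f) = Re (integral {a..b} (ev a b f))"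
    by (intro integral_linear integrable_continuous_interval continuous_on_ev bounded_linear_Re)
  thus ?thesis using integral_ev[OF ab, of f] by (simp add: o_def)
qed

lemma ev_numeral: "ev a b (numeral n) x = numeral n"
  by (simp only: numeral_eq_cst ev_cst)

lemma cmod_power4: "complex_of_real ((cmod z) ^ 4) = z * cnj z * (z * cnj z)"
proof -
  have "(cmod z) ^ 4 = (cmod z)\<^sup>2 * (cmod z)\<^sup>2" by (simp flip: power_add)
  thus ?thesis by (simp only: of_real_mult complex_norm_square)
qed

lemma cmod_power6: "complex_of_real ((cmod z) ^ 6) = z * cnj z * (z * cnj z * (z * cnj z))"
proof -
  have "(cmod z) ^ 6 = (cmod z)\<^sup>2 * ((cmod z)\<^sup>2 * (cmod z)\<^sup>2)" by (simp flip: power_add)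
  thus ?thesis by (simp only: of_real_mult complex_norm_square)
qed

lemma energy_ev:
  assumes "f \<in> W 2"
  shows "energy a b (ev a b f) = (b - a) / 8 * Re (fc (energy_density f (D f)) 0)"
proof -
  have "(cmod (dx (ev a b f) x))\<^sup>2
       - 3/2 * Im (complex_of_real ((cmod (ev a b f x))\<^sup>2) * ev a b f x * cnj (dx (ev a b f) x))
       + 1/2 * (cmod (ev a b f x)) ^ 6 = Re (ev a b (energy_density f (D f)) x) * (1 / 8)" for x
  proof -
    define z y where "z = ev a b f x" and "y = ev a b (D f) x"
    have y: "dx (ev a b f) x = y" by (simp add: dx_ev assms y_def)
    let ?h = "z * z * (cnj z * cnj y)"
    have e: "ev a b (energy_density f (D f)) x =
        8 * (y * cnj y) + \<i> * (6 * ?h - 6 * cnj ?h) + 4 * (z * z * z * (cnj z * cnj z * cnj z))"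
      by (simp add: energy_density_def ev_add ev_minus ev_mult ev_cnjw ev_cst ev_numeral z_def y_def mult_ac)
    have 3: "6 * h - 6 * cnj h = of_real (12 * Im h) * \<i>" for h
      by (simp add: complex_eq_iff)
    have 4: "z * z * z * (cnj z * cnj z * cnj z) = of_real ((cmod z) ^ 6)"
      by (subst cmod_power6) (simp add: mult_ac)
    have 5: "y * cnj y = of_real ((cmod y)\<^sup>2)" by (rule complex_norm_square[symmetric])
    have "Re (8 * of_real p + \<i> * (of_real q * \<i>) + 4 * of_real r) = 8 * p - q + 4 * r" for p q r :: real
      by simp
    hence 1: "Re (ev a b (energy_density f (D f)) x) = 8 * (cmod y)\<^sup>2 - 12 * Im ?h + 4 * (cmod z) ^ 6"
      unfolding e 3 4 5 by blast
    have 2: "complex_of_real ((cmod z)\<^sup>2) * z * cnj y = ?h"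
      by (simp only: complex_norm_square) (simp add: mult_ac)
    have "p - 3/2 * q + 1/2 * r = (8 * p - 12 * q + 4 * r) * (1 / 8)" for p q r :: real by simp
    thus ?thesis unfolding 1 unfolding z_def[symmetric] y 2 .
  qed
  hence "energy a b (ev a b f) = integral {a..b} (\<lambda>x. Re (ev a b (energy_density f (D f)) x) * (1 / 8))"
    by (simp only: energy_def)
  thus ?thesis by (simp add: integral_Re_ev)
qed

lemma momentum_ev:
  assumes "f \<in> W 2"
  shows "momentum a b (ev a b f) = (b - a) / 2 * Re (fc (momentum_density f (D f)) 0)"
proof -
  have "Im (cnj (ev a b f x) * dx (ev a b f) x) + 1/2 * (cmod (ev a b f x)) ^ 4
      = Re (ev a b (momentum_density f (D f)) x) * (1 / 2)" for x
  proof -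
    define z y where "z = ev a b f x" and "y = ev a b (D f) x"
    have y: "dx (ev a b f) x = y" by (simp add: dx_ev assms y_def)
    have e: "ev a b (momentum_density f (D f)) x = \<i> * (z * cnj y - y * cnj z) + z * z * (cnj z * cnj z)"
      by (simp add: momentum_density_def ev_add ev_minus ev_mult ev_cnjw ev_cst z_def y_def)
    have 3: "z * cnj y - y * cnj z = of_real (- 2 * Im (cnj z * y)) * \<i>"
      by (simp add: complex_eq_iff algebra_simps)
    have 4: "z * z * (cnj z * cnj z) = of_real ((cmod z) ^ 4)" by (subst cmod_power4) (simp add: mult_ac)
    have "Re (\<i> * (of_real (- 2 * p) * \<i>) + of_real q) = 2 * p + q" for p q :: real
      by simp
    hence 1: "Re (ev a b (momentum_density f (D f)) x) = 2 * Im (cnj z * y) + (cmod z) ^ 4"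
      unfolding e 3 4 by blast
    show ?thesis unfolding 1 unfolding z_def[symmetric] y by simp
  qed
  hence "momentum a b (ev a b f) = integral {a..b} (\<lambda>x. Re (ev a b (momentum_density f (D f)) x) * (1 / 2))"
    by (simp only: momentum_def)
  thus ?thesis by (simp add: integral_Re_ev)
qed

lemma mass_ev: "mass a b (ev a b f) = (b - a) * Re (fc (mass_density f) 0)"
proof -
  have "(cmod (ev a b f x))\<^sup>2 = Re (ev a b (mass_density f) x)" for x
    by (simp add: mass_density_def ev_mult ev_cnjw flip: complex_norm_square)
  thus ?thesis by (simp add: mass_def integral_Re_ev)
qed

lemma invariants_ev: "f \<in> W 2 \<Longrightarrow> invariants a b (ev a b f) = Inv (f, D f)"
  by (simp add: invariants_def Inv_def energy_ev mass_ev momentum_ev)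

lemma sdiff_Inv: "strictly_differentiable Inv p"
proof -
  have vec: "(vector [x, y, z] :: real ^ 3) = x *\<^sub>R axis 1 1 + y *\<^sub>R axis 2 1 + z *\<^sub>R axis 3 1" for x y z
    by (simp add: vec_eq_iff forall_3 axis_def)
  have bl: "bounded_linear (\<lambda>f. (r * Re (fc f 0)) *\<^sub>R v)" for r :: real and v :: "real ^ 3"
    by (intro bounded_linear_compose[OF bounded_linear_scaleR_left]
        bounded_linear_const_mult bounded_linear_compose[OF bounded_linear_Re bounded_linear_fc])
  have "strictly_differentiable (\<lambda>p. ((b - a) / 8 * Re (fc (energy_density (fst p) (snd p)) 0)) *\<^sub>R axis 1 1
     + ((b - a) * Re (fc (mass_density (fst p)) 0)) *\<^sub>R axis 2 1
     + ((b - a) / 2 * Re (fc (momentum_density (fst p) (snd p)) 0)) *\<^sub>R (axis 3 1 :: real ^ 3)) p"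
    unfolding energy_density_def mass_density_def momentum_density_def
    by (intro strictly_differentiable_intros(2) strictly_differentiable_linear[OF bl])
       (intro sdiff_intros)+
  thus ?thesis by (simp add: Inv_def[abs_def] vec)
qed

section \<open>The method in the Wiener algebra\<close>

text \<open>The stage of the method is exp(c_i tau L) applied to this one. The factor exp((c_i -
  c_j) tau L) splits accordingly, which turns a Lawson sweep into a classical one.\<close>

primrec stage_w :: "nat \<Rightarrow> (nat \<Rightarrow> nat \<Rightarrow> real) \<Rightarrow> wiener \<Rightarrow> nat \<Rightarrow> nat \<Rightarrow> real \<Rightarrow> wiener" where
  "stage_w s A u 0 i \<tau> = u"
| "stage_w s A u (Suc l) i \<tau> = u + \<tau> *\<^sub>R (\<Sum>j<s. A i j *\<^sub>R
     eL (- rk_node s A j * \<tau>) (Nw (eL (rk_node s A j * \<tau>) (stage_w s A u l j \<tau>))))"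

lemma expd_stage_w:
  assumes "u \<in> W (m + l * (4 * n + 1))"
  shows "expd n m (stage_w s A u l i) (stage_fps A s u l i)"
  using assms
proof (induction l arbitrary: m i)
  case 0
  have "stage_w s A u 0 i = (\<lambda>_. u)" by (rule ext) simp
  thus ?case using 0 expd_const[of u m n] by simp
next
  case (Suc l)
  have u: "u \<in> W m" using Suc.prems by (rule W_mono) simp
  have F: "expd n m (\<lambda>\<tau>. eL (- rk_node s A j * \<tau>) (Nw (eL (rk_node s A j * \<tau>) (stage_w s A u l j \<tau>))))
      (Fs (rk_node s A j) (stage_fps A s u l j))" for j
    by (rule expd_F, rule Suc.IH) (use Suc.prems in \<open>simp add: algebra_simps\<close>)
  have "stage_w s A u (Suc l) i = (\<lambda>\<tau>. u + \<tau> *\<^sub>R (\<Sum>j<s. A i j *\<^sub>R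
      eL (- rk_node s A j * \<tau>) (Nw (eL (rk_node s A j * \<tau>) (stage_w s A u l j \<tau>)))))"
    by (rule ext) simp
  thus ?case
    unfolding stage_fps.simps
    by (simp only:) (intro expd_add expd_const u expd_times_step expd_sum expd_scaleR F)
qed

definition num_w :: "nat \<Rightarrow> (nat \<Rightarrow> nat \<Rightarrow> real) \<Rightarrow> (nat \<Rightarrow> real) \<Rightarrow> nat \<Rightarrow> wiener \<Rightarrow> real \<Rightarrow> wiener" where
  "num_w s A w M u \<tau> = u + \<tau> *\<^sub>R (\<Sum>i<s. w i *\<^sub>R
     eL (- rk_node s A i * \<tau>) (Nw (eL (rk_node s A i * \<tau>) (stage_w s A u M i \<tau>))))"

lemma expd_num_w:
  assumes "u \<in> W (m + Suc M * (4 * n + 1))"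
  shows "expd n m (num_w s A w M u) (fps_const u +
     fps_X * (\<Sum>i<s. fps_map (\<lambda>x. w i *\<^sub>R x) (Fs (rk_node s A i) (stage_fps A s u M i))))"
proof -
  have u: "u \<in> W m" using assms by (rule W_mono) simp
  have F: "expd n m (\<lambda>\<tau>. eL (- rk_node s A j * \<tau>) (Nw (eL (rk_node s A j * \<tau>) (stage_w s A u M j \<tau>))))
      (Fs (rk_node s A j) (stage_fps A s u M j))" for j
    by (rule expd_F, rule expd_stage_w) (use assms in \<open>simp add: algebra_simps\<close>)
  show ?thesis
    unfolding num_w_def[abs_def]
    by (intro expd_add expd_const u expd_times_step expd_sum expd_scaleR F)
qed

text \<open>The step factor shifts degrees: coefficient q + 1 of the solution comes from coefficient
  q of the slopes, which is correct for q < p and q <= M. This is the origin of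
  \<open>min p (M + 1)\<close>.\<close>

lemma expd_num_w_exact:
  assumes rk: "rk_order s A w p" and u: "u \<in> W (m + Suc M * (4 * Suc (min p (M + 1)) + 1))"
     and u': "u \<in> W (Suc M * (4 * Suc M + 1))"
  shows "expd (Suc (min p (M + 1))) m (num_w s A w M u) (exact_fps u (Suc M))"
proof (rule expd_coeff_cong[OF expd_num_w[OF u]])
  fix q assume q: "q < Suc (min p (M + 1))"
  show "fps_nth (exact_fps u (Suc M)) q = fps_nth (fps_const u +
     fps_X * (\<Sum>i<s. fps_map (\<lambda>x. w i *\<^sub>R x) (Fs (rk_node s A i) (stage_fps A s u M i)))) q"
  proof (cases q)
    case 0
    thus ?thesis by (simp add: exact_fps_0)
  next
    case (Suc q')
    have "fps_nth (exact_fps u (Suc M)) (Suc q') =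
        (\<Sum>i<s. w i *\<^sub>R fps_nth (Fs (rk_node s A i) (stage_fps A s u M i)) q')"
      by (rule numerical_coeff_eq_exact_coeff[OF rk _ _ u', symmetric]) (use q Suc in auto)
    thus ?thesis by (simp add: Suc fps_sum_nth del: exact_fps.simps)
  qed
qed

definition grad_w :: "3 \<Rightarrow> wiener \<Rightarrow> wiener" where
  "grad_w j f = (if j = 1 then - D (D f) - cst (3 * \<i>) * (f * cnjw f * D f) + cst (3 / 2) * (f * cnjw f * (f * cnjw f) * f)
     else if j = 2 then f else - (cst \<i> * D f) + f * cnjw f * f)"

lemma grad_ev:
  assumes "f \<in> W 3"
  shows "grad j (ev a b f) = ev a b (grad_w j f)"
proof -
  have W: "f \<in> W 2" "D f \<in> W 2" using assms by (auto intro: W_mono W_D simp: numeral_3_eq_3 numeral_2_eq_2)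
  have n2: "complex_of_real ((cmod z)\<^sup>2) = z * cnj z" for z by (rule complex_norm_square)
  show ?thesis
    unfolding grad_def grad_w_def
    by (rule ext) (simp only: if_distrib[of "\<lambda>g. g _"] grad_energy_def grad_mass_def grad_momentum_def n2 cmod_power4
        dx_ev W ev_add ev_minus ev_uminus ev_mult ev_cst ev_cnjw if_distrib[of "ev a b"] cong: if_cong, simp add: mult_ac)
qed

definition gamma_w :: "nat \<Rightarrow> (nat \<Rightarrow> nat \<Rightarrow> real) \<Rightarrow> (nat \<Rightarrow> real) \<Rightarrow> nat \<Rightarrow> wiener \<Rightarrow> 3 \<Rightarrow> real \<Rightarrow> wiener" where
  "gamma_w s A w M u j \<tau> = (\<Sum>i<s. w i *\<^sub>R
     eL ((1 - rk_node s A i) * \<tau>) (grad_w j (eL (rk_node s A i * \<tau>) (stage_w s A u M i \<tau>))))"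

text \<open>The coefficients stay anonymous: of the correction directions only the weighted
  regularity and the limit for vanishing step are used.\<close>

lemma expd_grad_w:
  assumes "expd n (Suc (Suc m)) f c"
  shows "\<exists>d. expd n m (\<lambda>\<tau>. grad_w j (f \<tau>)) d"
proof -
  have f: "expd n m f c" "expd n (Suc m) f c" using expd_mono[OF assms] by auto
  note D1 = expd_D[OF f(2)] and D2 = expd_D[OF expd_D[OF assms]] and C = expd_cnjw[OF f(1)]
  note FC = expd_mult[OF f(1) C]
  have 1: "\<exists>d. expd n m (\<lambda>\<tau>. - D (D (f \<tau>)) + - (cst (3 * \<i>) * (f \<tau> * cnjw (f \<tau>) * D (f \<tau>)))
      + cst (3 / 2) * (f \<tau> * cnjw (f \<tau>) * (f \<tau> * cnjw (f \<tau>)) * f \<tau>)) d"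
    by (intro exI, rule expd_add[OF expd_add[OF expd_uminus[OF D2] expd_uminus[OF expd_cst_mult[OF expd_mult[OF FC D1]]]]
        expd_cst_mult[OF expd_mult[OF expd_mult[OF FC FC] f(1)]]])
  have 2: "\<exists>d. expd n m (\<lambda>\<tau>. - (cst \<i> * D (f \<tau>)) + f \<tau> * cnjw (f \<tau>) * f \<tau>) d"
    by (intro exI, rule expd_add[OF expd_uminus[OF expd_cst_mult[OF D1]] expd_mult[OF FC f(1)]])
  show ?thesis
    using 1 2 f(1) by (cases "j = 1"; cases "j = 2") (auto simp: grad_w_def)
qed

lemma expd_gamma_w:
  assumes "u \<in> W (m + 4 * n + 2 + M * (4 * n + 1))"
  shows "\<exists>d. expd n m (gamma_w s A w M u j) d"
proof -
  have "\<exists>d. expd n m (\<lambda>\<tau>. eL ((1 - rk_node s A i) * \<tau>) (grad_w j (eL (rk_node s A i * \<tau>) (stage_w s A u M i \<tau>)))) d" for i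
  proof -
    have "expd n (m + 4 * n + 2) (stage_w s A u M i) (stage_fps A s u M i)"
      by (rule expd_stage_w[OF assms])
    hence "expd n (Suc (Suc (m + 2 * n)) + 2 * n) (stage_w s A u M i) (stage_fps A s u M i)"
      by (simp add: algebra_simps)
    from expd_grad_w[OF expd_eL[OF this], of j "rk_node s A i"]
    obtain d where "expd n (m + 2 * n) (\<lambda>\<tau>. grad_w j (eL (rk_node s A i * \<tau>) (stage_w s A u M i \<tau>))) d" by blast
    from expd_eL[OF this, of "1 - rk_node s A i"] show ?thesis by blast
  qed
  then obtain d where "\<And>i. expd n m (\<lambda>\<tau>. eL ((1 - rk_node s A i) * \<tau>)
      (grad_w j (eL (rk_node s A i * \<tau>) (stage_w s A u M i \<tau>)))) (d i)" by metis
  hence "expd n m (gamma_w s A w M u j) (\<Sum>i<s. fps_map (\<lambda>x. w i *\<^sub>R x) (d i))"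
    unfolding gamma_w_def[abs_def] by (intro expd_sum expd_scaleR)
  thus ?thesis by blast
qed

text \<open>Sweep \<open>l\<close> applies the nonlinearity to earlier sweeps only, hence the
  regularity assumption stops below \<open>l\<close>.\<close>

lemma mSP_stage_ev:
  assumes "\<And>l' j. l' < l \<Longrightarrow> j < s \<Longrightarrow> stage_w s A u l' j \<tau> \<in> W 2"
  shows "mSP_stage a b s A (ev a b u) \<tau> l i = ev a b (eL (rk_node s A i * \<tau>) (stage_w s A u l i \<tau>))"
  using assms
proof (induction l arbitrary: i)
  case 0
  show ?case by (simp add: expL_ev)
next
  case (Suc l)
  have n: "nonlin (mSP_stage a b s A (ev a b u) \<tau> l j) = ev a b (Nw (eL (rk_node s A j * \<tau>) (stage_w s A u l j \<tau>)))"
    if "j < s" for j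
    using Suc that by (simp add: nonlin_ev)
  have e: "eL ((rk_node s A i - rk_node s A j) * \<tau>) f = eL (rk_node s A i * \<tau>) (eL (- rk_node s A j * \<tau>) f)" for j f
    by (simp add: eL_eL algebra_simps)
  show ?case
    by (rule ext)
       (simp add: n expL_ev e eL_add eL_scaleR eL_sum ev_add ev_scaleR ev_sum scaleR_conv_of_real[where 'a=complex])
qed

context
  fixes s :: nat and A :: "nat \<Rightarrow> nat \<Rightarrow> real" and w :: "nat \<Rightarrow> real" and M :: nat and u :: wiener and \<tau> :: real
  assumes W: "\<And>l j. l \<le> M \<Longrightarrow> j < s \<Longrightarrow> stage_w s A u l j \<tau> \<in> W 3"
begin

lemma stage_ev: "mSP_stage a b s A (ev a b u) \<tau> M i = ev a b (eL (rk_node s A i * \<tau>) (stage_w s A u M i \<tau>))"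
  by (rule mSP_stage_ev, rule W_mono[OF W]) auto

lemma mSP_psi_hat_ev: "mSP_psi_hat a b s A w M (ev a b u) \<tau> = ev a b (eL \<tau> (num_w s A w M u \<tau>))"
proof -
  have n: "nonlin (ev a b (eL (rk_node s A j * \<tau>) (stage_w s A u M j \<tau>))) =
      ev a b (Nw (eL (rk_node s A j * \<tau>) (stage_w s A u M j \<tau>)))" if "j < s" for j
    by (rule nonlin_ev) (use W_mono[OF W[OF order_refl that], of 2] in simp)
  have e: "eL ((1 - rk_node s A j) * \<tau>) f = eL \<tau> (eL (- rk_node s A j * \<tau>) f)" for j f
    by (simp add: eL_eL algebra_simps)
  show ?thesis
    unfolding mSP_psi_hat_def stage_ev num_w_def
    by (rule ext)
       (simp add: n expL_ev e eL_add eL_scaleR eL_sum ev_add ev_scaleR ev_sum scaleR_conv_of_real[where 'a=complex])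
qed

lemma grad_stage_ev: "i < s \<Longrightarrow> grad j (ev a b (eL (rk_node s A i * \<tau>) (stage_w s A u M i \<tau>))) =
    ev a b (grad_w j (eL (rk_node s A i * \<tau>) (stage_w s A u M i \<tau>)))"
  by (rule grad_ev) (use W in simp)

lemma mSP_Gamma_ev: "mSP_Gamma a b s A w M (ev a b u) \<tau> j = ev a b (gamma_w s A w M u j \<tau>)"
  unfolding mSP_Gamma_def stage_ev gamma_w_def
  by (rule ext) (simp add: grad_stage_ev expL_ev ev_sum ev_scaleR scaleR_conv_of_real[where 'a=complex])

lemma mSP_update_ev:
  assumes "\<tau> \<noteq> 0"
  shows "mSP_update a b s A w M (ev a b u) \<tau> ((1 / \<tau>) *\<^sub>R \<alpha>) =
     ev a b (eL \<tau> (num_w s A w M u \<tau>) + (\<Sum>j\<in>UNIV. (\<alpha> $ j) *\<^sub>R gamma_w s A w M u j \<tau>))"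
proof -
  let ?Y = "\<lambda>i. eL (rk_node s A i * \<tau>) (stage_w s A u M i \<tau>)"
  have n: "nonlin (ev a b (?Y j)) = ev a b (Nw (?Y j))" if "j < s" for j
    by (rule nonlin_ev) (use W_mono[OF W[OF order_refl that], of 2] in simp)
  have slope: "mSP_slope a b s A M (ev a b u) \<tau> ((1 / \<tau>) *\<^sub>R \<alpha>) i =
      ev a b (Nw (?Y i) + (\<Sum>j\<in>UNIV. ((1 / \<tau>) * \<alpha> $ j) *\<^sub>R grad_w j (?Y i)))" if "i < s" for i
    by (rule ext) (simp add: mSP_slope_def stage_ev n grad_stage_ev that ev_add ev_sum ev_scaleR
        scaleR_conv_of_real[where 'a=complex])
  have e: "eL ((1 - rk_node s A j) * \<tau>) f = eL \<tau> (eL (- rk_node s A j * \<tau>) f)" for j f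
    by (simp add: eL_eL algebra_simps)
  \<comment> \<open>Interchanging the sums over stages and over gradients assembles the correction
    directions; the factor 1 / tau will cancel against the step size.\<close>
  have g: "(\<Sum>i<s. w i *\<^sub>R eL ((1 - rk_node s A i) * \<tau>) (\<Sum>j\<in>UNIV. ((1 / \<tau>) * \<alpha> $ j) *\<^sub>R grad_w j (?Y i)))
      = (1 / \<tau>) *\<^sub>R (\<Sum>j\<in>UNIV. (\<alpha> $ j) *\<^sub>R gamma_w s A w M u j \<tau>)"
    unfolding gamma_w_def eL_sum eL_scaleR scaleR_sum_right
    by (subst sum.swap) (simp add: mult_ac)
  have "mSP_update a b s A w M (ev a b u) \<tau> ((1 / \<tau>) *\<^sub>R \<alpha>) x =
      ev a b (eL \<tau> u + \<tau> *\<^sub>R (\<Sum>i<s. w i *\<^sub>R eL ((1 - rk_node s A i) * \<tau>)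
        (Nw (?Y i) + (\<Sum>j\<in>UNIV. ((1 / \<tau>) * \<alpha> $ j) *\<^sub>R grad_w j (?Y i))))) x" for x
    unfolding mSP_update_def
    by (simp add: slope expL_ev ev_add[of _ _ "eL \<tau> u"] ev_scaleR ev_sum[where I="{..<s}"] scaleR_conv_of_real[where 'a=complex])
  also have "eL \<tau> u + \<tau> *\<^sub>R (\<Sum>i<s. w i *\<^sub>R eL ((1 - rk_node s A i) * \<tau>)
        (Nw (?Y i) + (\<Sum>j\<in>UNIV. ((1 / \<tau>) * \<alpha> $ j) *\<^sub>R grad_w j (?Y i)))) =
      eL \<tau> (num_w s A w M u \<tau>) + \<tau> *\<^sub>R (\<Sum>i<s. w i *\<^sub>R eL ((1 - rk_node s A i) * \<tau>)
        (\<Sum>j\<in>UNIV. ((1 / \<tau>) * \<alpha> $ j) *\<^sub>R grad_w j (?Y i)))"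
    unfolding num_w_def eL_add scaleR_add_right sum.distrib by (simp add: eL_scaleR eL_sum e eL_add)
  also have "\<dots> = eL \<tau> (num_w s A w M u \<tau>) + (\<Sum>j\<in>UNIV. (\<alpha> $ j) *\<^sub>R gamma_w s A w M u j \<tau>)"
    unfolding g using assms by simp
  finally show ?thesis by (rule ext)
qed

lemma mSP_G_ev:
  assumes P: "num_w s A w M u \<tau> \<in> W 2" and g: "\<And>j. gamma_w s A w M u j \<tau> \<in> W 2" and u: "u \<in> W 2"
  shows "mSP_G a b s A w M (ev a b u) \<tau> \<alpha> =
     Inv ((eL \<tau> (num_w s A w M u \<tau>), D (eL \<tau> (num_w s A w M u \<tau>))) +
        (\<Sum>j\<in>UNIV. (\<alpha> $ j) *\<^sub>R (gamma_w s A w M u j \<tau>, D (gamma_w s A w M u j \<tau>)))) - Inv (u, D u)"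
proof -
  let ?P = "eL \<tau> (num_w s A w M u \<tau>)" and ?g = "\<lambda>j. gamma_w s A w M u j \<tau>"
  let ?f = "?P + (\<Sum>j\<in>UNIV. (\<alpha> $ j) *\<^sub>R ?g j)"
  have f: "?f \<in> W 2" by (intro W_add W_sum W_scaleR) (use P g in auto)
  have 1: "?P \<in> W (Suc 0)" "\<And>j. ?g j \<in> W (Suc 0)"
    using W_mono[OF P, of 1] W_mono[OF g, of 1] by simp_all
  have Dsum: "D (\<Sum>j\<in>I. (\<alpha> $ j) *\<^sub>R ?g j) = (\<Sum>j\<in>I. (\<alpha> $ j) *\<^sub>R D (?g j))" for I :: "3 set"
  proof (induction I rule: infinite_finite_induct)
    case (insert x F)
    have "D ((\<alpha> $ x) *\<^sub>R ?g x + (\<Sum>j\<in>F. (\<alpha> $ j) *\<^sub>R ?g j)) = (\<alpha> $ x) *\<^sub>R D (?g x) + D (\<Sum>j\<in>F. (\<alpha> $ j) *\<^sub>R ?g j)"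
      by (subst D_add) (auto simp: D_scaleR 1 intro!: W_sum W_scaleR)
    thus ?case using insert by simp
  qed (use D_scaleR[of 0 0] in simp_all)
  have D0: "D ?f = D ?P + (\<Sum>j\<in>UNIV. (\<alpha> $ j) *\<^sub>R D (?g j))"
    by (subst D_add) (auto simp: 1[simplified] Dsum intro!: W_sum W_scaleR)
  have pair: "(\<Sum>j\<in>UNIV. (\<alpha> $ j) *\<^sub>R (?g j, D (?g j))) = (\<Sum>j\<in>UNIV. (\<alpha> $ j) *\<^sub>R ?g j, \<Sum>j\<in>UNIV. (\<alpha> $ j) *\<^sub>R D (?g j))"
    by (simp add: prod_eq_iff fst_sum snd_sum)
  have "mSP_G a b s A w M (ev a b u) \<tau> \<alpha> = invariants a b (ev a b ?f) - invariants a b (ev a b u)"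
  proof -
    have "(\<lambda>x. ev a b ?P x + (\<Sum>j\<in>UNIV. complex_of_real (\<alpha> $ j) * ev a b (?g j) x)) = ev a b ?f"
      by (rule ext) (simp add: ev_add ev_sum ev_scaleR scaleR_conv_of_real[where 'a=complex])
    thus ?thesis unfolding mSP_G_def mSP_psi_hat_ev mSP_Gamma_ev by simp
  qed
  also have "\<dots> = Inv (?f, D ?f) - Inv (u, D u)" by (simp only: invariants_ev f u)
  finally show ?thesis unfolding D0 pair by simp
qed

end

section \<open>The exact solution in the interaction picture and the local error\<close>

lemma dnls_interaction:
  assumes \<psi>: "\<And>t. t \<in> {tn..tn + T0} \<Longrightarrow> \<psi> t = ev a b (\<Psi> t)" and \<Psi>: "contW 3 \<Psi> {tn..tn + T0}"
    and sol: "dnls_solution {tn..tn + T0} \<psi>" and t: "t \<in> {0..T0}"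
  defines "v \<equiv> \<lambda>t. eL (- t) (\<Psi> (tn + t))"
  shows "((\<lambda>s. fc (v s) k) has_vector_derivative fc (eL (- t) (Nw (eL t (v t)))) k) (at t within {0..T0})"
proof -
  define \<mu> where "\<mu> = (wavenumber a b k)\<^sup>2"
  have tI: "tn + t \<in> {tn..tn + T0}" using t by auto
  have W3: "\<Psi> (tn + t) \<in> W 3" using \<Psi> tI by (auto simp: contW_def)
  have W: "\<Psi> (tn + t) \<in> W 1" "D (\<Psi> (tn + t)) \<in> W 1"
    using W_mono[OF W3, of 1] W_mono[OF W_D[of _ 2], of _ 1] W3 by (simp_all add: eval_nat_numeral)
  have img: "(\<lambda>s. tn + s) ` {0..T0} = {tn..tn + T0}" by simp
  have d1: "((\<lambda>s. fc (\<Psi> (tn + s)) k) has_vector_derivative fc (rhs (\<Psi> (tn + t))) k) (at t within {0..T0})"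
  proof -
    have "((\<lambda>s. tn + s) has_vector_derivative 1) (at t within {0..T0})"
      by (auto intro!: derivative_eq_intros)
    moreover have "((\<lambda>u. fc (\<Psi> u) k) has_vector_derivative fc (rhs (\<Psi> (tn + t))) k)
        (at (tn + t) within (\<lambda>s. tn + s) ` {0..T0})"
      unfolding img by (rule dnls_coeff_ode[OF \<psi> \<Psi> sol tI])
    ultimately show ?thesis using vector_diff_chain_within by (force simp: o_def)
  qed
  \<comment> \<open>In mode k the inverse group is multiplication by exp(i t mu). It acts as an
    integrating factor: its derivative cancels the linear part -i mu of the equation.\<close>
  have d2: "((\<lambda>s. cis (s * \<mu>)) has_vector_derivative of_real \<mu> * (\<i> * cis (t * \<mu>))) (at t within {0..T0})"
  proof -
    have "((\<lambda>s. cis (s * \<mu>)) has_derivative (\<lambda>y. (y * \<mu>) *\<^sub>R (\<i> * cis (t * \<mu>)))) (at t within {0..T0})"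
      by (auto intro!: derivative_eq_intros)
    thus ?thesis by (simp add: has_vector_derivative_def scaleR_conv_of_real[where 'a=complex] mult_ac)
  qed
  have rhs: "fc (rhs (\<Psi> (tn + t))) k = - (\<i> * of_real \<mu> * fc (\<Psi> (tn + t)) k) + fc (Nw (\<Psi> (tn + t))) k"
    by (simp add: rhs_def fc_D[OF W(1)] fc_D[OF W(2)] \<mu>_def power2_eq_square mult_ac)
  have "((\<lambda>s. cis (s * \<mu>) * fc (\<Psi> (tn + s)) k) has_vector_derivative
      (cis (t * \<mu>) * fc (rhs (\<Psi> (tn + t))) k + of_real \<mu> * (\<i> * cis (t * \<mu>)) * fc (\<Psi> (tn + t)) k)) (at t within {0..T0})"
    by (rule has_vector_derivative_mult[OF d2 d1])
  moreover have "(\<lambda>s. fc (v s) k) = (\<lambda>s. cis (s * \<mu>) * fc (\<Psi> (tn + s)) k)"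
    by (simp add: v_def \<mu>_def)
  moreover have "fc (eL (- t) (Nw (eL t (v t)))) k =
      cis (t * \<mu>) * fc (rhs (\<Psi> (tn + t))) k + of_real \<mu> * (\<i> * cis (t * \<mu>)) * fc (\<Psi> (tn + t)) k"
    by (simp add: v_def eL_eL rhs \<mu>_def ring_distribs mult_ac)
  ultimately show ?thesis by simp
qed

text \<open>Coefficientwise derivatives of the solution and of its x-derivative become norm
  derivatives, because the right-hand side and its x-derivative are norm-continuous in time; the
  local conservation laws then apply.\<close>

lemma dnls_invariants:
  assumes \<psi>: "\<And>t. t \<in> {t0..t1} \<Longrightarrow> \<psi> t = ev a b (\<Psi> t)" and \<Psi>: "contW 4 \<Psi> {t0..t1}"
    and sol: "dnls_solution {t0..t1} \<psi>" and t: "t \<in> {t0..t1}"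
  shows "Inv (\<Psi> t, D (\<Psi> t)) = Inv (\<Psi> t0, D (\<Psi> t0))"
proof -
  have \<Psi>3: "contW 3 \<Psi> {t0..t1}" using \<Psi> by (rule contW_mono) simp
  have r1: "contW (Suc 0) (\<lambda>t. rhs (\<Psi> t)) {t0..t1}" using \<Psi>3 by (intro contW_rhs) (simp add: numeral_3_eq_3)
  have W4: "\<Psi> t \<in> W 4" if "t \<in> {t0..t1}" for t using \<Psi> that by (auto simp: contW_def)
  have W1: "\<Psi> t \<in> W (Suc 0)" if "t \<in> {t0..t1}" for t using W4[OF that] by (rule W_mono) simp
  note ode = dnls_coeff_ode[OF \<psi> \<Psi>3 sol]
  have F': "(\<Psi> has_vector_derivative rhs (\<Psi> t)) (at t within {t0..t1})" if "t \<in> {t0..t1}" for t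
    by (rule wiener_has_vector_derivative[OF ode contW_continuous_on[OF r1] that])
  have DF': "((\<lambda>u. D (\<Psi> u)) has_vector_derivative D (rhs (\<Psi> t))) (at t within {t0..t1})" if "t \<in> {t0..t1}" for t
  proof (rule wiener_has_vector_derivative[where G="\<lambda>t. D (rhs (\<Psi> t))", OF _ contW_continuous_on[OF contW_D[OF r1]] that])
    fix s k assume s: "s \<in> {t0..t1}"
    have rW: "rhs (\<Psi> s) \<in> W 1" using r1 s by (auto simp: contW_def)
    have "((\<lambda>u. \<i> * wavenumber a b k * fc (\<Psi> u) k) has_vector_derivative
        \<i> * wavenumber a b k * fc (rhs (\<Psi> s)) k) (at s within {t0..t1})"
      by (intro has_vector_derivative_mult_right ode s)
    hence "((\<lambda>u. \<i> * wavenumber a b k * fc (\<Psi> u) k) has_vector_derivative fc (D (rhs (\<Psi> s))) k) (at s within {t0..t1})"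
      by (simp add: fc_D[OF rW])
    thus "((\<lambda>u. fc (D (\<Psi> u)) k) has_vector_derivative fc (D (rhs (\<Psi> s))) k) (at s within {t0..t1})"
      by (rule has_vector_derivative_transform[OF s, rotated]) (simp add: fc_D W1)
  qed
  show ?thesis
    unfolding Inv_def fst_conv snd_conv
    using invariants_constant[OF W4 F' DF' t] by simp
qed

lemma norm_pair_le: "f \<in> W 2 \<Longrightarrow> norm (f, D f) \<le> (1 + om) * nrm 2 f"
proof -
  assume f: "f \<in> W 2"
  have "norm (f, D f) \<le> norm f + norm (D f)" by (rule norm_Pair_le)
  also have "\<dots> \<le> nrm 2 f + om * nrm 2 f"
  proof (intro add_mono)
    show "norm f \<le> nrm 2 f" by (rule norm_le_nrm[OF f])
    have "norm (D f) \<le> om * nrm 1 f" by (rule norm_D_le) (rule W_mono[OF f], simp)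
    also have "\<dots> \<le> om * nrm 2 f" using om_pos by (intro mult_left_mono nrm_mono f) auto
    finally show "norm (D f) \<le> om * nrm 2 f" .
  qed
  finally show ?thesis by (simp add: algebra_simps)
qed

lemma pair_diff: "f \<in> W 2 \<Longrightarrow> g \<in> W 2 \<Longrightarrow> (f, D f) - (g, D g) = (f - g, D (f - g))"
  using W_mono[of f 2 1] W_mono[of g 2 1] by (simp add: D_minus)

lemma expd_tendsto_pair:
  assumes "expd 1 2 f c"
  shows "((\<lambda>\<tau>. (f \<tau>, D (f \<tau>))) \<longlongrightarrow> (f 0, D (f 0))) (at_right 0)"
proof -
  obtain C \<delta> where "expd_on 1 2 f c C \<delta>" using assms by (rule expdE)
  note * = expd_onD[OF this]
  \<comment> \<open>The expansion includes t = 0, where its remainder bound of order 1 is 0.\<close>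
  have f0: "f 0 = fps_nth c 0"
  proof -
    have "nrm 2 (f 0 - fps_nth c 0) \<le> 0" using *(6)[of 0] *(2) by simp
    moreover have "f 0 - fps_nth c 0 \<in> W 2" using *(8)[of 0] *(2) by simp
    ultimately have "norm (f 0 - fps_nth c 0) \<le> 0" using norm_le_nrm order_trans by blast
    thus ?thesis by simp
  qed
  have "((\<lambda>\<tau>. (f \<tau>, D (f \<tau>)) - (f 0, D (f 0))) \<longlongrightarrow> 0) (at_right 0)"
  proof (rule Lim_null_comparison)
    show "\<forall>\<^sub>F \<tau> in at_right 0. norm ((f \<tau>, D (f \<tau>)) - (f 0, D (f 0))) \<le> (1 + om) * (C * \<tau>)"
      unfolding eventually_at_right_field
    proof (intro exI[of _ \<delta>] conjI allI impI *(2))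
      fix \<tau> assume \<tau>: "0 < \<tau>" "\<tau> < \<delta>"
      have W: "f \<tau> \<in> W 2" "f 0 \<in> W 2" using *(5)[of \<tau>] *(5)[of 0] \<tau> by auto
      have "nrm 2 (f \<tau> - f 0) \<le> C * \<tau>" using *(6)[of \<tau>] \<tau> by (simp add: f0)
      hence "(1 + om) * nrm 2 (f \<tau> - f 0) \<le> (1 + om) * (C * \<tau>)" using om_pos by (intro mult_left_mono) auto
      thus "norm ((f \<tau>, D (f \<tau>)) - (f 0, D (f 0))) \<le> (1 + om) * (C * \<tau>)"
        unfolding pair_diff[OF W] using norm_pair_le[of "f \<tau> - f 0"] W by fastforce
    qed
    show "((\<lambda>\<tau>. (1 + om) * (C * \<tau>)) \<longlongrightarrow> 0) (at_right 0)" by (auto intro!: tendsto_eq_intros)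
  qed
  thus ?thesis by (rule LIM_zero_cancel)
qed

lemma L2_norm_ev_le: "L2_norm_on a b (ev a b f) \<le> sqrt (b - a) * norm f"
proof -
  have "integral {a..b} (\<lambda>x. (cmod (ev a b f x))\<^sup>2) \<le> integral {a..b} (\<lambda>x. (norm f)\<^sup>2)"
    by (intro integral_le integrable_continuous_interval continuous_intros continuous_on_ev power_mono norm_ev_le) auto
  also have "\<dots> = (b - a) * (norm f)\<^sup>2" using ab by simp
  finally show ?thesis
    unfolding L2_norm_on_def using real_sqrt_le_mono by (fastforce simp: real_sqrt_mult)
qed

text \<open>A full neighbourhood of 0 with the guard on the sign covers small positive steps and the
  step 0 by one statement; the Jacobian needs the latter.\<close>

lemma eventually_expd_W:
  assumes "expd n m f c"
  shows "\<forall>\<^sub>F \<tau> in nhds 0. 0 \<le> \<tau> \<longrightarrow> f \<tau> \<in> W m"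
proof -
  obtain C \<delta> where "expd_on n m f c C \<delta>" using assms by (rule expdE)
  note * = expd_onD[OF this]
  show ?thesis
    unfolding eventually_nhds_metric
    using *(2,5) by (intro exI[of _ \<delta>]) (auto simp: dist_real_def)
qed

lemma eventually_nhds_at_right:
  assumes "\<forall>\<^sub>F \<tau> in nhds 0. 0 \<le> \<tau> \<longrightarrow> P \<tau>"
  shows "\<forall>\<^sub>F \<tau> in at_right (0::real). P \<tau>" and "P 0"
  using assms eventually_nhds_x_imp_x[OF assms]
  by (auto simp: eventually_at_filter elim!: eventually_mono)

text \<open>
  Each of the at most \<open>M + 2\<close> integration steps costs \<open>4 * n + 1\<close> weights, where \<open>n \<le> M + 2\<close> is the
  order of the expansion: two per power of the step size for both factors of the interaction
  picture, and one for the derivative in the nonlinearity.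
\<close>

lemma mSP_order:
  fixes M p s :: nat and A :: "nat \<Rightarrow> nat \<Rightarrow> real" and w :: "nat \<Rightarrow> real" and \<psi> :: "real \<Rightarrow> real \<Rightarrow> complex"
  defines "m0 \<equiv> 10 + (M + 2) * (4 * (M + 2) + 1)"
  assumes rk: "rk_order s A w p" and T0: "T0 > 0"
    and C: "C_H_per a b r {tn..tn + T0} \<psi>" and sol: "dnls_solution {tn..tn + T0} \<psi>" and r: "r \<ge> real m0 + 1"
    and det: "det (jacobian (mSP_G a b s A w M (\<psi> tn) 0) (at 0)) \<noteq> 0"
  shows "\<exists>\<alpha>. mSP_multipliers a b s A w M (\<psi> tn) \<alpha>"
    and "mSP_multipliers a b s A w M (\<psi> tn) \<alpha> \<Longrightarrow>
      (\<lambda>\<tau>. L2_norm_on a b (\<lambda>x. mSP_update a b s A w M (\<psi> tn) \<tau> ((1 / \<tau>) *\<^sub>R \<alpha> \<tau>) x - \<psi> (tn + \<tau>) x))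
        \<in> O[at_right 0](\<lambda>\<tau>. \<tau> ^ (min p (M + 1) + 1))"
proof -
  let ?I = "{tn..tn + T0}"
  define n where "n = Suc (min p (M + 1))"
  have n: "n \<le> Suc (Suc M)" by (simp add: n_def)
  obtain \<Psi> where \<psi>: "\<And>t. t \<in> ?I \<Longrightarrow> \<psi> t = ev a b (\<Psi> t)" and \<Psi>: "contW m0 \<Psi> ?I"
    using dnls_lift[OF C sol r] by metis
  define u where "u = \<Psi> tn"
  have \<Psi>W: "\<Psi> t \<in> W m0" if "t \<in> ?I" for t using \<Psi> that by (auto simp: contW_def)
  have um0: "u \<in> W m0" unfolding u_def using \<Psi>W T0 by simp
  have \<psi>u: "\<psi> tn = ev a b u" unfolding u_def using \<psi> T0 by simp
  \<comment> \<open>The summand 10 in \<open>m0\<close> pays for the weights that do not scale with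
    the number of sweeps; the largest demand is 2 + 4 + 2, from the correction directions.\<close>
  have le1: "k \<le> m0" if "k \<le> 10 + j * (4 * (M + 2) + 1)" "j \<le> M + 2" for k j
    using that mult_le_mono1[OF that(2), of "4 * (M + 2) + 1"] unfolding m0_def by linarith
  have n4: "j * (4 * n + 1) \<le> j * (4 * (M + 2) + 1)" for j using n by (intro mult_le_mono2) simp
  have n5: "k + j * (4 * 1 + 1) \<le> 10 + j * (4 * (M + 2) + 1)" if "k \<le> 10" for k j :: nat
    by (rule add_mono[OF that mult_le_mono2]) simp
  define v where "v t = eL (- t) (\<Psi> (tn + t))" for t
  have \<Psi>v: "\<Psi> (tn + t) = eL t (v t)" for t by (simp add: v_def eL_eL)
  have v0: "v 0 = u" by (simp add: v_def u_def)
  have \<Psi>3: "contW 3 \<Psi> ?I" and \<Psi>4: "contW 4 \<Psi> ?I"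
    using contW_mono[OF \<Psi>] by (auto simp: m0_def)
  have ode: "((\<lambda>s. fc (v s) k) has_vector_derivative fc (eL (- t) (Nw (eL t (v t)))) k) (at t within {0..T0})"
    if "t \<in> {0..T0}" for t k
    unfolding v_def[abs_def] using dnls_interaction[OF \<psi> \<Psi>3 sol that] by simp
  have vW: "v t \<in> W m0" if "t \<in> {0..T0}" for t using \<Psi>W[of "tn + t"] that by (simp add: v_def)
  \<comment> \<open>Continuity of the solution at \<open>tn\<close> bounds it near \<open>tn\<close>
    in the strongest norm; this starts the bootstrapping of the expansion.\<close>
  have v_bd: "expd 0 m0 v 0"
  proof -
    have "((\<lambda>u. nrm m0 (\<Psi> u - \<Psi> tn)) \<longlongrightarrow> 0) (at tn within ?I)" using \<Psi> T0 by (auto simp: contW_def)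
    hence "\<forall>\<^sub>F u in at tn within ?I. nrm m0 (\<Psi> u - \<Psi> tn) < 1" by (rule order_tendstoD) simp
    then obtain d where d: "d > 0" "\<And>t. t \<in> ?I \<Longrightarrow> t \<noteq> tn \<Longrightarrow> dist t tn < d \<Longrightarrow> nrm m0 (\<Psi> t - \<Psi> tn) < 1"
      unfolding eventually_at by blast
    show ?thesis
    proof (rule expdI[where \<delta>="min (d / 2) T0" and C="nrm m0 u + 1"])
      fix t assume t: "0 \<le> t" "t \<le> min (d / 2) T0"
      show "v t \<in> W m0" using vW t by simp
      have tI: "tn + t \<in> ?I" using t by simp
      have "nrm m0 (\<Psi> (tn + t) - \<Psi> tn) \<le> 1"
        using d(2)[OF tI] d(1) t by (cases "t = 0") (auto simp: dist_real_def less_imp_le)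
      moreover have "nrm m0 (\<Psi> tn + (\<Psi> (tn + t) - \<Psi> tn)) \<le> nrm m0 (\<Psi> tn) + nrm m0 (\<Psi> (tn + t) - \<Psi> tn)"
        using \<Psi>W tI T0 by (intro nrm_add_le W_minus) auto
      ultimately show "nrm m0 (v t - (\<Sum>q<0. t ^ q *\<^sub>R fps_nth 0 q)) \<le> (nrm m0 u + 1) * t ^ 0"
        by (simp add: v_def u_def)
    qed (use d T0 in auto)
  qed
  have v_expd: "expd n 2 v (exact_fps u (Suc M))"
  proof (rule expd_exact[OF T0 v0 ode, where N="M + 2"])
    have le: "2 + n * (4 * (M + 2) + 1) \<le> m0" using n by (intro le1[of _ n]) auto
    show "expd 0 (2 + n * (4 * (M + 2) + 1)) v 0" by (rule expd_mono[OF v_bd le])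
    show "v t \<in> W (2 + n * (4 * (M + 2) + 1))" if "t \<in> {0..T0}" for t by (rule W_mono[OF vW[OF that] le])
  qed (use n in auto)
  define num where "num = num_w s A w M u"
  have num_expd: "expd n 2 num (exact_fps u (Suc M))"
    unfolding num_def n_def
  proof (rule expd_num_w_exact[OF rk])
    show "u \<in> W (2 + Suc M * (4 * Suc (min p (M + 1)) + 1))"
      by (rule W_mono[OF um0 le1[of _ "Suc M"]]) (use n4[of "Suc M"] in \<open>simp_all add: n_def\<close>)
    show "u \<in> W (Suc M * (4 * Suc M + 1))"
      by (rule W_mono[OF um0 le1[of _ "Suc M"]]) (use mult_le_mono2[of "4 * Suc M + 1" "4 * (M + 2) + 1" "Suc M"] in simp_all)
  qed
  obtain C1 \<delta>1 where C1: "C1 \<ge> 0" "\<delta>1 > 0" "\<And>\<tau>. 0 \<le> \<tau> \<Longrightarrow> \<tau> \<le> \<delta>1 \<Longrightarrow>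
      num \<tau> \<in> W 2 \<and> v \<tau> \<in> W 2 \<and> nrm 2 (num \<tau> - v \<tau>) \<le> C1 * \<tau> ^ n"
    using expd_diff_bound[OF num_expd v_expd] by metis
  define P where "P \<tau> = eL \<tau> (num \<tau>)" for \<tau>
  define g where "g j = gamma_w s A w M u j" for j
  have P0: "P 0 = u" by (simp add: P_def num_def num_w_def)
  obtain cP where P_expd: "expd 1 2 P cP"
  proof -
    have "u \<in> W (2 + 2 * 1 + Suc M * (4 * 1 + 1))"
      by (rule W_mono[OF um0 le1[OF n5]]) simp_all
    from expd_eL[OF expd_num_w[OF this], of 1 s A w] show ?thesis
      using that by (simp add: P_def[abs_def] num_def)
  qed
  have "\<exists>d. expd 1 2 (g j) d" for j
    unfolding g_def
    by (rule expd_gamma_w, rule W_mono[OF um0 le1[OF n5]]) simp_all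
  then obtain cg where g_expd: "\<And>j. expd 1 2 (g j) (cg j)" by metis
  have ev_stage: "\<forall>\<^sub>F \<tau> in nhds 0. \<forall>l\<in>{..M}. \<forall>j\<in>{..<s}. 0 \<le> \<tau> \<longrightarrow> stage_w s A u l j \<tau> \<in> W 3"
  proof (intro eventually_ball_finite ballI)
    fix l j assume l: "l \<in> {..M}"
    have "u \<in> W (3 + l * (4 * 1 + 1))"
      by (rule W_mono[OF um0 le1[OF n5]]) (use l in simp_all)
    from eventually_expd_W[OF expd_stage_w[OF this]]
    show "\<forall>\<^sub>F \<tau> in nhds 0. 0 \<le> \<tau> \<longrightarrow> stage_w s A u l j \<tau> \<in> W 3" .
  qed auto
  have ev_g: "\<forall>\<^sub>F \<tau> in nhds 0. \<forall>j\<in>UNIV. 0 \<le> \<tau> \<longrightarrow> g j \<tau> \<in> W 2"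
    by (intro eventually_ball_finite ballI eventually_expd_W[OF g_expd]) auto
  have "\<forall>\<^sub>F \<tau> in nhds 0. 0 \<le> \<tau> \<longrightarrow> (\<forall>l j. l \<le> M \<longrightarrow> j < s \<longrightarrow> stage_w s A u l j \<tau> \<in> W 3) \<and>
      num \<tau> \<in> W 2 \<and> (\<forall>j. g j \<tau> \<in> W 2)"
    using ev_stage ev_g eventually_expd_W[OF num_expd] by eventually_elim auto
  note regular = eventually_nhds_at_right[OF this]
  have u2: "u \<in> W 2" by (rule W_mono[OF um0]) (simp add: m0_def)
  let ?G = "mSP_G a b s A w M (\<psi> tn)"
  let ?P = "\<lambda>\<tau>. (P \<tau>, D (P \<tau>))" and ?g = "\<lambda>j \<tau>. (g j \<tau>, D (g j \<tau>))"
  have G_eq: "?G \<tau> \<alpha> = Inv (?P \<tau> + (\<Sum>j\<in>UNIV. (\<alpha> $ j) *\<^sub>R ?g j \<tau>)) - Inv (u, D u)"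
    if "(\<forall>l j. l \<le> M \<longrightarrow> j < s \<longrightarrow> stage_w s A u l j \<tau> \<in> W 3) \<and> num \<tau> \<in> W 2 \<and> (\<forall>j. g j \<tau> \<in> W 2)" for \<tau> \<alpha>
    unfolding \<psi>u P_def num_def g_def
    by (rule mSP_G_ev) (use that u2 in \<open>auto simp: num_def g_def\<close>)
  obtain Inv' where Inv': "sdiff Inv Inv' (?P 0)"
    using sdiff_Inv unfolding strictly_differentiable_def by blast
  interpret implicit_family Inv Inv' ?P ?g ?G "Inv (u, D u)" "at_right 0"
  proof
    show "\<forall>\<^sub>F \<tau> in at_right 0. \<forall>\<alpha>. ?G \<tau> \<alpha> = Inv (?P \<tau> + (\<Sum>j\<in>UNIV. (\<alpha> $ j) *\<^sub>R ?g j \<tau>)) - Inv (u, D u)"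
      using regular(1) by eventually_elim (use G_eq in blast)
    show "?G 0 \<alpha> = Inv (?P 0 + (\<Sum>j\<in>UNIV. (\<alpha> $ j) *\<^sub>R ?g j 0)) - Inv (u, D u)" for \<alpha>
      by (rule G_eq[OF regular(2)])
  qed (rule Inv' expd_tendsto_pair[OF P_expd] expd_tendsto_pair[OF g_expd])+
  obtain K d where K: "K > 0" "d > 0" "\<And>y z. norm (y - ?P 0) < d \<Longrightarrow> norm (z - ?P 0) < d \<Longrightarrow>
     norm (Inv y - Inv z) \<le> K * norm (y - z)"
    using sdiff_lipschitz[OF Inv'] by metis
  have ev_d: "\<forall>\<^sub>F \<tau> in at_right 0. norm (?P \<tau> - ?P 0) < d / 2"
  proof -
    have "((\<lambda>\<tau>. norm (?P \<tau> - ?P 0)) \<longlongrightarrow> 0) (at_right 0)"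
      by (rule tendsto_norm_zero[OF LIM_zero[OF expd_tendsto_pair[OF P_expd]]])
    thus ?thesis by (rule order_tendstoD) (use K in simp)
  qed
  have tau_n: "((\<lambda>\<tau>::real. c * \<tau> ^ n) \<longlongrightarrow> 0) (at_right 0)" for c
    by (auto intro!: tendsto_eq_intros simp: n_def)
  have ev_small: "\<forall>\<^sub>F \<tau> in at_right 0. (1 + om) * C1 * \<tau> ^ n < d / 2"
    by (rule order_tendstoD(2)[OF tau_n]) (use K in simp)
  have ev_T: "\<forall>\<^sub>F \<tau> in at_right 0. 0 < \<tau> \<and> \<tau> < min T0 \<delta>1"
    unfolding eventually_at_right_field using T0 C1(2) by (intro exI[of _ "min T0 \<delta>1"]) auto
  define C2 where "C2 = K * ((1 + om) * C1)"
  have C2: "C2 \<ge> 0" using K C1 om_pos by (simp add: C2_def)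
  \<comment> \<open>By conservation the initial value may be replaced by the exact solution at the
    new time. Then G(tau, 0) is a difference of invariants at two points whose distance is the
    uncorrected local error, and the invariants are locally Lipschitz.\<close>
  have G0_le: "\<forall>\<^sub>F \<tau> in at_right 0. norm (?G \<tau> 0) \<le> C2 * \<tau> ^ n"
    using ev_d ev_small ev_T regular(1)
  proof eventually_elim
    case (elim \<tau>)
    have tI: "tn + \<tau> \<in> ?I" using elim(3) by auto
    have num_v: "num \<tau> \<in> W 2" "v \<tau> \<in> W 2" "nrm 2 (num \<tau> - v \<tau>) \<le> C1 * \<tau> ^ n" using C1(3)[of \<tau>] elim(3) by auto
    have Q: "P \<tau> \<in> W 2" "\<Psi> (tn + \<tau>) \<in> W 2" using num_v by (simp_all add: P_def \<Psi>v)
    let ?Q = "(\<Psi> (tn + \<tau>), D (\<Psi> (tn + \<tau>)))"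
    have "P \<tau> - \<Psi> (tn + \<tau>) = eL \<tau> (num \<tau> - v \<tau>)" by (simp add: P_def \<Psi>v eL_minus)
    hence "nrm 2 (P \<tau> - \<Psi> (tn + \<tau>)) \<le> C1 * \<tau> ^ n" using num_v by simp
    hence "(1 + om) * nrm 2 (P \<tau> - \<Psi> (tn + \<tau>)) \<le> (1 + om) * (C1 * \<tau> ^ n)"
      using om_pos by (intro mult_left_mono) auto
    hence PQ: "norm (?P \<tau> - ?Q) \<le> (1 + om) * C1 * \<tau> ^ n"
      unfolding pair_diff[OF Q] using norm_pair_le[of "P \<tau> - \<Psi> (tn + \<tau>)"] Q by fastforce
    have "norm (?Q - ?P 0) \<le> norm (?P \<tau> - ?P 0) + norm (?P \<tau> - ?Q)"
    proof -
      have "norm (z - y) \<le> norm (x - y) + norm (x - z)" for x y z :: "wiener \<times> wiener"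
        using norm_triangle_ineq4[of "x - y" "x - z"] by simp
      thus ?thesis .
    qed
    hence "norm (?Q - ?P 0) < d" using PQ elim(1,2) by linarith
    moreover have "norm (?P \<tau> - ?P 0) < d" using elim(1) K(2) by linarith
    ultimately have "norm (Inv (?P \<tau>) - Inv ?Q) \<le> K * norm (?P \<tau> - ?Q)" by (intro K(3))
    also have "\<dots> \<le> K * ((1 + om) * C1 * \<tau> ^ n)" using K(1) PQ by (intro mult_left_mono) auto
    also have "Inv ?Q = Inv (u, D u)" unfolding u_def by (rule dnls_invariants[OF \<psi> \<Psi>4 sol tI])
    finally have "norm (Inv (?P \<tau>) - Inv (u, D u)) \<le> C2 * \<tau> ^ n" by (simp add: C2_def mult.assoc)
    moreover have "?G \<tau> 0 = Inv (?P \<tau>) - Inv (u, D u)"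
      using G_eq[OF elim(4), of 0] by (simp flip: zero_prod_def)
    ultimately show ?case by simp
  qed
  have G0_0: "((\<lambda>\<tau>. ?G \<tau> 0) \<longlongrightarrow> 0) (at_right 0)"
    by (rule Lim_null_comparison[OF G0_le tau_n])
  obtain \<rho> B where \<rho>: "\<rho> > 0" "B > 0"
    "\<forall>\<^sub>F \<tau> in at_right 0. \<exists>\<alpha>\<in>ball 0 \<rho>. ?G \<tau> \<alpha> = 0"
    "\<forall>\<^sub>F \<tau> in at_right 0. \<forall>\<alpha>\<in>ball 0 \<rho>. \<forall>\<gamma>\<in>ball 0 \<rho>. norm (\<alpha> - \<gamma>) \<le> B * norm (?G \<tau> \<alpha> - ?G \<tau> \<gamma>)"
    by (rule solution_branch[OF det G0_0])
  \<comment> \<open>Any zero in the ball is compared with the point 0, where G is already as small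
    as the local error.\<close>
  have rate: "\<forall>\<^sub>F \<tau> in at_right 0. norm (\<alpha> \<tau>) \<le> B * C2 * \<tau> ^ n"
    if "\<forall>\<^sub>F \<tau> in at_right 0. \<alpha> \<tau> \<in> ball 0 \<rho> \<and> ?G \<tau> (\<alpha> \<tau>) = 0" for \<alpha>
    using that \<rho>(4) G0_le
  proof eventually_elim
    case (elim \<tau>)
    have "norm (\<alpha> \<tau> - 0) \<le> B * norm (?G \<tau> (\<alpha> \<tau>) - ?G \<tau> 0)" 
      by (rule bspec[OF bspec[OF elim(2)]]) (use elim(1) \<rho>(1) in auto)
    also have "\<dots> \<le> B * (C2 * \<tau> ^ n)" using elim(1,3) \<rho>(2) by (intro mult_left_mono) auto
    finally show ?case by (simp add: mult.assoc)
  qed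
  define \<alpha>0 where "\<alpha>0 \<tau> = (SOME \<alpha>. \<alpha> \<in> ball 0 \<rho> \<and> ?G \<tau> \<alpha> = 0)" for \<tau>
  have \<alpha>0: "\<forall>\<^sub>F \<tau> in at_right 0. \<alpha>0 \<tau> \<in> ball 0 \<rho> \<and> ?G \<tau> (\<alpha>0 \<tau>) = 0"
    using \<rho>(3)
  proof eventually_elim
    case (elim \<tau>)
    thus ?case using someI_ex[of "\<lambda>\<alpha>. \<alpha> \<in> ball 0 \<rho> \<and> ?G \<tau> \<alpha> = 0"] unfolding \<alpha>0_def by blast
  qed
  have "mSP_multipliers a b s A w M (\<psi> tn) \<alpha>0"
    unfolding mSP_multipliers_def
  proof (intro conjI exI[of _ \<rho>] \<rho>(1))
    show "\<forall>\<^sub>F \<tau> in at_right 0. \<alpha>0 \<tau> \<in> ball 0 \<rho> \<and> ?G \<tau> (\<alpha>0 \<tau>) = 0 \<and>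
        (\<forall>\<gamma>\<in>ball 0 \<rho>. ?G \<tau> \<gamma> = 0 \<longrightarrow> \<gamma> = \<alpha>0 \<tau>)"
      using \<alpha>0 \<rho>(4)
    proof eventually_elim
      case (elim \<tau>)
      have "\<gamma> = \<alpha>0 \<tau>" if "\<gamma> \<in> ball 0 \<rho>" "?G \<tau> \<gamma> = 0" for \<gamma>
      proof -
        have "norm (\<gamma> - \<alpha>0 \<tau>) \<le> B * norm (?G \<tau> \<gamma> - ?G \<tau> (\<alpha>0 \<tau>))" using elim that by blast
        thus ?thesis using elim that by simp
      qed
      thus ?case using elim by blast
    qed
    show "(\<alpha>0 \<longlongrightarrow> 0) (at_right 0)" by (rule Lim_null_comparison[OF rate[OF \<alpha>0] tau_n])
  qed
  thus "\<exists>\<alpha>. mSP_multipliers a b s A w M (\<psi> tn) \<alpha>" by blast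
  assume \<alpha>: "mSP_multipliers a b s A w M (\<psi> tn) \<alpha>"
  \<comment> \<open>The given branch may come with a different radius; since it tends to 0 it
    eventually enters the ball of radius rho, where the rate holds.\<close>
  have "(\<alpha> \<longlongrightarrow> 0) (at_right 0)" using \<alpha> by (simp add: mSP_multipliers_def)
  hence "\<forall>\<^sub>F \<tau> in at_right 0. dist (\<alpha> \<tau>) 0 < \<rho>" using \<rho>(1) by (rule tendstoD)
  moreover have "\<forall>\<^sub>F \<tau> in at_right 0. ?G \<tau> (\<alpha> \<tau>) = 0"
    using \<alpha> unfolding mSP_multipliers_def by (auto elim: eventually_mono)
  ultimately have "\<forall>\<^sub>F \<tau> in at_right 0. \<alpha> \<tau> \<in> ball 0 \<rho> \<and> ?G \<tau> (\<alpha> \<tau>) = 0"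
    by eventually_elim (simp add: dist_commute)
  note \<alpha>_rate = rate[OF this]
  define K3 where "K3 = (\<Sum>j\<in>UNIV. norm (g j 0)) + 1"
  have "((\<lambda>\<tau>. \<Sum>j\<in>UNIV. norm (g j \<tau>)) \<longlongrightarrow> (\<Sum>j\<in>UNIV. norm (g j 0))) (at_right 0)"
  proof (intro tendsto_sum tendsto_norm)
    show "(g j \<longlongrightarrow> g j 0) (at_right 0)" for j
      using tendsto_fst[OF expd_tendsto_pair[OF g_expd[of j]]] by simp
  qed
  hence ev_K3: "\<forall>\<^sub>F \<tau> in at_right 0. (\<Sum>j\<in>UNIV. norm (g j \<tau>)) < K3"
    by (rule order_tendstoD) (simp add: K3_def)
  have "\<forall>\<^sub>F \<tau> in at_right 0. norm (L2_norm_on a b (\<lambda>x. mSP_update a b s A w M (\<psi> tn) \<tau> ((1 / \<tau>) *\<^sub>R \<alpha> \<tau>) x - \<psi> (tn + \<tau>) x))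
      \<le> (sqrt (b - a) * (C1 + B * C2 * K3)) * norm (\<tau> ^ (min p (M + 1) + 1))"
    using \<alpha>_rate ev_K3 ev_T regular(1)
  proof eventually_elim
    case (elim \<tau>)
    have tI: "tn + \<tau> \<in> ?I" using elim(3) by auto
    have num_v: "num \<tau> \<in> W 2" "v \<tau> \<in> W 2" "nrm 2 (num \<tau> - v \<tau>) \<le> C1 * \<tau> ^ n" using C1(3)[of \<tau>] elim(3) by auto
    let ?S = "\<Sum>j\<in>UNIV. (\<alpha> \<tau> $ j) *\<^sub>R g j \<tau>"
    have upd: "mSP_update a b s A w M (\<psi> tn) \<tau> ((1 / \<tau>) *\<^sub>R \<alpha> \<tau>) = ev a b (P \<tau> + ?S)"
      unfolding \<psi>u P_def num_def g_def by (rule mSP_update_ev) (use elim in auto)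
    have "(\<lambda>x. mSP_update a b s A w M (\<psi> tn) \<tau> ((1 / \<tau>) *\<^sub>R \<alpha> \<tau>) x - \<psi> (tn + \<tau>) x) =
        ev a b (P \<tau> + ?S - \<Psi> (tn + \<tau>))"
      unfolding upd \<psi>[OF tI] by (rule ext) (simp only: ev_minus)
    hence "L2_norm_on a b (\<lambda>x. mSP_update a b s A w M (\<psi> tn) \<tau> ((1 / \<tau>) *\<^sub>R \<alpha> \<tau>) x - \<psi> (tn + \<tau>) x)
        \<le> sqrt (b - a) * norm (P \<tau> + ?S - \<Psi> (tn + \<tau>))"
      by (simp only: L2_norm_ev_le)
    also have "\<dots> \<le> sqrt (b - a) * (C1 * \<tau> ^ n + B * C2 * \<tau> ^ n * K3)"
    proof (rule mult_left_mono)
      have eq: "P \<tau> + ?S - \<Psi> (tn + \<tau>) = eL \<tau> (num \<tau> - v \<tau>) + ?S" by (simp add: P_def \<Psi>v eL_minus)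
      have 1: "norm (eL \<tau> (num \<tau> - v \<tau>)) \<le> C1 * \<tau> ^ n"
        using norm_le_nrm[of "num \<tau> - v \<tau>" 2] num_v by fastforce
      have 2: "norm ?S \<le> B * C2 * \<tau> ^ n * K3"
        using elim(1,2) \<rho>(2) C2 elim(3)
        by (intro order_trans[OF norm_sum_component_le] mult_mono) (auto simp: sum_nonneg)
      show "norm (P \<tau> + ?S - \<Psi> (tn + \<tau>)) \<le> C1 * \<tau> ^ n + B * C2 * \<tau> ^ n * K3"
        unfolding eq by (rule norm_triangle_mono[OF 1 2])
    qed (use ab in simp)
    finally have le: "L2_norm_on a b (\<lambda>x. mSP_update a b s A w M (\<psi> tn) \<tau> ((1 / \<tau>) *\<^sub>R \<alpha> \<tau>) x - \<psi> (tn + \<tau>) x)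
        \<le> (sqrt (b - a) * (C1 + B * C2 * K3)) * \<tau> ^ n" by (simp add: algebra_simps)
    \<comment> \<open>A non-integrable integrand has integral 0 by convention, so nonnegativity
      holds for every function.\<close>
    have nn: "0 \<le> L2_norm_on a b f" for f
      unfolding L2_norm_on_def
      by (cases "(\<lambda>x. (cmod (f x))\<^sup>2) integrable_on {a..b}")
         (auto intro!: integral_nonneg simp: not_integrable_integral)
    have "norm (\<tau> ^ (min p (M + 1) + 1)) = \<tau> ^ n" using elim(3) by (simp add: n_def power_abs abs_mult)
    thus ?case using le nn by simp
  qed
  thus "(\<lambda>\<tau>. L2_norm_on a b (\<lambda>x. mSP_update a b s A w M (\<psi> tn) \<tau> ((1 / \<tau>) *\<^sub>R \<alpha> \<tau>) x - \<psi> (tn + \<tau>) x))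
        \<in> O[at_right 0](\<lambda>\<tau>. \<tau> ^ (min p (M + 1) + 1))"
    by (rule bigoI)
qed

end

theorem theorem3p3:
  fixes M p :: nat
  assumes "M > 0" and "p > 0"
  shows "\<exists>r0 :: real. \<forall>r \<ge> r0.
    \<forall>(s :: nat) (A :: nat \<Rightarrow> nat \<Rightarrow> real) (w :: nat \<Rightarrow> real) (a :: real) (b :: real)
      (tn :: real) (T0 :: real) (\<psi> :: real \<Rightarrow> real \<Rightarrow> complex).
      s > 0 \<longrightarrow> rk_order s A w p \<longrightarrow> a < b \<longrightarrow> T0 > 0 \<longrightarrow>
      C_H_per a b r {tn..tn + T0} \<psi> \<longrightarrow>
      dnls_solution {tn..tn + T0} \<psi> \<longrightarrow>
      det (jacobian (\<lambda>\<alpha>. mSP_G a b s A w M (\<psi> tn) 0 \<alpha>) (at 0)) \<noteq> 0 \<longrightarrow>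
      (\<exists>\<alpha>. mSP_multipliers a b s A w M (\<psi> tn) \<alpha>) \<and>
      (\<forall>\<alpha>. mSP_multipliers a b s A w M (\<psi> tn) \<alpha> \<longrightarrow>
        (\<lambda>\<tau>. L2_norm_on a b (\<lambda>x.
            mSP_update a b s A w M (\<psi> tn) \<tau> ((1 / \<tau>) *\<^sub>R \<alpha> \<tau>) x - \<psi> (tn + \<tau>) x))
          \<in> O[at_right 0](\<lambda>\<tau>. \<tau> ^ (min p (M + 1) + 1)))"
\<comment> \<open>The threshold is the number of weights spent plus the unit lost in the embedding
  of the Sobolev space. It depends on \<open>M\<close> alone, because the order of the expansions
  never exceeds M + 2.\<close>
proof (intro exI[of _ "real (10 + (M + 2) * (4 * (M + 2) + 1)) + 1"] allI impI)
  fix r s A w a b tn T0 \<psi>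
  assume *: "real (10 + (M + 2) * (4 * (M + 2) + 1)) + 1 \<le> r" "rk_order s A w p" "a < b" "T0 > 0"
    "C_H_per a b r {tn..tn + T0} \<psi>" "dnls_solution {tn..tn + T0} \<psi>"
    "det (jacobian (\<lambda>\<alpha>. mSP_G a b s A w M (\<psi> tn) 0 \<alpha>) (at 0)) \<noteq> 0"
  interpret torus a b by (rule torus.intro) (rule *(3))
  note mSP = mSP_order[OF *(2,4,5,6,1,7)]
  show "(\<exists>\<alpha>. mSP_multipliers a b s A w M (\<psi> tn) \<alpha>) \<and>
      (\<forall>\<alpha>. mSP_multipliers a b s A w M (\<psi> tn) \<alpha> \<longrightarrow>
        (\<lambda>\<tau>. L2_norm_on a b (\<lambda>x.
            mSP_update a b s A w M (\<psi> tn) \<tau> ((1 / \<tau>) *\<^sub>R \<alpha> \<tau>) x - \<psi> (tn + \<tau>) x))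
          \<in> O[at_right 0](\<lambda>\<tau>. \<tau> ^ (min p (M + 1) + 1)))"
    using mSP by blast
qed

end
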